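(* Let $\mu=\sum_{\lambda\in\Lambda}a_\lambda\delta_\lambda$ be a uniformly discrete Fourier quasicrystal on $\mathbb{R}^d$ whose Fourier transform $\hat\mu$ is a translation bounded measure. Suppose that $h(z)$ is a holomorphic function on a neighborhood of the closure of the set $\{a_\lambda:\lambda\in\Lambda\}\subset\mathbb{C}$. Then $\nu=\sum_{\lambda\in\Lambda}a_\lambda h(a_\lambda)\delta_\lambda$ is also a Fourier quasicrystal, and $\hat\nu$ is a translation bounded measure.
   Context: Notation: $B(x,r)=\{y\in\mathbb{R}^d:|y-x|<r\}$, $B(r)=B(0,r)$; $\delta_z$ is the unit mass at $z$; $|\nu|$ is the variation of a measure $\nu$. A set $E\subset\mathbb{R}^d$ is uniformly discrete if there is $\varepsilon>0$ with $|x-x'|\ge\varepsilon$ for all distinct $x,x'\in E$; a measure is uniformly discrete if its support is. Measures are complex Radon measures. A measure $\mu$ is translation bounded if $\sup_{x\in\mathbb{R}^d}|\mu|(B(x,1))<\infty$, and slowly increasing if $|\mu|(B(r))$ grows at most polynomially as $r\to\infty$; slowly increasing measures are tempered distributions. The Fourier transform of $f\in S'(\mathbb{R}^d)$ is defined by $\hat f(\varphi)=f(\hat\varphi)$ for $\varphi\in S(\mathbb{R}^d)$, where $\hat\varphi(y)=\int_{\mathbb{R}^d}\varphi(x)e^{-2\pi i\langle x,y\rangle}dx$. A measure $\mu$ is a Fourier quasicrystal if both $\mu$ and $\hat\mu$ are slowly increasing atomic measures, i.e. $\mu=\sum_{\lambda\in\Lambda}a_\lambda\delta_\lambda$, $\hat\mu=\sum_{\gamma\in\Gamma}b_\gamma\delta_\gamma$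 with countable sets $\Lambda,\Gamma$, nonzero coefficients, and $\sum_{|\lambda|<r}|a_\lambda|+\sum_{|\gamma|<r}|b_\gamma|$ growing at most polynomially as $r\to\infty$. $\Lambda$ is called the support of $\mu$. *)

theory Defs
  imports "HOL-Analysis.Analysis"
begin

(* Iterated partial derivatives; the head of the list is differentiated last. *)
primrec iter_partial ::
  "'a::euclidean_space list \<Rightarrow> ('a \<Rightarrow> complex) \<Rightarrow> 'a \<Rightarrow> complex" where
  "iter_partial [] f = f"
| "iter_partial (v # vs) f = (\<lambda>x. frechet_derivative (iter_partial vs f) (at x) v)"

(* Requiring every iterated partial derivative to be (Frechet) differentiable gives
   smoothness, since each of them is then continuous. *)
definition schwartz :: "('a::euclidean_space \<Rightarrow> complex) \<Rightarrow> bool" where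
  "schwartz f \<longleftrightarrow>
     (\<forall>vs \<in> lists Basis.
        (\<forall>x. iter_partial vs f differentiable (at x)) \<and>
        (\<forall>n. bounded (range (\<lambda>x. (1 + norm x) ^ n *\<^sub>R iter_partial vs f x))))"

definition fourier :: "('a::euclidean_space \<Rightarrow> complex) \<Rightarrow> 'a \<Rightarrow> complex" where
  "fourier \<phi> y =
     (LINT x|lborel. \<phi> x * exp (- (2 * of_real pi * \<i> * of_real (inner x y))))"

(* Distributions are functionals of which only the values on Schwartz functions matter. *)
type_synonym 'a distribution = "('a \<Rightarrow> complex) \<Rightarrow> complex"

definition distr_eq :: "'a::euclidean_space distribution \<Rightarrow> 'a distribution \<Rightarrow> bool" where
  "distr_eq S T \<longleftrightarrow> (\<forall>\<phi>. schwartz \<phi> \<longrightarrow> S \<phi> = T \<phi>)"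

definition fourier_distr :: "'a::euclidean_space distribution \<Rightarrow> 'a distribution" where
  "fourier_distr T = (\<lambda>\<phi>. T (fourier \<phi>))"

(* The atomic measure sum_x a(x) delta_x is represented by its mass function a, so that the
   coefficients are automatically nonzero on the set of atoms. *)
type_synonym 'a mass = "'a \<Rightarrow> complex"

definition atoms :: "'a mass \<Rightarrow> 'a set" where
  "atoms a = {x. a x \<noteq> 0}"

(* |mu| = sum_x |a(x)| delta_x, as a measure defined on all subsets. *)
definition variation :: "'a mass \<Rightarrow> 'a measure" where
  "variation a = density (count_space UNIV) (\<lambda>x. ennreal (norm (a x)))"

(* Radon measure: the variation is finite on bounded sets. *)
definition atomic_measure :: "'a::euclidean_space mass \<Rightarrow> bool" where
  "atomic_measure a \<longleftrightarrow>
     countable (atoms a) \<and> (\<forall>r. emeasure (variation a) (ball 0 r) < \<infinity>)"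

definition slowly_increasing :: "'a::euclidean_space mass \<Rightarrow> bool" where
  "slowly_increasing a \<longleftrightarrow>
     (\<exists>C N. \<forall>\<^sub>F r in at_top. emeasure (variation a) (ball 0 r) \<le> ennreal (C * r ^ N))"

definition translation_bounded :: "'a::euclidean_space mass \<Rightarrow> bool" where
  "translation_bounded a \<longleftrightarrow> (SUP x. emeasure (variation a) (ball x 1)) < \<infinity>"

(* For slowly increasing a the sum converges absolutely on Schwartz functions. *)
definition distr_of :: "'a::euclidean_space mass \<Rightarrow> 'a distribution" where
  "distr_of a = (\<lambda>\<phi>. \<Sum>\<^sub>\<infinity>x\<in>atoms a. a x * \<phi> x)"

(* The Fourier transform of the distribution given by a is the slowly increasing atomic
   measure with mass function b. *)
definition fourier_measure :: "'a::euclidean_space mass \<Rightarrow> 'a mass \<Rightarrow> bool" where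
  "fourier_measure a b \<longleftrightarrow>
     atomic_measure b \<and> slowly_increasing b \<and>
     distr_eq (fourier_distr (distr_of a)) (distr_of b)"

definition fourier_quasicrystal :: "'a::euclidean_space mass \<Rightarrow> bool" where
  "fourier_quasicrystal a \<longleftrightarrow>
     atomic_measure a \<and> slowly_increasing a \<and> (\<exists>b. fourier_measure a b)"

end

theory Submission
  imports
    Defs
    "HOL-Probability.Probability"
    "HOL-Complex_Analysis.Complex_Analysis"
begin

text \<open>
  The measure \<mu> with masses a has the Fourier transform with masses b.  Smearing \<mu> by a narrow
  kernel \<tau> that is supported in a ball smaller than the separation of the atoms gives a function
  F(s) = \<Sum> a(\<lambda>) \<tau>(\<lambda> - s) with F = \<tau>(0) a on the atoms.  On the Fourier side F is the absolutely
  convergent trigonometric series \<Sum> b(\<gamma>) \<psi>(\<gamma>) e(\<gamma> \<bullet> s), where e(t) = exp(2 \<pi> i t) and \<psi> is the inverse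
  Fourier transform of \<tau>: the coefficients are summable because b is translation bounded and \<psi> is
  dominated by an integrable, slowly varying weight.  Hence a is the restriction to the atoms of a
  function in the Wiener algebra W of all absolutely convergent series \<Sum> c_n e(\<omega>_n \<bullet> x)
  (lemma \<open>atoms_value_in_wiener\<close>).

  A local Wiener-Levy theorem (\<open>local_wiener_levy\<close>) then produces g in W with g = h(a) on the atoms,
  although h is holomorphic only near the closure of the values at the atoms and F takes other values
  elsewhere.  Finally the measure with masses a h(a) = a g has the Fourier transform
  \<Sum> c_n (translate of b by \<omega>_n), because multiplication by a character on one side is a translation on
  the other; as \<Sum> |c_n| is finite, this is again a translation bounded measure
  (\<open>wiener_multiplier\<close>).

  The local Wiener-Levy theorem rests on one explicit non-analytic element of W.  The binomial series
  |sin t| = \<Sum> (1/2 choose n) (- cos^2 t)^n converges absolutely in W, since cos has norm 1 and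
  \<Sum> |(1/2 choose n)| is finite.  From |sin| one builds piecewise linear functions of characters.
  Plateau functions, equal to 1 near a point of the circle and to 0 away from it, serve to glue local
  solutions.  Clipped functions agree with e(\<omega> \<bullet> x) - z where this is small, and have small norm in W.
  So every f in W differs, on a region where finitely many characters are almost constant, from a
  constant f(x0) by an element of small norm, and there h(f) is the Taylor series of h at f(x0),
  convergent in W.
\<close>

section \<open>The Wiener algebra and a local Wiener-Levy theorem\<close>

definition character :: "'a::euclidean_space \<Rightarrow> 'a \<Rightarrow> complex" where
  "character \<omega> x = cis (2 * pi * (x \<bullet> \<omega>))"

lemma norm_character [simp]: "norm (character \<omega> x) = 1"
  by (simp add: character_def)

lemma character_0 [simp]: "character 0 x = 1"
  by (simp add: character_def)

lemma character_add: "character (\<omega> + \<eta>) x = character \<omega> x * character \<eta> x"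
  by (simp add: character_def cis_mult inner_add_right algebra_simps)

lemma character_commute: "character \<omega> x = character x \<omega>"
  by (simp add: character_def inner_commute)

lemma character_add_point: "character \<omega> (x + y) = character \<omega> x * character \<omega> y"
  by (simp only: character_commute[of \<omega>] character_add)

text \<open>
  The function f belongs to the Wiener algebra and has norm at most r there.  Generating the algebra
  inductively, instead of carrying frequencies and coefficients around, turns every statement about
  it (multiplicativity, localization, the action on measures) into an induction whose only
  substantial cases are a single character and a convergent series.
\<close>

inductive wiener_le :: "('a::euclidean_space \<Rightarrow> complex) \<Rightarrow> real \<Rightarrow> bool" where
  character: "wiener_le (character \<omega>) 1"
| scale: "wiener_le f r \<Longrightarrow> wiener_le (\<lambda>x. k * f x) (norm k * r)"
| series: "(\<And>n::nat. wiener_le (f n) (r n)) \<Longrightarrow> summable r \<Longrightarrow>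
    wiener_le (\<lambda>x. \<Sum>n. f n x) (suminf r)"
| mono: "wiener_le f r \<Longrightarrow> r \<le> s \<Longrightarrow> wiener_le f s"

lemma wiener_le_norm: "wiener_le f r \<Longrightarrow> norm (f x) \<le> r"
proof (induction rule: wiener_le.induct)
  case (scale f r k)
  then show ?case by (simp add: norm_mult mult_left_mono)
next
  case (series f r)
  have "summable (\<lambda>n. norm (f n x))"
    by (rule summable_comparison_test'[OF series.hyps(2), of 0]) (use series.IH in auto)
  then have "norm (\<Sum>n. f n x) \<le> (\<Sum>n. norm (f n x))" by (rule summable_norm)
  also have "\<dots> \<le> suminf r"
    by (rule suminf_le) (use series \<open>summable (\<lambda>n. norm (f n x))\<close> in auto)
  finally show ?case .
qed auto

lemma wiener_le_nonneg: "wiener_le f r \<Longrightarrow> 0 \<le> r"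
  using wiener_le_norm[of f r 0] norm_ge_zero order_trans by blast

lemma wiener_le_const: "wiener_le (\<lambda>x. k) (norm k)"
  using wiener_le.scale[OF wiener_le.character[of 0], of k] by simp

lemma wiener_le_zero: "wiener_le (\<lambda>x. 0) 0"
  using wiener_le_const[of 0] by simp

lemma wiener_le_add:
  assumes "wiener_le f r" "wiener_le g s"
  shows "wiener_le (\<lambda>x. f x + g x) (r + s)"
proof -
  define F where "F n = (if n = 0 then f else if n = 1 then g else (\<lambda>x. 0))" for n :: nat
  define R where "R n = (if n = 0 then r else if n = 1 then s else 0)" for n :: nat
  have "wiener_le (F n) (R n)" for n
    using assms wiener_le_zero by (auto simp add: F_def R_def)
  moreover have R: "R sums (\<Sum>n\<in>{0,1}. R n)"
    by (rule sums_finite) (auto simp: R_def)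
  moreover have "(\<lambda>n. F n x) sums (\<Sum>n\<in>{0,1}. F n x)" for x
    by (rule sums_finite) (auto simp: F_def)
  ultimately have "wiener_le (\<lambda>x. \<Sum>n\<in>{0,1}. F n x) (\<Sum>n\<in>{0,1}. R n)"
    using wiener_le.series[of F R] by (simp add: sums_iff)
  then show ?thesis by (simp add: F_def R_def)
qed

lemma wiener_le_uminus: "wiener_le f r \<Longrightarrow> wiener_le (\<lambda>x. - f x) r"
  using wiener_le.scale[of f r "-1"] by simp

lemma wiener_le_diff:
  "wiener_le f r \<Longrightarrow> wiener_le g s \<Longrightarrow> wiener_le (\<lambda>x. f x - g x) (r + s)"
  using wiener_le_add[OF _ wiener_le_uminus, of f r g s] by simp

lemma wiener_le_sum:
  "finite A \<Longrightarrow> (\<And>i. i \<in> A \<Longrightarrow> wiener_le (f i) (r i)) \<Longrightarrow>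
    wiener_le (\<lambda>x. \<Sum>i\<in>A. f i x) (\<Sum>i\<in>A. r i)"
proof (induction A rule: finite_induct)
  case empty
  then show ?case using wiener_le_zero by simp
qed (simp add: wiener_le_add)

lemma wiener_le_summable:
  assumes "\<And>n. wiener_le (f n) (r n)" "summable r"
  shows "summable (\<lambda>n. f n x)"
  by (rule summable_comparison_test'[OF assms(2), of 0]) (use assms(1) wiener_le_norm in blast)

lemma wiener_le_character_mult:
  "wiener_le g s \<Longrightarrow> wiener_le (\<lambda>x. character \<omega> x * g x) s"
proof (induction rule: wiener_le.induct)
  case (character \<eta>)
  have "(\<lambda>x. character \<omega> x * character \<eta> x) = character (\<omega> + \<eta>)"
    by (simp add: fun_eq_iff character_add)
  then show ?case using wiener_le.character by metis
next
  case (scale g s k)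
  then show ?case using wiener_le.scale[OF scale.IH, of k] by (simp add: algebra_simps)
next
  case (series g s)
  show ?case
    using wiener_le.series[OF series.IH series.hyps(2)]
      wiener_le_summable[OF series.hyps] by (simp add: suminf_mult)
qed (auto intro: wiener_le.mono)

lemma wiener_le_mult:
  assumes "wiener_le f r" "wiener_le g s"
  shows "wiener_le (\<lambda>x. f x * g x) (r * s)"
  using assms
proof (induction rule: wiener_le.induct)
  case (character \<omega>)
  then show ?case using wiener_le_character_mult by simp
next
  case (scale f r k)
  then show ?case using wiener_le.scale[of "\<lambda>x. f x * g x" "r * s" k] by (simp add: algebra_simps)
next
  case (series f r)
  have "wiener_le (\<lambda>x. \<Sum>n. f n x * g x) (\<Sum>n. r n * s)"
    using series by (intro wiener_le.series summable_mult2) auto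
  then show ?case
    using wiener_le_summable[OF series.hyps(1,2)] series.hyps(2)
    by (simp add: suminf_mult2 [symmetric])
next
  case (mono f r r')
  then show ?case
    using wiener_le_nonneg[OF mono.prems] by (auto intro: wiener_le.mono mult_right_mono)
qed

lemma wiener_le_power: "wiener_le f r \<Longrightarrow> wiener_le (\<lambda>x. f x ^ n) (r ^ n)"
proof (induction n)
  case 0
  then show ?case using wiener_le_const[of 1] by simp
qed (simp add: wiener_le_mult)

text \<open>
  The bound grows only linearly in n; against the summable coefficients of the binomial series this
  gives the continuity of translations of |sin| below.
\<close>

lemma wiener_le_power_diff:
  assumes "wiener_le u 1" "wiener_le v 1" "wiener_le (\<lambda>x. u x - v x) d"
  shows "wiener_le (\<lambda>x. u x ^ n - v x ^ n) (real n * d)"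
proof (induction n)
  case 0
  then show ?case using wiener_le_const[of 0] by simp
next
  case (Suc n)
  have "wiener_le (\<lambda>x. u x * (u x ^ n - v x ^ n) + (u x - v x) * v x ^ n) (1 * (real n * d) + d * 1 ^ n)"
    using assms Suc by (intro wiener_le_add wiener_le_mult wiener_le_power) auto
  then show ?case by (simp add: algebra_simps)
qed

text \<open>
  The Taylor coefficients at 0 of sqrt (1 - y).
\<close>

definition sqrt_coeff :: "nat \<Rightarrow> real" where
  "sqrt_coeff n = ((1/2) gchoose n) * (-1) ^ n"

lemma sqrt_coeff_0 [simp]: "sqrt_coeff 0 = 1"
  by (simp add: sqrt_coeff_def)

lemma sqrt_coeff_Suc: "sqrt_coeff (Suc n) = sqrt_coeff n * ((real n - 1/2) / (real n + 1))"
proof -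
  have "((1/2) gchoose n) * (1/2 - real n) = (real n + 1) * ((1/2) gchoose Suc n)"
    using gbinomial_mult_1[of "1/2 :: real" n] by (simp add: algebra_simps)
  then have "((1/2) gchoose Suc n) = ((1/2) gchoose n) * (1/2 - real n) / (real n + 1)"
    by (simp add: field_simps)
  then have "sqrt_coeff (Suc n) = - (((1/2) gchoose n) * (1/2 - real n) / (real n + 1)) * (-1) ^ n"
    by (simp add: sqrt_coeff_def)
  also have "\<dots> = sqrt_coeff n * ((real n - 1/2) / (real n + 1))"
    by (simp add: sqrt_coeff_def algebra_simps diff_divide_distrib add_divide_distrib)
  finally show ?thesis .
qed

lemma sqrt_coeff_nonpos: "sqrt_coeff (Suc n) \<le> 0"
proof (induction n)
  case 0
  then show ?case by (simp add: sqrt_coeff_Suc)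
next
  case (Suc n)
  have "sqrt_coeff (Suc (Suc n)) = sqrt_coeff (Suc n) * ((real (Suc n) - 1/2) / (real (Suc n) + 1))"
    by (rule sqrt_coeff_Suc)
  moreover have "0 \<le> (real (Suc n) - 1/2) / (real (Suc n) + 1)" by simp
  ultimately show ?case using Suc by (metis mult_nonpos_nonneg)
qed

lemma sqrt_coeff_sums_less:
  assumes "0 \<le> y" "y < 1"
  shows "(\<lambda>n. sqrt_coeff n * y ^ n) sums sqrt (1 - y)"
proof -
  have "(\<lambda>n. ((1/2) gchoose n) * (- y) ^ n) sums (1 + - y) powr (1/2)"
    using assms by (intro gen_binomial_real) auto
  moreover have "(- y) ^ n = (-1) ^ n * y ^ n" for n
    by (metis mult_minus1 power_mult_distrib)
  ultimately show ?thesis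
    using assms by (simp add: sqrt_coeff_def powr_half_sqrt mult.assoc)
qed

text \<open>
  All coefficients but the first have the same sign, and sqrt (1 - y) \<ge> 0 for y < 1.  So the partial
  sums of their absolute values are at most 1, first with the factors y^n and then, for y \<rightarrow> 1,
  without them.
\<close>

lemma summable_sqrt_coeff: "summable (\<lambda>n. \<bar>sqrt_coeff n\<bar>)"
proof -
  have partial: "(\<Sum>n<N. \<bar>sqrt_coeff (Suc n)\<bar> * y ^ Suc n) \<le> 1" if y: "0 \<le> y" "y < 1" for N y
  proof -
    have "(\<lambda>n. sqrt_coeff (Suc n) * y ^ Suc n) sums (sqrt (1 - y) - 1)"
      using sqrt_coeff_sums_less[OF y] by (subst sums_Suc_iff) simp
    then have s: "(\<lambda>n. \<bar>sqrt_coeff (Suc n)\<bar> * y ^ Suc n) sums (1 - sqrt (1 - y))"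
      using sums_minus sqrt_coeff_nonpos by (fastforce simp: abs_of_nonpos)
    have "(\<Sum>n<N. \<bar>sqrt_coeff (Suc n)\<bar> * y ^ Suc n) \<le> 1 - sqrt (1 - y)"
      using sum_le_suminf[OF sums_summable[OF s], of "{..<N}"] sums_unique[OF s] y by simp
    also have "\<dots> \<le> 1" using y by simp
    finally show ?thesis .
  qed
  have "(\<Sum>n<N. \<bar>sqrt_coeff (Suc n)\<bar>) \<le> 1" for N
  proof (rule tendsto_upperbound)
    show "((\<lambda>y. \<Sum>n<N. \<bar>sqrt_coeff (Suc n)\<bar> * y ^ Suc n) \<longlongrightarrow> (\<Sum>n<N. \<bar>sqrt_coeff (Suc n)\<bar>)) (at_left 1)"
      by (rule tendsto_eq_intros | simp)+
    show "\<forall>\<^sub>F y in at_left 1. (\<Sum>n<N. \<bar>sqrt_coeff (Suc n)\<bar> * y ^ Suc n) \<le> 1"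
      using eventually_at_left_field[of _ "1::real"] partial
      by (intro eventually_at_leftI[of 0]) auto
  qed auto
  then have "summable (\<lambda>n. \<bar>sqrt_coeff (Suc n)\<bar>)"
    by (intro summableI_nonneg_bounded[where x = 1]) auto
  then show ?thesis using summable_Suc_iff[of "\<lambda>n. \<bar>sqrt_coeff n\<bar>"] by simp
qed

text \<open>
  By absolute convergence at y = 1 both sides are continuous on [0, 1], so the equality extends from
  [0, 1) to the end point.  The end point matters: cos^2 t = 1 is where |sin t| fails to be smooth.
\<close>

lemma sqrt_coeff_sums:
  assumes "0 \<le> y" "y \<le> 1"
  shows "(\<lambda>n. sqrt_coeff n * y ^ n) sums sqrt (1 - y)"
proof -
  have bound: "norm (sqrt_coeff n * z ^ n) \<le> \<bar>sqrt_coeff n\<bar>" if "z \<in> {0..1}" for n and z :: real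
    using that by (auto simp: abs_mult power_abs mult_left_le power_le_one)
  have "uniform_limit {0..1} (\<lambda>N z. \<Sum>n<N. sqrt_coeff n * z ^ n) (\<lambda>z. \<Sum>n. sqrt_coeff n * z ^ n) sequentially"
    by (rule Weierstrass_m_test[OF bound summable_sqrt_coeff])
  then have "continuous_on {0..1} (\<lambda>z. \<Sum>n. sqrt_coeff n * z ^ n)"
    by (rule uniform_limit_theorem[rotated]) (auto intro!: always_eventually continuous_intros)
  then have "continuous_on (closure {0..<1}) (\<lambda>z. (\<Sum>n. sqrt_coeff n * z ^ n) - sqrt (1 - z))"
    by (auto intro!: continuous_intros)
  then have "(\<Sum>n. sqrt_coeff n * y ^ n) - sqrt (1 - y) = 0"
    by (rule continuous_constant_on_closure)
      (use assms sqrt_coeff_sums_less in \<open>auto simp: sums_iff\<close>)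
  moreover have "summable (\<lambda>n. sqrt_coeff n * y ^ n)"
    by (rule summable_comparison_test'[OF summable_sqrt_coeff, of 0]) (use bound[of y] assms in auto)
  ultimately show ?thesis by (simp add: sums_iff)
qed

lemma abs_sin_sums: "(\<lambda>n. sqrt_coeff n * cos t ^ (2 * n)) sums \<bar>sin t\<bar>"
proof -
  have "(\<lambda>n. sqrt_coeff n * (cos t ^ 2) ^ n) sums sqrt (1 - cos t ^ 2)"
    by (rule sqrt_coeff_sums) (auto simp: abs_square_le_1)
  then show ?thesis by (simp add: power_mult sin_squared_eq[symmetric])
qed

definition phase :: "'a::euclidean_space \<Rightarrow> real \<Rightarrow> 'a \<Rightarrow> real" where
  "phase \<omega> \<beta> x = 2 * pi * (x \<bullet> \<omega>) + \<beta>"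

lemma cos_phase:
  "complex_of_real (cos (phase \<omega> \<beta> x)) =
     (cis \<beta> / 2) * character \<omega> x + (cis (- \<beta>) / 2) * character (- \<omega>) x"
  by (simp add: phase_def character_def complex_eq_iff cos_add sin_add add_divide_distrib diff_divide_distrib)

lemma wiener_le_cos: "wiener_le (\<lambda>x. complex_of_real (cos (phase \<omega> \<beta> x))) 1"
proof -
  have "wiener_le (\<lambda>x. (cis \<beta> / 2) * character \<omega> x + (cis (- \<beta>) / 2) * character (- \<omega>) x)
    (norm (cis \<beta> / 2) * 1 + norm (cis (- \<beta>) / 2) * 1)"
    by (intro wiener_le_add wiener_le.scale wiener_le.character)
  then show ?thesis by (simp add: cos_phase norm_divide)
qed

lemma cis_diff: "cis s - cis t = 2 * \<i> * complex_of_real (sin ((s - t) / 2)) * cis ((s + t) / 2)"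
proof -
  have "sin ((t - s) / 2) = - sin ((s - t) / 2)"
    by (metis minus_diff_eq minus_divide_left sin_minus)
  then show ?thesis
    by (simp add: complex_eq_iff cos_diff_cos sin_diff_sin)
qed

lemma norm_cis_diff: "norm (cis s - cis t) = 2 * \<bar>sin ((s - t) / 2)\<bar>"
  by (simp add: cis_diff norm_mult)

lemma norm_cis_diff_le: "norm (cis s - cis t) \<le> \<bar>s - t\<bar>"
  using abs_sin_x_le_abs_x[of "(s - t) / 2"] by (simp add: norm_cis_diff)

lemma wiener_le_cos_diff:
  "wiener_le (\<lambda>x. complex_of_real (cos (phase \<omega> \<beta> x)) - cos (phase \<omega> \<beta>' x)) \<bar>\<beta> - \<beta>'\<bar>"
proof -
  have "wiener_le (\<lambda>x. ((cis \<beta> - cis \<beta>') / 2) * character \<omega> x +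
      ((cis (- \<beta>) - cis (- \<beta>')) / 2) * character (- \<omega>) x)
    (norm ((cis \<beta> - cis \<beta>') / 2) * 1 + norm ((cis (- \<beta>) - cis (- \<beta>')) / 2) * 1)"
    by (intro wiener_le_add wiener_le.scale wiener_le.character)
  moreover have "norm ((cis \<beta> - cis \<beta>') / 2) * 1 + norm ((cis (- \<beta>) - cis (- \<beta>')) / 2) * 1 \<le> \<bar>\<beta> - \<beta>'\<bar>"
    using norm_cis_diff_le[of \<beta> \<beta>'] norm_cis_diff_le[of "-\<beta>" "-\<beta>'"] by (simp add: norm_divide)
  ultimately show ?thesis
    by (rule wiener_le.mono[THEN back_subst[where P = "\<lambda>f. wiener_le f _"]])
      (simp add: cos_phase fun_eq_iff algebra_simps diff_divide_distrib)
qed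

text \<open>
  The bound for the norm of |sin| in the Wiener algebra, since cos has norm 1.
\<close>

definition sqrt_bound :: real where
  "sqrt_bound = (\<Sum>n. \<bar>sqrt_coeff n\<bar>)"

lemma sqrt_bound_ge_1: "1 \<le> sqrt_bound"
  using sum_le_suminf[OF summable_sqrt_coeff, of "{0}"] by (simp add: sqrt_bound_def)

lemma wiener_le_abs_sin: "wiener_le (\<lambda>x. complex_of_real \<bar>sin (phase \<omega> \<beta> x)\<bar>) sqrt_bound"
proof -
  have "wiener_le (\<lambda>x. \<Sum>n. complex_of_real (sqrt_coeff n) * complex_of_real (cos (phase \<omega> \<beta> x)) ^ (2 * n))
    (\<Sum>n. norm (complex_of_real (sqrt_coeff n)) * 1 ^ (2 * n))"
    using summable_sqrt_coeff
    by (intro wiener_le.series wiener_le.scale wiener_le_power wiener_le_cos) simp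
  moreover have "(\<lambda>n. complex_of_real (sqrt_coeff n) * complex_of_real (cos (phase \<omega> \<beta> x)) ^ (2 * n))
      sums complex_of_real \<bar>sin (phase \<omega> \<beta> x)\<bar>" for x :: 'a
    using sums_of_real[OF abs_sin_sums[of "phase \<omega> \<beta> x"], where 'a = complex] by simp
  ultimately show ?thesis by (simp add: sums_iff sqrt_bound_def)
qed

text \<open>
  Translation is continuous in the Wiener norm.  Term by term in the binomial series the difference
  has norm at most 2 n \<delta> and at most 2; the first bound is used for the finitely many terms below N and
  the second for the tail.  The choice of \<delta> is uniform in the frequency and in the phases.
\<close>

lemma wiener_le_abs_sin_diff:
  assumes "0 < \<epsilon>"
  obtains \<delta> where "0 < \<delta>"
    "\<And>(\<omega> :: 'a::euclidean_space) \<beta> \<beta>'. \<bar>\<beta> - \<beta>'\<bar> \<le> \<delta> \<Longrightarrow>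
      wiener_le (\<lambda>x. complex_of_real \<bar>sin (phase \<omega> \<beta> x)\<bar> - complex_of_real \<bar>sin (phase \<omega> \<beta>' x)\<bar>) \<epsilon>"
proof -
  obtain N where "norm (\<Sum>i. \<bar>sqrt_coeff (i + N)\<bar>) < \<epsilon> / 4"
    using suminf_exist_split[OF _ summable_sqrt_coeff, of "\<epsilon> / 4"] assms by auto
  then have N: "(\<Sum>i. \<bar>sqrt_coeff (i + N)\<bar>) \<le> \<epsilon> / 4" by simp
  define \<delta> where "\<delta> = \<epsilon> / (4 * (real N + 1) * sqrt_bound)"
  have \<delta>: "0 < \<delta>" using assms sqrt_bound_ge_1 by (simp add: \<delta>_def)
  define r where "r n = \<bar>sqrt_coeff n\<bar> * (if n < N then real (2 * n) * \<delta> else 2)" for n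
  have r_tail: "summable (\<lambda>n. r (n + N))"
    using summable_mult2[OF summable_ignore_initial_segment[OF summable_sqrt_coeff, of N], of 2]
    by (simp add: r_def)
  then have r: "summable r" using summable_iff_shift by blast
  have "(\<Sum>n<N. r n) \<le> (\<Sum>n<N. \<bar>sqrt_coeff n\<bar> * (2 * real N * \<delta>))"
    using \<delta> by (intro sum_mono) (auto simp: r_def intro!: mult_mono)
  also have "\<dots> = (\<Sum>n<N. \<bar>sqrt_coeff n\<bar>) * (2 * real N * \<delta>)"
    by (simp add: sum_distrib_right)
  also have "\<dots> \<le> sqrt_bound * (2 * real N * \<delta>)"
    using \<delta> sum_le_suminf[OF summable_sqrt_coeff, of "{..<N}"]
    by (intro mult_right_mono) (auto simp: sqrt_bound_def)
  also have "\<dots> = \<epsilon> / 2 * (real N / (real N + 1))"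
    using sqrt_bound_ge_1 by (simp add: \<delta>_def divide_simps)
  also have "\<dots> \<le> \<epsilon> / 2"
    using assms by (intro mult_left_le) (auto simp: divide_le_eq_1)
  finally have "(\<Sum>n<N. r n) \<le> \<epsilon> / 2" .
  moreover have "(\<Sum>n. r (n + N)) \<le> \<epsilon> / 2"
    using N suminf_mult2[OF summable_ignore_initial_segment[OF summable_sqrt_coeff, of N], of 2]
    by (simp add: r_def)
  ultimately have sum_r: "suminf r \<le> \<epsilon>"
    using suminf_split_initial_segment[OF r, of N] by simp
  have "wiener_le (\<lambda>x. complex_of_real \<bar>sin (phase \<omega> \<beta> x)\<bar> - complex_of_real \<bar>sin (phase \<omega> \<beta>' x)\<bar>) \<epsilon>"
    if "\<bar>\<beta> - \<beta>'\<bar> \<le> \<delta>" for \<omega> :: 'a and \<beta> \<beta>'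
  proof -
    define u v where "u x = complex_of_real (cos (phase \<omega> \<beta> x))"
      and "v x = complex_of_real (cos (phase \<omega> \<beta>' x))" for x :: 'a
    have uv: "wiener_le u 1" "wiener_le v 1" "wiener_le (\<lambda>x. u x - v x) \<delta>"
      unfolding u_def v_def using wiener_le_cos wiener_le_cos_diff that wiener_le.mono by blast+
    have "wiener_le (\<lambda>x. u x ^ (2 * n) - v x ^ (2 * n)) (real (2 * n) * \<delta>)" for n
      by (rule wiener_le_power_diff[OF uv])
    moreover have "wiener_le (\<lambda>x. u x ^ (2 * n) - v x ^ (2 * n)) (1 ^ (2 * n) + 1 ^ (2 * n))" for n
      by (intro wiener_le_diff wiener_le_power uv)
    ultimately have *: "wiener_le (\<lambda>x. u x ^ (2 * n) - v x ^ (2 * n)) (if n < N then real (2 * n) * \<delta> else 2)" for n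
      by simp
    have "wiener_le (\<lambda>x. complex_of_real (sqrt_coeff n) * (u x ^ (2 * n) - v x ^ (2 * n))) (r n)" for n
      using wiener_le.scale[OF *[of n], of "complex_of_real (sqrt_coeff n)"] by (simp only: r_def norm_of_real)
    from wiener_le.series[OF this r]
    have "wiener_le (\<lambda>x. \<Sum>n. complex_of_real (sqrt_coeff n) * (u x ^ (2 * n) - v x ^ (2 * n))) (suminf r)" .
    moreover have "(\<lambda>n. complex_of_real (sqrt_coeff n) * (u x ^ (2 * n) - v x ^ (2 * n))) sums
       (complex_of_real \<bar>sin (phase \<omega> \<beta> x)\<bar> - complex_of_real \<bar>sin (phase \<omega> \<beta>' x)\<bar>)" for x
      using sums_diff[OF sums_of_real[OF abs_sin_sums[of "phase \<omega> \<beta> x"], where 'a = complex]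
          sums_of_real[OF abs_sin_sums[of "phase \<omega> \<beta>' x"], where 'a = complex]]
      by (simp add: u_def v_def right_diff_distrib)
    ultimately have "wiener_le (\<lambda>x. complex_of_real \<bar>sin (phase \<omega> \<beta> x)\<bar> - complex_of_real \<bar>sin (phase \<omega> \<beta>' x)\<bar>) (suminf r)"
      by (simp add: sums_iff)
    then show ?thesis using sum_r by (rule wiener_le.mono)
  qed
  with \<delta> show thesis by (rule that)
qed

lemma unit_complex_eq_cis:
  assumes "norm z = 1"
  obtains t where "z = cis t"
proof
  show "z = cis (Arg z)"
    using assms cis_Arg[of z] by (cases "z = 0") (auto simp: sgn_div_norm)
qed

lemma phase_eqs:
  "character \<omega> x = cis (phase \<omega> 0 x)"
  "phase ((1/2) *\<^sub>R \<omega>) (\<beta> / 2) x = phase \<omega> \<beta> x / 2"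
  "phase \<omega> (\<beta> + \<gamma>) x = phase \<omega> \<beta> x + \<gamma>"
  by (simp_all add: phase_def character_def algebra_simps add_divide_distrib)

lemma half_abs_diff_sin:
  "(\<bar>sin a + sin b\<bar> - \<bar>sin a - sin b\<bar>) / 2 =
     \<bar>sin ((a + b) / 2)\<bar> * \<bar>cos ((a - b) / 2)\<bar> - \<bar>sin ((a - b) / 2)\<bar> * \<bar>cos ((a + b) / 2)\<bar>" for a b :: real
  by (simp add: sin_plus_sin sin_diff_sin abs_mult)

text \<open>
  With z = e^(i t) and A half the phase difference, character \<omega> x - z is a unimodular factor times
  2 i sin A.  Clipping sin A at +/- sin b yields (|sin A + sin b| - |sin A - sin b|) / 2, which is a
  difference of products of |sin| and |cos| at phases that differ by b only.  By continuity of
  translations its norm tends to 0 with b, while it agrees with sin A as long as |sin A| \<le> sin b.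
\<close>

lemma wiener_le_near_character:
  assumes "0 < \<epsilon>"
  obtains w where "0 < w"
    "\<And>(\<omega> :: 'a::euclidean_space) z. norm z = 1 \<Longrightarrow>
      \<exists>g. wiener_le g \<epsilon> \<and> (\<forall>x. norm (character \<omega> x - z) \<le> w \<longrightarrow> character \<omega> x - z = g x)"
proof -
  define \<epsilon>' where "\<epsilon>' = \<epsilon> / (4 * sqrt_bound)"
  have "0 < \<epsilon>'" using assms sqrt_bound_ge_1 by (simp add: \<epsilon>'_def)
  then obtain \<delta> where \<delta>: "0 < \<delta>"
    "\<And>(\<omega> :: 'a) \<beta> \<beta>'. \<bar>\<beta> - \<beta>'\<bar> \<le> \<delta> \<Longrightarrow>
      wiener_le (\<lambda>x. complex_of_real \<bar>sin (phase \<omega> \<beta> x)\<bar> - complex_of_real \<bar>sin (phase \<omega> \<beta>' x)\<bar>) \<epsilon>'"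
    using wiener_le_abs_sin_diff by metis
  define b where "b = min \<delta> 1"
  have b: "0 < b" "b \<le> \<delta>" "b \<le> 1" using \<delta>(1) by (auto simp: b_def)
  have sin_b: "0 < sin b" using b pi_gt3 by (intro sin_gt_zero) auto
  have "\<exists>g. wiener_le g \<epsilon> \<and> (\<forall>x. norm (character \<omega> x - z) \<le> 2 * sin b \<longrightarrow> character \<omega> x - z = g x)"
    if "norm z = 1" for \<omega> :: 'a and z
  proof -
    obtain t where z: "z = cis t" by (rule unit_complex_eq_cis[OF \<open>norm z = 1\<close>])
    define A where "A = phase ((1/2) *\<^sub>R \<omega>) (- t / 2)"
    have A: "(phase \<omega> 0 x - t) / 2 = A x" "(phase \<omega> 0 x + t) / 2 = phase ((1/2) *\<^sub>R \<omega>) 0 x + t / 2" for x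
      using phase_eqs(2)[of \<omega> 0 x] phase_eqs(2)[of \<omega> "-t" x] phase_eqs(3)[of \<omega> 0 "-t" x]
      by (simp_all add: A_def add_divide_distrib diff_divide_distrib)
    define s where "s \<beta> x = complex_of_real \<bar>sin (phase ((1/2) *\<^sub>R (1/2) *\<^sub>R \<omega>) \<beta> x)\<bar>" for \<beta> x
    define p m where "p = (- t / 2 + b) / 2" and "m = (- t / 2 - b) / 2"
    have pm: "phase ((1/2) *\<^sub>R (1/2) *\<^sub>R \<omega>) p x = (A x + b) / 2"
        "phase ((1/2) *\<^sub>R (1/2) *\<^sub>R \<omega>) m x = (A x - b) / 2" for x
      unfolding p_def m_def phase_eqs(2) A_def
      using phase_eqs(3)[of "(1/2) *\<^sub>R \<omega>" "- t / 2" b x] phase_eqs(3)[of "(1/2) *\<^sub>R \<omega>" "- t / 2" "- b" x]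
        phase_eqs(2)[of \<omega> "- t" x] by simp_all
    define clip where "clip x = (s p x - s m x) * s (m + pi/2) x + s m x * (s (m + pi/2) x - s (p + pi/2) x)" for x
    have s_bound: "wiener_le (s \<beta>) sqrt_bound" for \<beta>
      unfolding s_def by (rule wiener_le_abs_sin)
    have s_diff: "wiener_le (\<lambda>x. s \<beta> x - s \<beta>' x) \<epsilon>'" if "\<bar>\<beta> - \<beta>'\<bar> = b" for \<beta> \<beta>'
      unfolding s_def using \<delta>(2) that b by simp
    have "\<bar>p - m\<bar> = b" "\<bar>m + pi/2 - (p + pi/2)\<bar> = b"
      using b by (simp_all add: p_def m_def field_simps)
    then have clip: "wiener_le clip (\<epsilon>' * sqrt_bound + sqrt_bound * \<epsilon>')"
      unfolding clip_def by (intro wiener_le_add wiener_le_mult s_bound s_diff)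
    have clip_eq: "clip x = complex_of_real ((\<bar>sin (A x) + sin b\<bar> - \<bar>sin (A x) - sin b\<bar>) / 2)" for x
      unfolding half_abs_diff_sin clip_def s_def phase_eqs(3) pm
      by (simp add: sin_add cos_add algebra_simps)
    define g where "g x = 2 * \<i> * cis (t / 2) * (character ((1/2) *\<^sub>R \<omega>) x * clip x)" for x
    have "wiener_le g (norm (2 * \<i> * cis (t / 2)) * (1 * (\<epsilon>' * sqrt_bound + sqrt_bound * \<epsilon>')))"
      unfolding g_def by (intro wiener_le.scale wiener_le_mult wiener_le.character clip)
    moreover have "norm (2 * \<i> * cis (t / 2)) * (1 * (\<epsilon>' * sqrt_bound + sqrt_bound * \<epsilon>')) = \<epsilon>"
      using sqrt_bound_ge_1 by (simp add: \<epsilon>'_def norm_mult)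
    ultimately have "wiener_le g \<epsilon>" by simp
    moreover have "character \<omega> x - z = g x" if "norm (character \<omega> x - z) \<le> 2 * sin b" for x
    proof -
      have "\<bar>sin (A x)\<bar> \<le> sin b"
        using that by (simp add: phase_eqs(1) z norm_cis_diff A)
      then have "\<bar>sin (A x) + sin b\<bar> = sin (A x) + sin b" "\<bar>sin (A x) - sin b\<bar> = sin b - sin (A x)"
        by linarith+
      then have "clip x = complex_of_real (sin (A x))"
        unfolding clip_eq by simp
      moreover have "character \<omega> x - z = 2 * \<i> * complex_of_real (sin (A x)) * cis (phase ((1/2) *\<^sub>R \<omega>) 0 x + t / 2)"
        by (simp only: z phase_eqs(1) cis_diff A)
      moreover have "cis (phase ((1/2) *\<^sub>R \<omega>) 0 x + t / 2) = cis (t / 2) * character ((1/2) *\<^sub>R \<omega>) x"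
        by (simp only: phase_eqs(1) cis_mult add.commute)
      ultimately show ?thesis
        by (simp add: g_def)
    qed
    ultimately show ?thesis by blast
  qed
  then show thesis using that[of "2 * sin b"] sin_b by simp
qed

text \<open>
  The cosine v of the phase difference determines the distance of the character from z, and |v - cos b|
  factors into two functions |sin|.  Hence every piecewise linear function of v with break points in
  [-1, 1] lies in the Wiener algebra, in particular the one that increases from 0 at c1 to 1 at c2.
\<close>

lemma wiener_le_plateau:
  fixes \<omega> :: "'a::euclidean_space"
  assumes "norm z = 1" "0 < w" "w \<le> 2"
  obtains \<alpha> R where "wiener_le \<alpha> R"
    "\<And>x. norm (character \<omega> x - z) \<le> w / 2 \<Longrightarrow> \<alpha> x = 1"
    "\<And>x. norm (character \<omega> x - z) \<ge> w \<Longrightarrow> \<alpha> x = 0"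
proof -
  obtain t where z: "z = cis t" by (rule unit_complex_eq_cis[OF assms(1)])
  define v where "v x = cos (phase \<omega> (- t) x)" for x
  have dist: "norm (character \<omega> x - z) ^ 2 = 2 - 2 * v x" for x
  proof -
    have "norm (character \<omega> x - z) = 2 * \<bar>sin (phase \<omega> (- t) x / 2)\<bar>"
      using phase_eqs(3)[of \<omega> 0 "- t" x] by (simp add: z phase_eqs(1) norm_cis_diff)
    then show ?thesis
      using cos_double_sin[of "phase \<omega> (- t) x / 2"] by (simp add: v_def power_mult_distrib)
  qed
  have abs_v: "\<exists>R. wiener_le (\<lambda>x. complex_of_real \<bar>v x - c\<bar>) R" if "-1 \<le> c" "c \<le> 1" for c
  proof -
    define b where "b = arccos c"
    have c: "c = cos b" using that by (simp add: b_def)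
    have ph: "phase ((1/2) *\<^sub>R \<omega>) ((- t + b) / 2) x = (phase \<omega> (-t) x + b) / 2"
      "phase ((1/2) *\<^sub>R \<omega>) ((- t + - b) / 2) x = (phase \<omega> (-t) x - b) / 2" for x
      unfolding phase_eqs by simp_all
    have eq: "\<bar>v x - c\<bar> = 2 * (\<bar>sin (phase ((1/2) *\<^sub>R \<omega>) ((- t + b) / 2) x)\<bar> *
        \<bar>sin (phase ((1/2) *\<^sub>R \<omega>) ((- t + - b) / 2) x)\<bar>)" for x
    proof -
      have "\<bar>sin ((b - phase \<omega> (-t) x) / 2)\<bar> = \<bar>sin ((phase \<omega> (-t) x - b) / 2)\<bar>"
        by (metis abs_minus_cancel minus_diff_eq minus_divide_left sin_minus)
      then show ?thesis unfolding ph c v_def cos_diff_cos by (simp add: abs_mult)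
    qed
    show ?thesis
      unfolding eq of_real_mult
      by (rule exI, (rule wiener_le.scale wiener_le_mult wiener_le_abs_sin)+)
  qed
  \<comment> \<open>values of v at distance w and w / 2 from z\<close>
  define c1 c2 where "c1 = 1 - w\<^sup>2 / 2" and "c2 = 1 - (w/2)\<^sup>2 / 2"
  have w2: "w\<^sup>2 \<le> 4" "0 < w\<^sup>2" using assms power_mono[of w 2 2] by auto
  obtain R1 R2 where R: "wiener_le (\<lambda>x. complex_of_real \<bar>v x - c1\<bar>) R1" "wiener_le (\<lambda>x. complex_of_real \<bar>v x - c2\<bar>) R2"
    using abs_v[of c1] abs_v[of c2] w2 by (auto simp: c1_def c2_def power_divide)
  have c12: "c1 < c2" using w2 by (simp add: c1_def c2_def power_divide)
  define \<alpha> where "\<alpha> x = complex_of_real (1 / (2 * (c2 - c1))) *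
    (complex_of_real \<bar>v x - c1\<bar> - complex_of_real \<bar>v x - c2\<bar> + complex_of_real (c2 - c1))" for x
  have "wiener_le \<alpha> (norm (complex_of_real (1 / (2 * (c2 - c1)))) * (R1 + R2 + norm (complex_of_real (c2 - c1))))"
    unfolding \<alpha>_def by (intro wiener_le.scale wiener_le_add wiener_le_diff wiener_le_const R)
  moreover have "\<alpha> x = 1" if "norm (character \<omega> x - z) \<le> w / 2" for x
  proof -
    have "c2 \<le> v x" using power_mono[OF that, of 2] dist[of x] by (simp add: c2_def)
    then have "\<bar>v x - c1\<bar> - \<bar>v x - c2\<bar> + (c2 - c1) = 2 * (c2 - c1)" using c12 by simp
    then show ?thesis unfolding \<alpha>_def of_real_diff[symmetric] of_real_add[symmetric] of_real_mult[symmetric]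
      using c12 by simp
  qed
  moreover have "\<alpha> x = 0" if "norm (character \<omega> x - z) \<ge> w" for x
  proof -
    have "v x \<le> c1" using power_mono[OF that, of 2] assms dist[of x] by (simp add: c1_def)
    then have "\<bar>v x - c1\<bar> - \<bar>v x - c2\<bar> + (c2 - c1) = 0" using c12 by simp
    then show ?thesis unfolding \<alpha>_def of_real_diff[symmetric] of_real_add[symmetric] of_real_mult[symmetric]
      using c12 by simp
  qed
  ultimately show thesis by (rule that)
qed

text \<open>
  This is Wiener's localization principle.  A series is split into a tail of small norm, for which
  the constant and the function are estimated separately, and finitely many terms, each of which
  needs only finitely many characters to be almost constant.
\<close>

lemma wiener_le_locally_near_const:
  fixes f :: "'a::euclidean_space \<Rightarrow> complex"
  assumes "wiener_le f r" "0 < \<epsilon>"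
  shows "\<exists>\<Omega> w. finite \<Omega> \<and> 0 < w \<and> (\<forall>x0. \<exists>g. wiener_le g \<epsilon> \<and>
    (\<forall>x. (\<forall>\<omega>\<in>\<Omega>. norm (character \<omega> x - character \<omega> x0) \<le> w) \<longrightarrow> f x - f x0 = g x))"
  using assms
proof (induction arbitrary: \<epsilon> rule: wiener_le.induct)
  case (character \<omega>)
  obtain w where w: "0 < w"
    "\<And>(\<omega> :: 'a::euclidean_space) z. norm z = 1 \<Longrightarrow>
      \<exists>g. wiener_le g \<epsilon> \<and> (\<forall>x. norm (character \<omega> x - z) \<le> w \<longrightarrow> character \<omega> x - z = g x)"
    using wiener_le_near_character[OF \<open>0 < \<epsilon>\<close>] by metis
  show ?case
    by (rule exI[of _ "{\<omega>}"], rule exI[of _ w]) (use w in simp)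
next
  case (scale f r k)
  obtain \<Omega> w where \<Omega>: "finite \<Omega>" "0 < w" "\<And>x0. \<exists>g. wiener_le g (\<epsilon> / (norm k + 1)) \<and>
    (\<forall>x. (\<forall>\<omega>\<in>\<Omega>. norm (character \<omega> x - character \<omega> x0) \<le> w) \<longrightarrow> f x - f x0 = g x)"
    using scale.IH[of "\<epsilon> / (norm k + 1)"] scale.prems by (auto simp: add_nonneg_pos)
  have le: "norm k * (\<epsilon> / (norm k + 1)) \<le> \<epsilon>"
    using scale.prems by (simp add: field_simps add_pos_nonneg)
  show ?case
  proof (rule exI[of _ \<Omega>], rule exI[of _ w], intro conjI allI)
    fix x0
    obtain g where g: "wiener_le g (\<epsilon> / (norm k + 1))"
      "\<forall>x. (\<forall>\<omega>\<in>\<Omega>. norm (character \<omega> x - character \<omega> x0) \<le> w) \<longrightarrow> f x - f x0 = g x"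
      using \<Omega>(3) by blast
    have "wiener_le (\<lambda>x. k * g x) \<epsilon>"
      using wiener_le.mono[OF wiener_le.scale[OF g(1)] le] .
    moreover have "\<forall>x. (\<forall>\<omega>\<in>\<Omega>. norm (character \<omega> x - character \<omega> x0) \<le> w) \<longrightarrow> k * f x - k * f x0 = k * g x"
      using g(2) by (simp flip: right_diff_distrib)
    ultimately show "\<exists>g. wiener_le g \<epsilon> \<and> (\<forall>x. (\<forall>\<omega>\<in>\<Omega>. norm (character \<omega> x - character \<omega> x0) \<le> w) \<longrightarrow>
        k * f x - k * f x0 = g x)" by blast
  qed (use \<Omega> in auto)
next
  case (series f r)
  obtain N where "norm (\<Sum>i. r (i + N)) < \<epsilon> / 4"
    using suminf_exist_split[OF _ series.hyps(2), of "\<epsilon> / 4"] series.prems by auto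
  then have N: "(\<Sum>i. r (i + N)) \<le> \<epsilon> / 4" by simp
  define \<eta> where "\<eta> = \<epsilon> / (2 * (real N + 1))"
  have \<eta>: "0 < \<eta>" using series.prems by (simp add: \<eta>_def)
  obtain \<Omega> w where \<Omega>: "\<And>n. finite (\<Omega> n)" "\<And>n. 0 < w n" "\<And>n x0. \<exists>g. wiener_le g \<eta> \<and>
    (\<forall>x. (\<forall>\<omega>\<in>\<Omega> n. norm (character \<omega> x - character \<omega> x0) \<le> w n) \<longrightarrow> f n x - f n x0 = g x)"
    using series.IH[OF \<eta>] by metis
  define w' where "w' = Min (insert 1 (w ` {..<N}))"
  have w': "0 < w'" "\<And>n. n < N \<Longrightarrow> w' \<le> w n"
    using \<Omega>(2) by (auto simp: w'_def)
  show ?case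
  proof (rule exI[of _ "\<Union>n<N. \<Omega> n"], rule exI[of _ w'], intro conjI allI)
    show "finite (\<Union>n<N. \<Omega> n)" using \<Omega>(1) by simp
    show "0 < w'" by (rule w')
    fix x0
    obtain g where g: "\<And>n. wiener_le (g n) \<eta>"
      "\<And>n x. (\<forall>\<omega>\<in>\<Omega> n. norm (character \<omega> x - character \<omega> x0) \<le> w n) \<Longrightarrow> f n x - f n x0 = g n x"
      using \<Omega>(3)[of _ x0] by metis
    define tail where "tail x = (\<Sum>n. f (n + N) x)" for x
    have tail: "wiener_le tail (\<epsilon> / 4)"
      unfolding tail_def
      by (rule wiener_le.mono[OF wiener_le.series N]) 
        (use series.hyps summable_ignore_initial_segment in auto)
    have split: "(\<Sum>n. f n x) = tail x + (\<Sum>n<N. f n x)" for x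
      unfolding tail_def
      using suminf_split_initial_segment[OF wiener_le_summable[OF series.hyps]] .
    have "wiener_le (\<lambda>x. tail x - tail x0 + (\<Sum>n<N. g n x)) (\<epsilon> / 4 + \<epsilon> / 4 + (\<Sum>n<N. \<eta>))"
      using wiener_le_norm[OF tail, of x0]
      by (intro wiener_le_add wiener_le_diff wiener_le_sum tail g wiener_le.mono[OF wiener_le_const]) auto
    moreover have "\<epsilon> / 4 + \<epsilon> / 4 + (\<Sum>n<N. \<eta>) \<le> \<epsilon>"
      using series.prems by (simp add: \<eta>_def field_simps)
    ultimately have "wiener_le (\<lambda>x. tail x - tail x0 + (\<Sum>n<N. g n x)) \<epsilon>"
      by (rule wiener_le.mono)
    moreover have "(\<Sum>n. f n x) - (\<Sum>n. f n x0) = tail x - tail x0 + (\<Sum>n<N. g n x)"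
      if "\<forall>\<omega>\<in>(\<Union>n<N. \<Omega> n). norm (character \<omega> x - character \<omega> x0) \<le> w'" for x
    proof -
      have "f n x - f n x0 = g n x" if "n < N" for n
        using g(2)[of n x] w'(2)[of n] \<open>\<forall>\<omega>\<in>_. _\<close> that by fastforce
      then have "(\<Sum>n<N. f n x) - (\<Sum>n<N. f n x0) = (\<Sum>n<N. g n x)"
        by (simp flip: sum_subtractf)
      then show ?thesis unfolding split by (simp add: algebra_simps)
    qed
    ultimately show "\<exists>g. wiener_le g \<epsilon> \<and> (\<forall>x. (\<forall>\<omega>\<in>(\<Union>n<N. \<Omega> n). norm (character \<omega> x - character \<omega> x0) \<le> w') \<longrightarrow>
        (\<Sum>n. f n x) - (\<Sum>n. f n x0) = g x)" by blast
  qed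
qed

definition wiener_on :: "'a::euclidean_space set \<Rightarrow> ('a \<Rightarrow> complex) \<Rightarrow> bool" where
  "wiener_on S F \<longleftrightarrow> (\<exists>g R. wiener_le g R \<and> (\<forall>x\<in>S. g x = F x))"

text \<open>
  The circle is covered by finitely many discs of radius w / 2.  If f solves the problem where the
  character is within w of z, and g solves it where the distance is more than w / 2, then
  \<alpha> f + (1 - \<alpha>) g with the plateau \<alpha> around z solves it on the union.
\<close>

lemma wiener_on_glue_character:
  assumes w: "0 < w" "w \<le> 2"
    and loc: "\<And>z. norm z = 1 \<Longrightarrow> wiener_on {x \<in> S. norm (character \<omega> x - z) < w} F"
  shows "wiener_on S F"
proof -
  obtain Z where Z: "finite Z" "Z \<subseteq> sphere 0 1" "sphere (0::complex) 1 \<subseteq> (\<Union>z\<in>Z. ball z (w/2))"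
    using seq_compact_imp_totally_bounded[OF compact_imp_seq_compact[OF compact_sphere[of 0 1]], THEN spec, of "w/2"] w
    by auto
  have "wiener_on T F" if "T \<subseteq> S" "\<And>x. x \<in> T \<Longrightarrow> \<exists>z\<in>Z. norm (character \<omega> x - z) \<le> w/2" for T
    using Z(1,2) that
  proof (induction Z arbitrary: T rule: finite_induct)
    case empty
    then have "T = {}" by auto
    then show ?case using wiener_le_zero by (auto simp: wiener_on_def)
  next
    case (insert z Z)
    then have z: "norm z = 1" by simp
    obtain \<alpha> R where \<alpha>: "wiener_le \<alpha> R"
      "\<And>x. norm (character \<omega> x - z) \<le> w / 2 \<Longrightarrow> \<alpha> x = 1"
      "\<And>x. norm (character \<omega> x - z) \<ge> w \<Longrightarrow> \<alpha> x = 0"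
      using wiener_le_plateau[OF z w] by metis
    have "wiener_on {x \<in> T. norm (character \<omega> x - z) > w/2} F"
      using insert.prems by (intro insert.IH) fastforce+
    then obtain g R1 where g: "wiener_le g R1" "\<And>x. x \<in> T \<Longrightarrow> norm (character \<omega> x - z) > w/2 \<Longrightarrow> g x = F x"
      by (auto simp: wiener_on_def)
    obtain f R2 where f: "wiener_le f R2" "\<And>x. x \<in> S \<Longrightarrow> norm (character \<omega> x - z) < w \<Longrightarrow> f x = F x"
      using loc[OF z] by (auto simp: wiener_on_def)
    have "wiener_le (\<lambda>x. \<alpha> x * f x + (1 - \<alpha> x) * g x) (R * R2 + (norm (1::complex) + R) * R1)"
      by (intro wiener_le_add wiener_le_mult wiener_le_diff wiener_le_const \<alpha> f g)
    moreover have "\<alpha> x * f x + (1 - \<alpha> x) * g x = F x" if "x \<in> T" for x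
    proof -
      consider "norm (character \<omega> x - z) \<le> w / 2" | "norm (character \<omega> x - z) \<ge> w"
        | "norm (character \<omega> x - z) > w / 2" "norm (character \<omega> x - z) < w" by linarith
      then show ?thesis
        using \<alpha>(2,3)[of x] f(2)[of x] g(2)[of x] that insert.prems(2) w
        by cases (auto simp: algebra_simps)
    qed
    ultimately show ?case unfolding wiener_on_def by blast
  qed
  moreover have "\<exists>z\<in>Z. norm (character \<omega> x - z) \<le> w/2" for x
  proof -
    have "character \<omega> x \<in> (\<Union>z\<in>Z. ball z (w/2))" by (rule subsetD[OF Z(3)]) simp
    then obtain z where "z \<in> Z" "dist z (character \<omega> x) < w / 2" by auto
    then show ?thesis by (auto simp: dist_norm norm_minus_commute intro!: bexI[of _ z])
  qed
  ultimately show ?thesis by blast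
qed

lemma wiener_on_glue:
  assumes "finite \<Omega>" and w: "0 < w"
    and loc: "\<And>T. T \<subseteq> S \<Longrightarrow>
      (\<forall>x\<in>T. \<forall>y\<in>T. \<forall>\<omega>\<in>\<Omega>. norm (character \<omega> x - character \<omega> y) \<le> w) \<Longrightarrow> wiener_on T F"
  shows "wiener_on S F"
  using assms(1,3)
proof (induction \<Omega> rule: finite_induct)
  case empty
  then show ?case by auto
next
  case (insert \<omega> \<Omega>)
  show ?case
  proof (rule insert.IH)
    fix T assume T: "T \<subseteq> S" "\<forall>x\<in>T. \<forall>y\<in>T. \<forall>\<omega>\<in>\<Omega>. norm (character \<omega> x - character \<omega> y) \<le> w"
    \<comment> \<open>two points within v of the same z are within w of each other; plateaus need a radius of at most 2\<close>
    define v where "v = min (w / 2) 2"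
    show "wiener_on T F"
    proof (rule wiener_on_glue_character[where w = v and \<omega> = \<omega>])
      fix z :: complex
      have "norm (character \<omega> x - character \<omega> y) \<le> w"
        if "norm (character \<omega> x - z) < v" "norm (character \<omega> y - z) < v" for x y
        using that norm_triangle_ineq4[of "character \<omega> x - z" "character \<omega> y - z"] by (simp add: v_def)
      then show "wiener_on {x \<in> T. norm (character \<omega> x - z) < v} F"
        using T by (intro insert.prems) auto
    qed (use w in \<open>auto simp: v_def\<close>)
  qed
qed

text \<open>
  The discs of radius \<rho> around the values lie in U, with one \<rho> for all of them by compactness.  On a
  set T where the relevant characters vary little, f - f(x0) agrees with an element of norm at most
  \<rho> / 2, so the Taylor series of h at f(x0) may be summed in the Wiener algebra.  The local solutions
  are then glued.
\<close>

theorem local_wiener_levy: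
  fixes f :: "'a::euclidean_space \<Rightarrow> complex"
  assumes f: "wiener_le f r" and U: "open U" "closure (f ` S) \<subseteq> U" and h: "h holomorphic_on U"
  shows "wiener_on S (\<lambda>x. h (f x))"
proof -
  have "bounded (f ` S)"
    using wiener_le_norm[OF f] by (auto simp: bounded_iff)
  then have "compact (closure (f ` S))" by (simp add: compact_closure)
  then obtain \<rho> where \<rho>: "0 < \<rho>" "\<And>z. z \<in> closure (f ` S) \<Longrightarrow> ball z \<rho> \<subseteq> U"
    using compact_subset_open_imp_ball_epsilon_subset[OF _ U] by (metis UN_subset_iff)
  obtain \<Omega> w where \<Omega>: "finite \<Omega>" "0 < w" "\<And>x0. \<exists>g. wiener_le g (\<rho>/2) \<and>
    (\<forall>x. (\<forall>\<omega>\<in>\<Omega>. norm (character \<omega> x - character \<omega> x0) \<le> w) \<longrightarrow> f x - f x0 = g x)"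
    using wiener_le_locally_near_const[OF f, of "\<rho>/2"] \<rho>(1) by auto
  show ?thesis
  proof (rule wiener_on_glue[OF \<Omega>(1,2)])
    fix T assume T: "T \<subseteq> S" "\<forall>x\<in>T. \<forall>y\<in>T. \<forall>\<omega>\<in>\<Omega>. norm (character \<omega> x - character \<omega> y) \<le> w"
    show "wiener_on T (\<lambda>x. h (f x))"
    proof (cases "T = {}")
      case True
      then show ?thesis using wiener_le_zero by (auto simp: wiener_on_def)
    next
      case False
      then obtain x0 where x0: "x0 \<in> T" by blast
      obtain g where g: "wiener_le g (\<rho>/2)"
        "\<And>x. (\<forall>\<omega>\<in>\<Omega>. norm (character \<omega> x - character \<omega> x0) \<le> w) \<Longrightarrow> f x - f x0 = g x"
        using \<Omega>(3)[of x0] by blast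
      define c where "c n = (deriv ^^ n) h (f x0) / fact n" for n
      have "f x0 \<in> closure (f ` S)" using x0 T(1) closure_subset by blast
      then have hol: "h holomorphic_on ball (f x0) \<rho>"
        using holomorphic_on_subset[OF h] \<rho>(2) by blast
      have sums: "(\<lambda>n. c n * (z - f x0) ^ n) sums h z" if "z \<in> ball (f x0) \<rho>" for z
        unfolding c_def using holomorphic_power_series[OF hol that] .
      have "summable (\<lambda>n. c n * complex_of_real (3/4 * \<rho>) ^ n)"
        using sums_summable[OF sums, of "f x0 + complex_of_real (3/4 * \<rho>)"] \<rho>(1) by (simp add: dist_norm)
      then have "summable (\<lambda>n. norm (c n * complex_of_real (\<rho>/2) ^ n))"
        by (rule powser_insidea) (use \<rho>(1) in simp)
      then have summable_c: "summable (\<lambda>n. norm (c n) * (\<rho>/2) ^ n)"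
        using \<rho>(1) by (simp add: norm_mult norm_power norm_divide)
      have "wiener_le (\<lambda>x. \<Sum>n. c n * g x ^ n) (\<Sum>n. norm (c n) * (\<rho>/2) ^ n)"
        by (intro wiener_le.series wiener_le.scale wiener_le_power g summable_c)
      moreover have "(\<Sum>n. c n * g x ^ n) = h (f x)" if "x \<in> T" for x
      proof -
        have gx: "f x - f x0 = g x" using g(2) T(2) that x0 by blast
        then have "f x \<in> ball (f x0) \<rho>"
          using wiener_le_norm[OF g(1), of x] \<rho>(1) by (simp add: dist_norm norm_minus_commute[of "f x0"])
        from sums[OF this] show ?thesis by (simp add: gx sums_iff)
      qed
      ultimately show ?thesis unfolding wiener_on_def by blast
    qed
  qed
qed

section \<open>Weighted sums over translation bounded and slowly increasing measures\<close>

lemma emeasure_variation: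
  "emeasure (variation a) A = (\<integral>\<^sup>+x. ennreal (norm (a x)) * indicator A x \<partial>count_space UNIV)"
  unfolding variation_def by (rule emeasure_density) auto

text \<open>
  An atomic measure as a sequence of point masses.  Sums over the atoms become series, which are
  exchanged with Lebesgue integrals more easily than sums over the uncountable type of points.
\<close>

lemma atoms_enumeration:
  fixes a :: "'a::euclidean_space mass"
  assumes "countable (atoms a)"
  shows "\<exists>(c :: nat \<Rightarrow> complex) (e :: nat \<Rightarrow> 'a).
    (\<forall>n. c n \<noteq> 0 \<longrightarrow> c n = a (e n)) \<and>
    bij_betw e {n. c n \<noteq> 0} (atoms a) \<and>
    (\<forall>f. (\<integral>\<^sup>+x. ennreal (norm (a x)) * f x \<partial>count_space UNIV) = (\<Sum>n. ennreal (norm (c n)) * f (e n))) \<and>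
    (\<forall>f. integrable (count_space UNIV) (\<lambda>x. a x * f x) \<longrightarrow>
      (\<lambda>n. c n * f (e n)) sums (\<integral>x. a x * f x \<partial>count_space UNIV))"
proof -
  define e where "e = from_nat_into (atoms a)"
  define c where "c n = (if n \<in> to_nat_on (atoms a) ` atoms a then a (e n) else 0)" for n
  have e_to_nat: "e (to_nat_on (atoms a) x) = x" if "x \<in> atoms a" for x
    using assms that by (simp add: e_def)
  have c_eq: "c n = a (e n)" if "c n \<noteq> 0" for n
    using that by (auto simp: c_def split: if_splits)
  have N: "{n. c n \<noteq> 0} = to_nat_on (atoms a) ` atoms a"
    using e_to_nat by (auto simp: c_def atoms_def)
  have bij: "bij_betw e {n. c n \<noteq> 0} (atoms a)"
    unfolding N bij_betw_def using e_to_nat by (force simp: inj_on_def image_image)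
  have nn: "(\<integral>\<^sup>+x. ennreal (norm (a x)) * f x \<partial>count_space UNIV) = (\<Sum>n. ennreal (norm (c n)) * f (e n))" for f
  proof -
    have "(\<integral>\<^sup>+x. ennreal (norm (a x)) * f x \<partial>count_space UNIV) =
        (\<integral>\<^sup>+x. ennreal (norm (a x)) * f x \<partial>count_space (atoms a))"
      by (rule nn_integral_count_space_eq) (auto simp: atoms_def)
    also have "\<dots> = (\<integral>\<^sup>+n. ennreal (norm (a (e n))) * f (e n) \<partial>count_space {n. c n \<noteq> 0})"
      by (rule nn_integral_bij_count_space[OF bij, symmetric])
    also have "\<dots> = (\<integral>\<^sup>+n. ennreal (norm (c n)) * f (e n) \<partial>count_space {n. c n \<noteq> 0})"
      by (rule nn_integral_cong) (use c_eq in auto)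
    also have "\<dots> = (\<integral>\<^sup>+n. ennreal (norm (c n)) * f (e n) \<partial>count_space UNIV)"
      by (rule nn_integral_count_space_eq) auto
    finally show ?thesis by (simp add: nn_integral_count_space_nat)
  qed
  have sum: "Infinite_Set_Sum.abs_summable_on (\<lambda>n. c n * f (e n)) UNIV"
    "infsetsum (\<lambda>n. c n * f (e n)) UNIV = infsetsum (\<lambda>x. a x * f x) UNIV"
    if "integrable (count_space UNIV) (\<lambda>x. a x * f x)" for f
  proof -
    have 1: "Infinite_Set_Sum.abs_summable_on (\<lambda>x. a x * f x) (atoms a)"
      using that by (auto simp: abs_summable_on_def intro: abs_summable_on_subset[unfolded abs_summable_on_def])
    then have "Infinite_Set_Sum.abs_summable_on (\<lambda>n. a (e n) * f (e n)) {n. c n \<noteq> 0}"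
      by (subst abs_summable_on_reindex_bij_betw[OF bij])
    then show "Infinite_Set_Sum.abs_summable_on (\<lambda>n. c n * f (e n)) UNIV"
      by (subst (asm) abs_summable_on_cong_neutral[of _ "UNIV" _ "\<lambda>n. c n * f (e n)"]) (use c_eq in auto)
    have "infsetsum (\<lambda>x. a x * f x) UNIV = infsetsum (\<lambda>x. a x * f x) (atoms a)"
      by (rule infsetsum_cong_neutral) (auto simp: atoms_def)
    also have "\<dots> = infsetsum (\<lambda>n. a (e n) * f (e n)) {n. c n \<noteq> 0}"
      by (rule infsetsum_reindex_bij_betw[OF bij, symmetric])
    also have "\<dots> = infsetsum (\<lambda>n. c n * f (e n)) UNIV"
      by (rule infsetsum_cong_neutral) (use c_eq in auto)
    finally show "infsetsum (\<lambda>n. c n * f (e n)) UNIV = infsetsum (\<lambda>x. a x * f x) UNIV" by simp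
  qed
  have sums: "(\<lambda>n. c n * f (e n)) sums (\<integral>x. a x * f x \<partial>count_space UNIV)"
    if "integrable (count_space UNIV) (\<lambda>x. a x * f x)" for f
    using sums_infsetsum_nat'[OF sum(1)[OF that]] sum(2)[OF that]
    by (simp add: infsetsum_def[of "\<lambda>x. a x * f x"])
  show ?thesis using c_eq bij nn sums by blast
qed

text \<open>
  A weight that is integrable and changes at most by a constant factor over unit distances; the
  product form reduces its integral, and later estimates against it, to one variable.
\<close>

definition weight :: "'a::euclidean_space \<Rightarrow> real" where
  "weight x = (\<Prod>i\<in>Basis. inverse (1 + (x \<bullet> i)\<^sup>2))"

lemma one_plus_square_pos: "0 < 1 + (t::real)\<^sup>2"
  by (simp add: add_pos_nonneg)

lemma weight_pos: "0 < weight x"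
  unfolding weight_def by (intro prod_pos) (simp add: one_plus_square_pos)

lemma weight_nonneg [simp]: "0 \<le> weight x"
  using weight_pos[of x] by simp

lemma borel_measurable_weight [measurable]: "weight \<in> borel_measurable borel"
  unfolding weight_def by measurable

text \<open>
  In each coordinate y^2 \<le> 2 x^2 + 2 (x - y)^2.
\<close>

lemma weight_le:
  assumes "norm (x - y) \<le> 1"
  shows "weight x \<le> 3 ^ DIM('a) * weight (y::'a::euclidean_space)"
proof -
  have "weight x \<le> (\<Prod>i\<in>(Basis::'a set). 3 * inverse (1 + (y \<bullet> i)\<^sup>2))"
    unfolding weight_def
  proof (intro prod_mono conjI)
    fix i :: 'a assume i: "i \<in> Basis"
    show "0 \<le> inverse (1 + (x \<bullet> i)\<^sup>2)" by simp
    have "\<bar>x \<bullet> i - y \<bullet> i\<bar> \<le> 1"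
      using Basis_le_norm[OF i, of "x - y"] assms by (simp add: inner_diff_left)
    then have "(x \<bullet> i - y \<bullet> i)\<^sup>2 \<le> 1" by (simp add: abs_square_le_1)
    moreover have "(y \<bullet> i)\<^sup>2 + (2 * (x \<bullet> i) - y \<bullet> i)\<^sup>2 = 2 * (x \<bullet> i)\<^sup>2 + 2 * (x \<bullet> i - y \<bullet> i)\<^sup>2"
      by (simp add: power2_eq_square algebra_simps)
    ultimately have "1 + (y \<bullet> i)\<^sup>2 \<le> 3 * (1 + (x \<bullet> i)\<^sup>2)"
      using zero_le_power2[of "2 * (x \<bullet> i) - y \<bullet> i"] zero_le_power2[of "x \<bullet> i"]
      unfolding distrib_left by linarith
    then show "inverse (1 + (x \<bullet> i)\<^sup>2) \<le> 3 * inverse (1 + (y \<bullet> i)\<^sup>2)"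
      using one_plus_square_pos[of "x \<bullet> i"] one_plus_square_pos[of "y \<bullet> i"] by (simp add: field_simps)
  qed
  then show ?thesis by (simp add: weight_def prod.distrib)
qed

lemma weight_ge: "1 \<le> (1 + (norm x)\<^sup>2) ^ DIM('a) * weight (x::'a::euclidean_space)"
proof -
  have "1 \<le> (\<Prod>i\<in>(Basis::'a set). (1 + (norm x)\<^sup>2) * inverse (1 + (x \<bullet> i)\<^sup>2))"
  proof (rule prod_ge_1)
    fix i :: 'a assume i: "i \<in> Basis"
    have "(x \<bullet> i)\<^sup>2 \<le> (norm x)\<^sup>2"
      using Basis_le_norm[OF i, of x] by (simp add: abs_le_square_iff[symmetric])
    then show "1 \<le> (1 + (norm x)\<^sup>2) * inverse (1 + (x \<bullet> i)\<^sup>2)"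
      using one_plus_square_pos[of "x \<bullet> i"] by (simp add: field_simps)
  qed
  then show ?thesis by (simp add: weight_def prod.distrib)
qed

lemma nn_integral_weight_finite: "(\<integral>\<^sup>+x. ennreal (weight (x::'a::euclidean_space)) \<partial>lborel) < \<infinity>"
proof -
  have "integrable lborel (\<lambda>t::real. inverse (1 + t\<^sup>2))"
    using integrable_inverse_1_plus_square by (simp add: set_integrable_def einterval_def)
  then have fin: "(\<integral>\<^sup>+t. ennreal (inverse (1 + t\<^sup>2)) \<partial>(lborel :: real measure)) < \<infinity>"
    by (simp add: integrable_iff_bounded)
  have "(\<integral>\<^sup>+x. ennreal (weight (x::'a)) \<partial>lborel) =
      (\<integral>\<^sup>+x. (\<Prod>i\<in>Basis. ennreal (inverse (1 + (x \<bullet> i)\<^sup>2))) \<partial>(lborel :: 'a measure))"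
    unfolding weight_def by (subst prod_ennreal) auto
  also have "\<dots> = (\<Prod>i\<in>(Basis::'a set). (\<integral>\<^sup>+t. ennreal (inverse (1 + t\<^sup>2)) \<partial>lborel))"
    by (rule nn_integral_lborel_prod) auto
  also have "\<dots> < \<infinity>" using fin by (simp add: power_less_top_ennreal)
  finally show ?thesis .
qed

lemma nn_integral_lborel_shift:
  fixes f :: "'a::euclidean_space \<Rightarrow> ennreal"
  assumes [measurable]: "f \<in> borel_measurable borel"
  shows "(\<integral>\<^sup>+x. f (x + t) \<partial>lborel) = (\<integral>\<^sup>+x. f x \<partial>lborel)"
proof -
  have "(\<integral>\<^sup>+x. f x \<partial>lborel) = (\<integral>\<^sup>+x. f x \<partial>distr lborel borel ((+) t))"
    by (simp add: lborel_distr_plus)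
  also have "\<dots> = (\<integral>\<^sup>+x. f (t + x) \<partial>lborel)" by (subst nn_integral_distr) auto
  finally show ?thesis by (simp add: add.commute)
qed

text \<open>
  Translation boundedness with an explicit constant, which has to be followed through the series that
  builds the Fourier transform of the new measure.
\<close>

definition unit_mass_le :: "'a::euclidean_space mass \<Rightarrow> real \<Rightarrow> bool" where
  "unit_mass_le b B \<longleftrightarrow>
     countable (atoms b) \<and> 0 \<le> B \<and> (\<forall>x. emeasure (variation b) (ball x 1) \<le> ennreal B)"

lemma unit_mass_le_imp_translation_bounded: "unit_mass_le b B \<Longrightarrow> translation_bounded b"
  unfolding translation_bounded_def unit_mass_le_def infinity_ennreal_def
  by (rule le_less_trans[OF SUP_least ennreal_less_top]) auto

lemma translation_bounded_imp_unit_mass_le: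
  assumes "countable (atoms b)" "translation_bounded b"
  shows "\<exists>B. unit_mass_le b B"
proof -
  obtain B where B: "0 \<le> B" "(SUP x. emeasure (variation b) (ball x 1)) = ennreal B"
    using assms(2) unfolding translation_bounded_def
    by (metis enn2real_nonneg ennreal_enn2real infinity_ennreal_def)
  have "emeasure (variation b) (ball x 1) \<le> ennreal B" for x
    unfolding B(2)[symmetric] by (rule SUP_upper) simp
  then show ?thesis using assms(1) B(1) by (auto simp: unit_mass_le_def)
qed

text \<open>
  Smearing every point mass over the unit ball around it changes the weight by a constant factor at
  most.  After an exchange of sum and integral the mass of a unit ball is integrated against the
  weight, and translation invariance of Lebesgue measure makes the bound uniform in \<omega>.
\<close>

lemma unit_mass_le_weight_sum:
  "\<exists>K\<ge>0. \<forall>(b :: 'a::euclidean_space mass) B \<omega>. unit_mass_le b B \<longrightarrow>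
    (\<integral>\<^sup>+x. ennreal (norm (b x) * weight (x + \<omega>)) \<partial>count_space UNIV) \<le> ennreal (K * B)"
proof -
  obtain W where W: "0 \<le> W" "(\<integral>\<^sup>+x. ennreal (weight (x::'a)) \<partial>lborel) = ennreal W"
    using nn_integral_weight_finite[where 'a = 'a]
    by (metis enn2real_nonneg ennreal_enn2real infinity_ennreal_def)
  define V where "V = measure lborel (ball (0::'a) 1)"
  have V: "0 < V" "emeasure lborel (ball (0::'a) 1) = ennreal V"
    using content_ball_pos[of 1 "0::'a"] emeasure_lborel_ball_finite[of "0::'a" 1]
    by (simp_all add: V_def emeasure_eq_ennreal_measure less_top)
  define K where "K = 3 ^ DIM('a) * W / V"
  have "(\<integral>\<^sup>+x. ennreal (norm (b x) * weight (x + \<omega>)) \<partial>count_space UNIV) \<le> ennreal (K * B)"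
    if "unit_mass_le b B" for b :: "'a mass" and B \<omega>
  proof -
    have b: "countable (atoms b)" "0 \<le> B" "\<And>x. emeasure (variation b) (ball x 1) \<le> ennreal B"
      using that by (auto simp: unit_mass_le_def)
    obtain c :: "nat \<Rightarrow> complex" and e where
      sum_eq: "\<And>f. (\<integral>\<^sup>+x. ennreal (norm (b x)) * f x \<partial>count_space UNIV) = (\<Sum>n. ennreal (norm (c n)) * f (e n))"
      using atoms_enumeration[OF b(1)] by blast
    have vol: "(\<integral>\<^sup>+y. indicator (ball x 1) y \<partial>lborel) = ennreal V" for x :: 'a
    proof -
      have "(\<integral>\<^sup>+y. indicator (ball x 1) y \<partial>lborel) = (\<integral>\<^sup>+y. indicator (ball x 1) (y + x) \<partial>lborel)"
        by (rule nn_integral_lborel_shift[symmetric]) (auto intro!: borel_measurable_indicator)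
      also have "(\<lambda>y. indicator (ball x 1) (y + x)) = (indicator (ball 0 1) :: 'a \<Rightarrow> ennreal)"
        by (auto simp: indicator_def dist_norm fun_eq_iff)
      finally show ?thesis using V by simp
    qed
    have "ennreal V * (\<integral>\<^sup>+x. ennreal (norm (b x) * weight (x + \<omega>)) \<partial>count_space UNIV) =
        (\<Sum>n. ennreal (norm (c n)) * (ennreal V * ennreal (weight (e n + \<omega>))))"
    proof -
      have 1: "(\<integral>\<^sup>+x. ennreal (norm (b x) * weight (x + \<omega>)) \<partial>count_space UNIV) =
          (\<Sum>n. ennreal (norm (c n)) * ennreal (weight (e n + \<omega>)))"
        by (simp add: ennreal_mult sum_eq[of "\<lambda>x. ennreal (weight (x + \<omega>))"])
      show ?thesis
        unfolding 1 ennreal_suminf_cmult[symmetric] by (intro suminf_cong) (simp only: mult_ac)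
    qed
    also have "\<dots> = (\<Sum>n. (\<integral>\<^sup>+y. ennreal (norm (c n)) * (ennreal (weight (e n + \<omega>)) * indicator (ball (e n) 1) y) \<partial>lborel))"
    proof (intro suminf_cong)
      fix n
      have [measurable]: "(indicator (ball (e n) 1) :: 'a \<Rightarrow> ennreal) \<in> borel_measurable borel"
        by (rule borel_measurable_indicator) simp
      show "ennreal (norm (c n)) * (ennreal V * ennreal (weight (e n + \<omega>))) =
          (\<integral>\<^sup>+y. ennreal (norm (c n)) * (ennreal (weight (e n + \<omega>)) * indicator (ball (e n) 1) y) \<partial>lborel)"
        by (simp add: nn_integral_cmult vol mult.commute)
    qed
    also have "\<dots> \<le> (\<Sum>n. (\<integral>\<^sup>+y. ennreal (norm (c n)) *
        (ennreal (3 ^ DIM('a) * weight (y + \<omega>)) * indicator (ball y 1) (e n)) \<partial>lborel))"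
      by (intro suminf_le nn_integral_mono mult_left_mono)
        (auto simp: indicator_def dist_norm norm_minus_commute intro!: ennreal_leI weight_le)
    also have "\<dots> = (\<integral>\<^sup>+y. (\<Sum>n. ennreal (norm (c n)) *
        (ennreal (3 ^ DIM('a) * weight (y + \<omega>)) * indicator (ball y 1) (e n))) \<partial>lborel)"
      by (rule nn_integral_suminf[symmetric]) (auto simp: indicator_def dist_norm)
    also have "\<dots> = (\<integral>\<^sup>+y. ennreal (3 ^ DIM('a) * weight (y + \<omega>)) * emeasure (variation b) (ball y 1) \<partial>lborel)"
    proof (rule nn_integral_cong)
      fix y :: 'a
      have 1: "ennreal (norm (c n)) * (k * f (e n)) = k * (ennreal (norm (c n)) * f (e n))" for n k f
        by (simp only: mult_ac)
      show "(\<Sum>n. ennreal (norm (c n)) * (ennreal (3 ^ DIM('a) * weight (y + \<omega>)) * indicator (ball y 1) (e n))) =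
          ennreal (3 ^ DIM('a) * weight (y + \<omega>)) * emeasure (variation b) (ball y 1)"
        unfolding 1 ennreal_suminf_cmult emeasure_variation sum_eq ..
    qed
    also have "\<dots> \<le> (\<integral>\<^sup>+y. ennreal (3 ^ DIM('a) * weight (y + \<omega>)) * ennreal B \<partial>lborel)"
      by (intro nn_integral_mono mult_left_mono b) auto
    also have "\<dots> = (\<integral>\<^sup>+y. ennreal (3 ^ DIM('a) * weight y) * ennreal B \<partial>(lborel::'a measure))"
      by (rule nn_integral_lborel_shift) auto
    also have "\<dots> = ennreal (3 ^ DIM('a) * W * B)"
      using W b(2) by (simp add: nn_integral_multc ennreal_mult nn_integral_cmult)
    also have "\<dots> = ennreal V * ennreal (K * B)"
      using V(1) W(1) b(2) by (simp add: K_def flip: ennreal_mult')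
    finally show ?thesis
      using V(1) by (subst (asm) ennreal_mult_le_mult_iff) auto
  qed
  moreover have "0 \<le> K" using W(1) V(1) by (simp add: K_def)
  ultimately show ?thesis by blast
qed

text \<open>
  The exponent N = p + 2 beats the growth exponent p by enough to sum over the shells
  k \<le> |x| < k + 1.
\<close>

lemma slowly_increasing_weighted_sum:
  fixes a :: "'a::euclidean_space mass"
  assumes "atomic_measure a" "slowly_increasing a"
  obtains N where "(\<integral>\<^sup>+x. ennreal (norm (a x) / (1 + norm x) ^ N) \<partial>count_space UNIV) < \<infinity>"
proof -
  let ?v = "\<lambda>r. emeasure (variation a) (ball 0 r)"
  obtain C p R where R: "\<And>r. R \<le> r \<Longrightarrow> ?v r \<le> ennreal (C * r ^ p)"
    using assms(2) unfolding slowly_increasing_def eventually_at_top_linorder by blast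
  have mono: "?v r \<le> ?v s" if "r \<le> s" for r s
    using that by (intro emeasure_mono) (auto simp: variation_def)
  obtain V where V: "0 \<le> V" "?v R = ennreal V"
    using assms(1) unfolding atomic_measure_def
    by (metis enn2real_nonneg ennreal_enn2real infinity_ennreal_def)
  define D where "D = \<bar>C\<bar> + V"
  have D: "?v r \<le> ennreal (D * r ^ p)" if "1 \<le> r" for r
  proof (cases "R \<le> r")
    case True
    have "C * r ^ p \<le> D * r ^ p"
      using that V(1) by (intro mult_right_mono) (auto simp: D_def)
    then show ?thesis using R[OF True] by (meson ennreal_leI order_trans)
  next
    case False
    have "V * 1 \<le> D * r ^ p"
      using that V(1) by (intro mult_mono) (auto simp: D_def)
    then show ?thesis using mono[of r R] False V(2) by (metis ennreal_leI mult.right_neutral nle_le order_trans)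
  qed
  define N where "N = p + 2"
  have summable: "summable (\<lambda>k. D * inverse (real (Suc k) ^ 2))"
    using inverse_power_summable[of 2, where 'a = real]
    by (intro summable_mult) (subst summable_Suc_iff, simp)
  have "(\<integral>\<^sup>+x. ennreal (norm (a x) / (1 + norm x) ^ N) \<partial>count_space UNIV) \<le>
      (\<integral>\<^sup>+x. (\<Sum>k. ennreal (inverse (real (Suc k) ^ N)) * (ennreal (norm (a x)) * indicator (ball 0 (real (Suc k))) x)) \<partial>count_space UNIV)"
  proof (rule nn_integral_mono)
    fix x :: 'a
    \<comment> \<open>the ball that belongs to the shell of x majorizes the term on its own\<close>
    define k where "k = nat \<lfloor>norm x\<rfloor>"
    have k: "real k \<le> norm x" "norm x < real (Suc k)"
      using real_of_int_floor_add_one_gt[of "norm x"] by (simp_all add: k_def add.commute)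
    have "norm (a x) / (1 + norm x) ^ N \<le> norm (a x) / real (Suc k) ^ N"
      using k by (intro divide_left_mono power_mono mult_pos_pos zero_less_power) auto
    then have "ennreal (norm (a x) / (1 + norm x) ^ N) \<le> ennreal (inverse (real (Suc k) ^ N)) * (ennreal (norm (a x)) * indicator (ball 0 (real (Suc k))) x)"
      using k by (simp add: ennreal_mult[symmetric] ennreal_leI field_simps del: of_nat_Suc)
    also have "\<dots> \<le> (\<Sum>k. ennreal (inverse (real (Suc k) ^ N)) * (ennreal (norm (a x)) * indicator (ball 0 (real (Suc k))) x))"
      using sum_le_suminf[of "\<lambda>k. ennreal (inverse (real (Suc k) ^ N)) * (ennreal (norm (a x)) * indicator (ball 0 (real (Suc k))) x)" "{k}"] by simp
    finally show "ennreal (norm (a x) / (1 + norm x) ^ N) \<le> \<dots>" .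
  qed
  also have "\<dots> = (\<Sum>k. ennreal (inverse (real (Suc k) ^ N)) * ?v (real (Suc k)))"
    unfolding emeasure_variation by (subst nn_integral_suminf) (auto simp: nn_integral_cmult)
  also have "\<dots> \<le> (\<Sum>k. ennreal (D * inverse (real (Suc k) ^ 2)))"
  proof (intro suminf_le)
    fix k
    have "ennreal (inverse (real (Suc k) ^ N)) * ?v (real (Suc k)) \<le>
        ennreal (inverse (real (Suc k) ^ N)) * ennreal (D * real (Suc k) ^ p)"
      by (intro mult_left_mono D) auto
    also have "\<dots> = ennreal (D * inverse (real (Suc k) ^ 2))"
      by (subst ennreal_mult'[symmetric]) (auto simp: N_def power_add power2_eq_square field_simps simp del: of_nat_Suc)
    finally show "ennreal (inverse (real (Suc k) ^ N)) * ?v (real (Suc k)) \<le> ennreal (D * inverse (real (Suc k) ^ 2))" .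
  qed auto
  also have "\<dots> < \<infinity>"
    using V(1) by (subst suminf_ennreal2[OF _ summable]) (auto simp: D_def)
  finally show thesis by (rule that)
qed

lemma unit_mass_le_imp_slowly_increasing:
  fixes b :: "'a::euclidean_space mass"
  assumes "unit_mass_le b B"
  shows "atomic_measure b" "slowly_increasing b"
proof -
  have B: "countable (atoms b)" "0 \<le> B" using assms by (auto simp: unit_mass_le_def)
  obtain K where K: "0 \<le> K" "(\<integral>\<^sup>+x. ennreal (norm (b x) * weight (x + 0)) \<partial>count_space UNIV) \<le> ennreal (K * B)"
    using unit_mass_le_weight_sum[where 'a = 'a] assms by blast
  have ball: "emeasure (variation b) (ball 0 r) \<le> ennreal ((1 + r\<^sup>2) ^ DIM('a) * (K * B))" for r
  proof -
    have "emeasure (variation b) (ball 0 r) \<le>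
        (\<integral>\<^sup>+x. ennreal ((1 + r\<^sup>2) ^ DIM('a)) * ennreal (norm (b x) * weight (x + 0)) \<partial>count_space UNIV)"
      unfolding emeasure_variation
    proof (rule nn_integral_mono)
      fix x :: 'a
      have "norm (b x) * 1 \<le> norm (b x) * ((1 + r\<^sup>2) ^ DIM('a) * weight x)" if "norm x < r"
      proof (rule mult_left_mono)
        have "(1 + (norm x)\<^sup>2) ^ DIM('a) * weight x \<le> (1 + r\<^sup>2) ^ DIM('a) * weight x"
          using that by (intro mult_right_mono power_mono add_mono) auto
        then show "1 \<le> (1 + r\<^sup>2) ^ DIM('a) * weight x" using weight_ge[of x] by linarith
      qed simp
      then show "ennreal (norm (b x)) * indicator (ball 0 r) x \<le> ennreal ((1 + r\<^sup>2) ^ DIM('a)) * ennreal (norm (b x) * weight (x + 0))"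
        by (auto simp: indicator_def ennreal_mult'[symmetric] ennreal_leI mult_ac)
    qed
    also have "\<dots> = ennreal ((1 + r\<^sup>2) ^ DIM('a)) * (\<integral>\<^sup>+x. ennreal (norm (b x) * weight (x + 0)) \<partial>count_space UNIV)"
      by (rule nn_integral_cmult) simp
    also have "\<dots> \<le> ennreal ((1 + r\<^sup>2) ^ DIM('a)) * ennreal (K * B)"
      by (intro mult_left_mono K) auto
    also have "\<dots> = ennreal ((1 + r\<^sup>2) ^ DIM('a) * (K * B))"
      by (rule ennreal_mult'[symmetric]) simp
    finally show ?thesis .
  qed
  show "atomic_measure b"
    unfolding atomic_measure_def using B(1) le_less_trans[OF ball] by auto
  have "emeasure (variation b) (ball 0 r) \<le> ennreal (2 ^ DIM('a) * (K * B) * r ^ (2 * DIM('a)))" if "1 \<le> r" for r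
  proof -
    have "(1 + r\<^sup>2) ^ DIM('a) \<le> (2 * r\<^sup>2) ^ DIM('a)"
      using that one_le_power[of r 2] by (intro power_mono) auto
    then have "(1 + r\<^sup>2) ^ DIM('a) * (K * B) \<le> (2 * r\<^sup>2) ^ DIM('a) * (K * B)"
      using K(1) B(2) by (intro mult_right_mono) auto
    also have "\<dots> = 2 ^ DIM('a) * (K * B) * r ^ (2 * DIM('a))"
      by (simp add: power_mult_distrib power_mult)
    finally show ?thesis using ball[of r] by (meson ennreal_leI order_trans)
  qed
  then show "slowly_increasing b"
    unfolding slowly_increasing_def eventually_at_top_linorder by blast
qed

section \<open>Fourier transforms of Schwartz functions\<close>

lemma fourier_eq: "fourier \<phi> y = (\<integral>x. \<phi> x * character (- y) x \<partial>lborel)"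
  unfolding fourier_def character_def by (simp add: cis_conv_exp mult_ac)

lemma borel_measurable_character [measurable]: "character \<omega> \<in> borel_measurable borel"
  unfolding character_def by (intro borel_measurable_continuous_onI continuous_intros)

lemma lborel_integral_shift:
  fixes f :: "'a::euclidean_space \<Rightarrow> complex"
  assumes [measurable]: "f \<in> borel_measurable borel"
  shows "(\<integral>x. f (x + t) \<partial>lborel) = (\<integral>x. f x \<partial>lborel)"
proof -
  have "(\<integral>x. f x \<partial>lborel) = (\<integral>x. f x \<partial>distr lborel borel ((+) t))"
    by (simp add: lborel_distr_plus)
  also have "\<dots> = (\<integral>x. f (t + x) \<partial>lborel)" by (subst integral_distr) auto
  finally show ?thesis by (simp add: add.commute)
qed

lemma iter_partial_append: "iter_partial vs (iter_partial us \<phi>) = iter_partial (vs @ us) \<phi>"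
  by (induction vs) auto

lemma schwartz_iter_partial:
  assumes "schwartz \<phi>" "us \<in> lists Basis"
  shows "schwartz (iter_partial us \<phi>)"
  using assms unfolding schwartz_def by (auto simp: iter_partial_append)

lemma schwartz_differentiable: "schwartz \<phi> \<Longrightarrow> \<phi> differentiable (at x)"
  unfolding schwartz_def by (metis lists.Nil iter_partial.simps(1))

lemma schwartz_measurable:
  assumes "schwartz \<phi>" shows "\<phi> \<in> borel_measurable borel"
  by (intro borel_measurable_continuous_onI continuous_at_imp_continuous_on ballI
      differentiable_imp_continuous_within schwartz_differentiable assms)

lemma schwartz_decay:
  assumes "schwartz \<phi>"
  obtains C where "0 \<le> C" "\<And>x. (1 + norm x) ^ n * norm (\<phi> x) \<le> C"
proof -
  have "bounded (range (\<lambda>x. (1 + norm x) ^ n *\<^sub>R \<phi> x))"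
    using assms unfolding schwartz_def by (metis lists.Nil iter_partial.simps(1))
  then obtain C where C: "\<And>x. norm ((1 + norm x) ^ n *\<^sub>R \<phi> x) \<le> C"
    unfolding bounded_iff by blast
  have "(1 + norm x) ^ n * norm (\<phi> x) \<le> C" for x using C[of x] by simp
  moreover have "0 \<le> C" using norm_ge_zero C order_trans by blast
  ultimately show thesis by (rule that[rotated])
qed

lemma schwartz_le_weight:
  assumes "schwartz (\<phi> :: 'a::euclidean_space \<Rightarrow> complex)"
  obtains C where "0 \<le> C" "\<And>x. norm (\<phi> x) \<le> C * weight x"
proof -
  obtain C where C: "0 \<le> C" "\<And>x. (1 + norm x) ^ (2 * DIM('a)) * norm (\<phi> x) \<le> C"
    using schwartz_decay[OF assms] by blast
  have "norm (\<phi> x) \<le> C * weight x" for x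
  proof -
    have "1 \<le> (1 + (norm x)\<^sup>2) ^ DIM('a) * weight x" by (rule weight_ge)
    also have "\<dots> \<le> ((1 + norm x)\<^sup>2) ^ DIM('a) * weight x"
      by (intro mult_right_mono power_mono) (auto simp: power2_eq_square algebra_simps)
    also have "\<dots> = (1 + norm x) ^ (2 * DIM('a)) * weight x" by (simp add: power_mult)
    finally have "norm (\<phi> x) * 1 \<le> norm (\<phi> x) * ((1 + norm x) ^ (2 * DIM('a)) * weight x)"
      by (rule mult_left_mono) simp
    also have "\<dots> = ((1 + norm x) ^ (2 * DIM('a)) * norm (\<phi> x)) * weight x" by simp
    also have "\<dots> \<le> C * weight x" by (intro mult_right_mono C) simp
    finally show ?thesis by simp
  qed
  with C(1) show thesis by (rule that)
qed

lemma integrable_weight: "integrable lborel (weight :: 'a::euclidean_space \<Rightarrow> real)"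
  using nn_integral_weight_finite[where 'a = 'a] by (simp add: integrable_iff_bounded)

lemma integrable_le_weight:
  fixes f :: "'a::euclidean_space \<Rightarrow> complex"
  assumes "f \<in> borel_measurable borel" "\<And>x. norm (f x) \<le> C * weight x"
  shows "integrable lborel f"
proof (rule Bochner_Integration.integrable_bound)
  show "integrable lborel (\<lambda>x::'a. C * weight x)" by (simp add: integrable_weight)
  show "AE x in lborel. norm (f x) \<le> norm (C * weight x)"
    using assms(2) abs_ge_self order_trans by (intro AE_I2) (fastforce)
qed (use assms(1) in simp)

lemma schwartz_integrable:
  assumes "schwartz (\<phi> :: 'a::euclidean_space \<Rightarrow> complex)"
  shows "integrable lborel \<phi>"
  using schwartz_le_weight[OF assms] integrable_le_weight[OF schwartz_measurable[OF assms]] by metis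

lemma integrable_mult_character:
  assumes "integrable lborel f"
  shows "integrable lborel (\<lambda>x. f x * character \<omega> x)"
proof (rule Bochner_Integration.integrable_bound[OF assms])
  show "(\<lambda>x. f x * character \<omega> x) \<in> borel_measurable lborel"
    using borel_measurable_integrable[OF assms] by measurable
qed (simp add: norm_mult)

lemma norm_fourier_le: "norm (fourier \<phi> y) \<le> (\<integral>x. norm (\<phi> x) \<partial>lborel)"
proof -
  have "norm (fourier \<phi> y) \<le> (\<integral>x. norm (\<phi> x * character (- y) x) \<partial>lborel)"
    unfolding fourier_eq by (rule integral_norm_bound)
  then show ?thesis by (simp add: norm_mult)
qed

lemma iter_partial_shift:
  "iter_partial vs (\<lambda>x. \<phi> (x + t)) = (\<lambda>x. iter_partial vs \<phi> (x + t))"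
proof (induction vs)
  case (Cons v vs)
  have "frechet_derivative (\<lambda>x. F (x + t)) (at x) = frechet_derivative F (at (x + t))" for F :: "'a \<Rightarrow> complex" and x
  proof -
    have "((\<lambda>x. F (x + t)) has_derivative D) (at x) \<longleftrightarrow> (F has_derivative D) (at (x + t))" for D
      unfolding has_derivative_at by (simp add: algebra_simps)
    then show ?thesis unfolding frechet_derivative_def by simp
  qed
  then show ?case using Cons by simp
qed simp

lemma schwartz_shift:
  assumes "schwartz \<phi>" shows "schwartz (\<lambda>x. \<phi> (x + t))"
  unfolding schwartz_def iter_partial_shift
proof (intro ballI conjI allI)
  fix vs :: "'a list" and n assume vs: "vs \<in> lists Basis"
  have s: "schwartz (iter_partial vs \<phi>)" by (rule schwartz_iter_partial[OF assms vs])
  show "(\<lambda>x. iter_partial vs \<phi> (x + t)) differentiable at x" for x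
    using schwartz_differentiable[OF s, of "x + t"] differentiable_chain_at[of "\<lambda>x. x + t" x "iter_partial vs \<phi>"]
    by (simp add: o_def)
  obtain C where C: "0 \<le> C" "\<And>x. (1 + norm x) ^ n * norm (iter_partial vs \<phi> x) \<le> C"
    using schwartz_decay[OF s] by blast
  have "norm ((1 + norm x) ^ n *\<^sub>R iter_partial vs \<phi> (x + t)) \<le> (1 + norm t) ^ n * C" for x
  proof -
    have "1 + norm x \<le> (1 + norm t) * (1 + norm (x + t))"
    proof -
      have "norm x \<le> norm (x + t) + norm t" using norm_triangle_ineq4[of "x + t" t] by simp
      moreover have "0 \<le> norm t * norm (x + t)" by simp
      ultimately show ?thesis unfolding ring_distribs by linarith
    qed
    then have "(1 + norm x) ^ n \<le> ((1 + norm t) * (1 + norm (x + t))) ^ n"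
      by (rule power_mono) simp
    then have "(1 + norm x) ^ n * norm (iter_partial vs \<phi> (x + t)) \<le>
        (1 + norm t) ^ n * ((1 + norm (x + t)) ^ n * norm (iter_partial vs \<phi> (x + t)))"
      by (simp add: power_mult_distrib mult_right_mono flip: mult.assoc)
    also have "\<dots> \<le> (1 + norm t) ^ n * C"
      by (intro mult_left_mono C) simp
    finally show ?thesis by simp
  qed
  then show "bounded (range (\<lambda>x. (1 + norm x) ^ n *\<^sub>R iter_partial vs \<phi> (x + t)))"
    unfolding bounded_iff by blast
qed

lemma fourier_shift:
  assumes [measurable]: "\<phi> \<in> borel_measurable borel"
  shows "fourier (\<lambda>x. \<phi> (x + t)) y = character t y * fourier \<phi> y"
proof -
  have "fourier (\<lambda>x. \<phi> (x + t)) y = (\<integral>x. (\<lambda>z. \<phi> z * (character (- y) z * character t y)) (x + t) \<partial>lborel)"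
    unfolding fourier_eq
    by (intro Bochner_Integration.integral_cong refl)
      (simp add: character_def cis_mult inner_add_left inner_commute algebra_simps)
  also have "\<dots> = (\<integral>z. \<phi> z * (character (- y) z * character t y) \<partial>lborel)"
    by (rule lborel_integral_shift) measurable
  also have "\<dots> = character t y * fourier \<phi> y"
    unfolding fourier_eq by (subst integral_mult_right_zero[symmetric]) (simp add: mult_ac)
  finally show ?thesis .
qed

text \<open>
  The difference quotients of \<phi> in direction i converge to the derivative, dominated by a multiple of
  the weight through the mean value inequality.  Their Fourier transforms are \<phi>'s own Fourier transform
  times difference quotients of a character, because a shift becomes a multiplication.
\<close>

lemma fourier_iter_partial:
  fixes \<phi> :: "'a::euclidean_space \<Rightarrow> complex"
  assumes \<phi>: "schwartz \<phi>" and i: "i \<in> Basis"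
  shows "fourier (iter_partial [i] \<phi>) y = 2 * pi * \<i> * (y \<bullet> i) * fourier \<phi> y"
proof -
  define D where "D = iter_partial [i] \<phi>"
  have D: "schwartz D" unfolding D_def using i by (intro schwartz_iter_partial \<phi>) auto
  note [measurable] = schwartz_measurable[OF \<phi>] schwartz_measurable[OF D]
  obtain C where C: "0 \<le> C" "\<And>x. norm (D x) \<le> C * weight x" using schwartz_le_weight[OF D] by blast
  have deriv: "((\<lambda>t. \<phi> (x + t *\<^sub>R i)) has_derivative (\<lambda>h. h *\<^sub>R D (x + t *\<^sub>R i))) (at t)" for x t
  proof -
    have d: "(\<phi> has_derivative frechet_derivative \<phi> (at (x + t *\<^sub>R i))) (at (x + t *\<^sub>R i))"
      using schwartz_differentiable[OF \<phi>] frechet_derivative_works by blast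
    have "((\<lambda>t. \<phi> (x + t *\<^sub>R i)) has_derivative (\<lambda>h. frechet_derivative \<phi> (at (x + t *\<^sub>R i)) (h *\<^sub>R i))) (at t)"
    proof (rule has_derivative_compose[where g = \<phi>])
      show "((\<lambda>t. x + t *\<^sub>R i) has_derivative (\<lambda>h. h *\<^sub>R i)) (at t)"
        by (auto intro!: derivative_eq_intros)
    qed (rule d)
    then show ?thesis
      using linear_frechet_derivative[OF schwartz_differentiable[OF \<phi>, of "x + t *\<^sub>R i"]]
      by (simp add: D_def linear_scale)
  qed
  define s where "s n = inverse (real (Suc n))" for n
  have s: "0 < s n" "s n \<le> 1" for n by (auto simp: s_def inverse_le_1_iff)
  have s_lim: "filterlim s (at 0) sequentially"
  proof -
    have "s \<longlonglongrightarrow> 0" unfolding s_def by (rule LIMSEQ_inverse_real_of_nat)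
    moreover have "s n \<noteq> 0" for n using s(1)[of n] by simp
    ultimately show ?thesis by (simp add: filterlim_at)
  qed
  define F where "F n x = (\<phi> (x + s n *\<^sub>R i) - \<phi> x) / complex_of_real (s n)" for n x
  have F_lim: "(\<lambda>n. F n x) \<longlonglongrightarrow> D x" for x
  proof -
    let ?q = "\<lambda>t. (\<phi> (x + t *\<^sub>R i) - \<phi> x) /\<^sub>R t"
    have "((\<lambda>t. norm (\<phi> (x + t *\<^sub>R i) - \<phi> x - t *\<^sub>R D x) / \<bar>t\<bar>) \<longlongrightarrow> 0) (at 0)"
      using deriv[of x 0] by (simp add: has_derivative_iff_norm)
    moreover have "\<forall>\<^sub>F t in at 0. norm (\<phi> (x + t *\<^sub>R i) - \<phi> x - t *\<^sub>R D x) / \<bar>t\<bar> = norm (?q t - D x)"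
    proof (rule eventually_at_topological[THEN iffD2], intro exI conjI ballI impI)
      fix t :: real assume "t \<noteq> 0"
      then have "?q t - D x = (\<phi> (x + t *\<^sub>R i) - \<phi> x - t *\<^sub>R D x) /\<^sub>R t"
        by (simp add: algebra_simps)
      then show "norm (\<phi> (x + t *\<^sub>R i) - \<phi> x - t *\<^sub>R D x) / \<bar>t\<bar> = norm (?q t - D x)"
        by (simp only: norm_scaleR) (simp add: field_simps)
    qed (rule open_UNIV, simp)
    ultimately have "((\<lambda>t. norm (?q t - D x)) \<longlongrightarrow> 0) (at 0)"
      by (rule Lim_transform_eventually)
    then have "(?q \<longlongrightarrow> D x) (at 0)"
      by (rule LIM_zero_cancel[OF tendsto_norm_zero_cancel])
    from filterlim_compose[OF this s_lim] show ?thesis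
      by (simp add: F_def scaleR_conv_of_real field_simps)
  qed
  have F_bound: "norm (F n x) \<le> C * 3 ^ DIM('a) * weight x" for n x
  proof -
    have "norm (\<phi> (x + s n *\<^sub>R i) - \<phi> (x + 0 *\<^sub>R i)) \<le> (C * 3 ^ DIM('a) * weight x) * norm (s n - 0)"
    proof (rule differentiable_bound[where S = "{0..s n}" and f = "\<lambda>t. \<phi> (x + t *\<^sub>R i)"])
      fix t assume t: "t \<in> {0..s n}"
      show "((\<lambda>t. \<phi> (x + t *\<^sub>R i)) has_derivative (\<lambda>h. h *\<^sub>R D (x + t *\<^sub>R i))) (at t within {0..s n})"
        using deriv by (rule has_derivative_at_withinI)
      have "norm (D (x + t *\<^sub>R i)) \<le> C * weight (x + t *\<^sub>R i)" by (rule C)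
      also have "\<dots> \<le> C * (3 ^ DIM('a) * weight x)"
        using t s(2)[of n] i by (intro mult_left_mono weight_le C) auto
      finally have "norm (D (x + t *\<^sub>R i)) \<le> C * 3 ^ DIM('a) * weight x" by simp
      then show "onorm (\<lambda>h. h *\<^sub>R D (x + t *\<^sub>R i)) \<le> C * 3 ^ DIM('a) * weight x"
        using C(1) by (intro onorm_bound) (auto simp: mult.commute intro: mult_left_mono)
    qed (use s[of n] in auto)
    then show ?thesis using s(1)[of n] by (simp add: F_def norm_divide field_simps)
  qed
  have "(\<lambda>n. fourier (F n) y) \<longlonglongrightarrow> fourier D y"
    unfolding fourier_eq
  proof (rule integral_dominated_convergence[where w = "\<lambda>x. C * 3 ^ DIM('a) * weight x"])
    show "integrable lborel (\<lambda>x::'a. C * 3 ^ DIM('a) * weight x)"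
      by (simp add: integrable_weight)
    show "AE x in lborel. (\<lambda>n. F n x * character (- y) x) \<longlonglongrightarrow> D x * character (- y) x"
      by (intro AE_I2 tendsto_intros F_lim)
    show "AE x in lborel. norm (F n x * character (- y) x) \<le> C * 3 ^ DIM('a) * weight x" for n
      using F_bound by (auto simp: norm_mult)
  qed (auto simp: F_def)
  moreover have "fourier (F n) y = fourier \<phi> y * ((cis (2 * pi * (y \<bullet> i) * s n) - 1) / complex_of_real (s n))" for n
  proof -
    have int: "integrable lborel (\<lambda>x. \<phi> (x + s n *\<^sub>R i) * character (- y) x)"
        "integrable lborel (\<lambda>x. \<phi> x * character (- y) x)"
      by (intro integrable_mult_character schwartz_integrable schwartz_shift \<phi>)+
    have "fourier (F n) y = (\<integral>x. (\<phi> (x + s n *\<^sub>R i) * character (- y) x - \<phi> x * character (- y) x) / complex_of_real (s n) \<partial>lborel)"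
      unfolding fourier_eq F_def by (intro Bochner_Integration.integral_cong refl) (simp add: algebra_simps diff_divide_distrib)
    also have "\<dots> = (fourier (\<lambda>x. \<phi> (x + s n *\<^sub>R i)) y - fourier \<phi> y) / complex_of_real (s n)"
      unfolding fourier_eq using int by simp
    also have "fourier (\<lambda>x. \<phi> (x + s n *\<^sub>R i)) y = character (s n *\<^sub>R i) y * fourier \<phi> y"
      by (rule fourier_shift) measurable
    finally show ?thesis
      by (simp add: character_def algebra_simps diff_divide_distrib)
  qed
  moreover have "(\<lambda>n. fourier \<phi> y * ((cis (2 * pi * (y \<bullet> i) * s n) - 1) / complex_of_real (s n)))
      \<longlonglongrightarrow> fourier \<phi> y * (\<i> * (2 * pi * (y \<bullet> i)))"
  proof (intro tendsto_intros)
    let ?c = "\<i> * (2 * pi * (y \<bullet> i)) :: complex"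
    have "((\<lambda>z. exp (?c * z)) has_field_derivative ?c) (at 0)"
      by (auto intro!: derivative_eq_intros)
    then have "((\<lambda>z. (exp (?c * z) - 1) / z) \<longlongrightarrow> ?c) (at 0)"
      by (simp add: DERIV_def)
    moreover have "filterlim (\<lambda>n. complex_of_real (s n)) (at 0) sequentially"
      unfolding filterlim_at using s_lim s(1) tendsto_of_real[of s 0 sequentially]
      by (auto simp: filterlim_at less_imp_neq[symmetric])
    ultimately have "(\<lambda>n. (exp (?c * complex_of_real (s n)) - 1) / complex_of_real (s n)) \<longlonglongrightarrow> ?c"
      by (rule filterlim_compose)
    then show "(\<lambda>n. (cis (2 * pi * (y \<bullet> i) * s n) - 1) / complex_of_real (s n)) \<longlonglongrightarrow> ?c"
      by (simp add: cis_conv_exp mult_ac)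
  qed
  ultimately have "fourier D y = fourier \<phi> y * (\<i> * (2 * pi * (y \<bullet> i)))"
    by (metis (no_types, lifting) LIMSEQ_unique ext)
  then show ?thesis by (simp add: D_def mult_ac)
qed

lemma one_plus_norm_power_le:
  "(1 + norm (y::'a::euclidean_space)) ^ n \<le> (1 + real DIM('a)) ^ n * (1 + (\<Sum>i\<in>Basis. \<bar>y \<bullet> i\<bar> ^ n))"
proof -
  have "Max ((\<lambda>i. \<bar>y \<bullet> i\<bar>) ` Basis) \<in> (\<lambda>i. \<bar>y \<bullet> i\<bar>) ` Basis"
    by (rule Max_in) auto
  then obtain j where j: "Max ((\<lambda>i. \<bar>y \<bullet> i\<bar>) ` Basis) = \<bar>y \<bullet> j\<bar>" "j \<in> Basis"
    by (rule imageE)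
  have max: "\<bar>y \<bullet> i\<bar> \<le> \<bar>y \<bullet> j\<bar>" if "i \<in> Basis" for i
    unfolding j(1)[symmetric] using that by (intro Max_ge) auto
  define m where "m = max 1 \<bar>y \<bullet> j\<bar>"
  have "norm y \<le> (\<Sum>i\<in>Basis. \<bar>y \<bullet> i\<bar>)" by (rule norm_le_l1)
  also have "\<dots> \<le> (\<Sum>i\<in>(Basis::'a set). m)" by (rule sum_mono) (use max in \<open>auto simp: m_def le_max_iff_disj\<close>)
  finally have "1 + norm y \<le> (1 + real DIM('a)) * m"
    by (simp add: m_def algebra_simps)
  then have "(1 + norm y) ^ n \<le> ((1 + real DIM('a)) * m) ^ n" by (rule power_mono) simp
  also have "\<dots> = (1 + real DIM('a)) ^ n * m ^ n" by (rule power_mult_distrib)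
  also have "m ^ n \<le> 1 + (\<Sum>i\<in>Basis. \<bar>y \<bullet> i\<bar> ^ n)"
  proof -
    have "\<bar>y \<bullet> j\<bar> ^ n \<le> (\<Sum>i\<in>Basis. \<bar>y \<bullet> i\<bar> ^ n)"
      using j(2) by (intro member_le_sum) auto
    moreover have "0 \<le> (\<Sum>i\<in>Basis. \<bar>y \<bullet> i\<bar> ^ n)" by (intro sum_nonneg) simp
    ultimately show ?thesis by (auto simp: m_def max_def)
  qed
  finally show ?thesis by (simp add: mult_left_mono)
qed

text \<open>
  Each coordinate power of y times the transform is, up to a constant, the transform of an iterated
  derivative and therefore bounded.
\<close>

lemma fourier_schwartz_decay:
  fixes \<phi> :: "'a::euclidean_space \<Rightarrow> complex"
  assumes \<phi>: "schwartz \<phi>"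
  obtains C where "0 \<le> C" "\<And>y. norm (fourier \<phi> y) \<le> C / (1 + norm y) ^ n"
proof -
  have deriv: "schwartz (iter_partial (replicate k i) \<phi>) \<and>
      fourier (iter_partial (replicate k i) \<phi>) y = (2 * pi * \<i> * (y \<bullet> i)) ^ k * fourier \<phi> y"
    if i: "i \<in> Basis" for i :: 'a and y and k
  proof (induction k)
    case (Suc k)
    have "iter_partial (replicate (Suc k) i) \<phi> = iter_partial [i] (iter_partial (replicate k i) \<phi>)"
      by (simp add: iter_partial_append)
    moreover have "schwartz (iter_partial (replicate (Suc k) i) \<phi>)"
      using i by (intro schwartz_iter_partial \<phi>) auto
    ultimately show ?case using fourier_iter_partial[OF _ i] Suc by (simp add: mult_ac)
  qed (use \<phi> in simp)
  define L where "L i = (\<integral>x. norm (iter_partial (replicate n i) \<phi> x) \<partial>lborel)" for i :: 'a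
  define C where "C = (1 + real DIM('a)) ^ n * ((\<integral>x. norm (\<phi> x) \<partial>lborel) + (\<Sum>i\<in>Basis. L i))"
  have coord: "\<bar>y \<bullet> i\<bar> ^ n * norm (fourier \<phi> y) \<le> L i" if "i \<in> Basis" for i y
  proof -
    have "1 * \<bar>y \<bullet> i\<bar> \<le> (2 * pi) * \<bar>y \<bullet> i\<bar>"
      using pi_ge_two by (intro mult_right_mono) auto
    then have "\<bar>y \<bullet> i\<bar> ^ n \<le> (2 * pi * \<bar>y \<bullet> i\<bar>) ^ n" by (intro power_mono) auto
    then have "\<bar>y \<bullet> i\<bar> ^ n * norm (fourier \<phi> y) \<le> (2 * pi * \<bar>y \<bullet> i\<bar>) ^ n * norm (fourier \<phi> y)"
      by (rule mult_right_mono) simp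
    also have "\<dots> = norm (fourier (iter_partial (replicate n i) \<phi>) y)"
      using deriv[OF that, of n y] by (simp add: norm_mult norm_power)
    also have "\<dots> \<le> L i" unfolding L_def by (rule norm_fourier_le)
    finally show ?thesis .
  qed
  have "(1 + norm y) ^ n * norm (fourier \<phi> y) \<le> C" for y
  proof -
    have "(1 + norm y) ^ n * norm (fourier \<phi> y) \<le>
        ((1 + real DIM('a)) ^ n * (1 + (\<Sum>i\<in>Basis. \<bar>y \<bullet> i\<bar> ^ n))) * norm (fourier \<phi> y)"
      by (intro mult_right_mono one_plus_norm_power_le) simp
    also have "\<dots> = (1 + real DIM('a)) ^ n *
        (norm (fourier \<phi> y) + (\<Sum>i\<in>Basis. \<bar>y \<bullet> i\<bar> ^ n * norm (fourier \<phi> y)))"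
      by (simp add: algebra_simps sum_distrib_left sum_distrib_right)
    also have "\<dots> \<le> C"
      unfolding C_def by (intro mult_left_mono add_mono sum_mono norm_fourier_le coord) auto
    finally show ?thesis .
  qed
  then have "norm (fourier \<phi> y) \<le> C / (1 + norm y) ^ n" for y
    using zero_less_power[of "1 + norm y" n]
    by (simp add: pos_le_divide_eq add_pos_nonneg mult.commute)
  moreover have "0 \<le> C"
    unfolding C_def L_def by (intro mult_nonneg_nonneg add_nonneg_nonneg sum_nonneg integral_nonneg_AE) auto
  ultimately show thesis by (rule that[rotated])
qed

section \<open>Gaussians and tent functions\<close>

lemma power_le_fact_exp:
  fixes z :: real assumes "0 \<le> z" shows "z ^ k \<le> fact k * exp z"
proof -
  have "inverse (fact k) * z ^ k \<le> (\<Sum>n. inverse (fact n) * z ^ n)"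
    using sum_le_suminf[OF summable_exp, of "{k}" z] assms by simp
  also have "\<dots> = exp z" by (simp add: exp_def scaleR_conv_of_real divide_inverse)
  finally show ?thesis by (simp add: field_simps)
qed

text \<open>
  One has (1 + r)^k \<le> k! e^(1 + r), and completing the square bounds the exponent r - c r^2.
\<close>

lemma power_mult_gauss_le:
  fixes r c :: real assumes "0 \<le> r" "0 < c"
  shows "(1 + r) ^ k * exp (- (c * r\<^sup>2)) \<le> fact k * exp (1 + 1 / (4 * c))"
proof -
  have "0 \<le> c * (r - 1 / (2 * c))\<^sup>2" using assms by simp
  also have "\<dots> = c * r\<^sup>2 - r + 1 / (4 * c)"
    using assms by (simp add: power2_eq_square field_simps)
  finally have le: "1 + r - c * r\<^sup>2 \<le> 1 + 1 / (4 * c)" by simp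
  have "(1 + r) ^ k * exp (- (c * r\<^sup>2)) \<le> (fact k * exp (1 + r)) * exp (- (c * r\<^sup>2))"
    using assms by (intro mult_right_mono power_le_fact_exp) auto
  also have "\<dots> = fact k * exp (1 + r - c * r\<^sup>2)" by (simp add: exp_diff exp_minus field_simps)
  also have "\<dots> \<le> fact k * exp (1 + 1 / (4 * c))" using le by simp
  finally show ?thesis .
qed

definition gauss :: "real \<Rightarrow> 'a::euclidean_space \<Rightarrow> real" where
  "gauss t x = exp (- (pi * t\<^sup>2 * (norm x)\<^sup>2))"

text \<open>
  The factors that derivatives of a modulated Gaussian can acquire.  The class is closed under
  directional derivatives and its members grow polynomially, which is all that is needed to see that
  modulated Gaussians are Schwartz functions.
\<close>

inductive polynomial_fun :: "('a::euclidean_space \<Rightarrow> complex) \<Rightarrow> bool" where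
  const: "polynomial_fun (\<lambda>x. k)"
| linear: "polynomial_fun (\<lambda>x. complex_of_real (x \<bullet> v))"
| add: "polynomial_fun p \<Longrightarrow> polynomial_fun q \<Longrightarrow> polynomial_fun (\<lambda>x. p x + q x)"
| mult: "polynomial_fun p \<Longrightarrow> polynomial_fun q \<Longrightarrow> polynomial_fun (\<lambda>x. p x * q x)"

lemma polynomial_fun_derivative:
  "polynomial_fun p \<Longrightarrow>
    \<exists>D. (\<forall>x. (p has_derivative D x) (at x)) \<and> (\<forall>v. polynomial_fun (\<lambda>x. D x v))"
proof (induction rule: polynomial_fun.induct)
  case (const k)
  show ?case by (rule exI[of _ "\<lambda>x v. 0"]) (auto intro: polynomial_fun.const)
next
  case (linear v)
  show ?case
    by (rule exI[of _ "\<lambda>x h. complex_of_real (h \<bullet> v)"])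
      (auto intro!: derivative_eq_intros polynomial_fun.const)
next
  case (add p q)
  then obtain D E where D: "\<And>x. (p has_derivative D x) (at x)" "\<And>v. polynomial_fun (\<lambda>x. D x v)"
    and E: "\<And>x. (q has_derivative E x) (at x)" "\<And>v. polynomial_fun (\<lambda>x. E x v)" by blast
  show ?case
    by (rule exI[of _ "\<lambda>x v. D x v + E x v"])
      (auto intro!: has_derivative_add D E polynomial_fun.add)
next
  case (mult p q)
  then obtain D E where D: "\<And>x. (p has_derivative D x) (at x)" "\<And>v. polynomial_fun (\<lambda>x. D x v)"
    and E: "\<And>x. (q has_derivative E x) (at x)" "\<And>v. polynomial_fun (\<lambda>x. E x v)" by blast
  show ?case
    by (rule exI[of _ "\<lambda>x v. p x * E x v + D x v * q x"])
      (auto intro!: has_derivative_mult D E polynomial_fun.add polynomial_fun.mult mult.hyps)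
qed

lemma polynomial_fun_growth:
  "polynomial_fun p \<Longrightarrow> \<exists>C n. 0 \<le> C \<and> (\<forall>x. norm (p x) \<le> C * (1 + norm x) ^ n)"
proof (induction rule: polynomial_fun.induct)
  case (const k)
  show ?case by (rule exI[of _ "norm k"], rule exI[of _ 0]) auto
next
  case (linear v)
  have "norm (complex_of_real (x \<bullet> v)) \<le> norm v * (1 + norm x) ^ 1" for x
    using Cauchy_Schwarz_ineq2[of x v] by (simp add: algebra_simps add_increasing)
  then show ?case by (intro exI[of _ "norm v"] exI[of _ 1]) auto
next
  case (add p q)
  then obtain C n D m where *: "0 \<le> C" "\<And>x. norm (p x) \<le> C * (1 + norm x) ^ n"
    "0 \<le> D" "\<And>x. norm (q x) \<le> D * (1 + norm x) ^ m" by blast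
  have "norm (p x + q x) \<le> (C + D) * (1 + norm x) ^ (n + m)" for x
  proof -
    have "norm (p x + q x) \<le> C * (1 + norm x) ^ n + D * (1 + norm x) ^ m"
      using norm_triangle_ineq[of "p x" "q x"] *(2)[of x] *(4)[of x] by linarith
    also have "\<dots> \<le> C * (1 + norm x) ^ (n + m) + D * (1 + norm x) ^ (n + m)"
      using * by (intro add_mono mult_left_mono power_increasing) auto
    finally show ?thesis by (simp add: algebra_simps)
  qed
  then show ?case using * by (intro exI[of _ "C + D"] exI[of _ "n + m"]) auto
next
  case (mult p q)
  then obtain C n D m where *: "0 \<le> C" "\<And>x. norm (p x) \<le> C * (1 + norm x) ^ n"
    "0 \<le> D" "\<And>x. norm (q x) \<le> D * (1 + norm x) ^ m" by blast
  have "norm (p x * q x) \<le> (C * D) * (1 + norm x) ^ (n + m)" for x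
  proof -
    have "norm (p x * q x) \<le> (C * (1 + norm x) ^ n) * (D * (1 + norm x) ^ m)"
      unfolding norm_mult using * by (intro mult_mono) auto
    then show ?thesis by (simp add: power_add mult_ac)
  qed
  then show ?case using * by (intro exI[of _ "C * D"] exI[of _ "n + m"]) auto
qed

lemma gauss_character_has_derivative:
  fixes s :: "'a::euclidean_space"
  shows "((\<lambda>x. gauss t x * character s x) has_derivative
    (\<lambda>v. (complex_of_real (- 2 * pi * t\<^sup>2) * complex_of_real (x \<bullet> v) + 2 * pi * \<i> * (v \<bullet> s)) *
      (gauss t x * character s x))) (at x)"
proof -
  define L where "L x = complex_of_real (- (pi * t\<^sup>2 * (x \<bullet> x))) + \<i> * complex_of_real (2 * pi * (x \<bullet> s))" for x
  have eq: "gauss t x * character s x = exp (L x)" for x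
    unfolding L_def gauss_def character_def cis_conv_exp power2_norm_eq_inner exp_add exp_of_real ..
  have L: "(L has_derivative (\<lambda>v. complex_of_real (- 2 * pi * t\<^sup>2) * complex_of_real (x \<bullet> v) + 2 * pi * \<i> * (v \<bullet> s))) (at x)"
    unfolding L_def
    by (rule derivative_eq_intros refl)+ (auto simp: fun_eq_iff algebra_simps inner_commute)
  show ?thesis
    unfolding eq
    by (rule has_derivative_compose[OF L, where g = exp])
      (use DERIV_exp in \<open>simp add: has_field_derivative_def mult.commute[of _ "exp _"]\<close>)
qed

lemma iter_partial_gauss:
  fixes s :: "'a::euclidean_space"
  assumes "polynomial_fun p"
  shows "\<exists>q. polynomial_fun q \<and>
    iter_partial vs (\<lambda>x. p x * (gauss t x * character s x)) = (\<lambda>x. q x * (gauss t x * character s x))"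
proof (induction vs)
  case Nil
  then show ?case using assms by auto
next
  case (Cons v vs)
  then obtain q where q: "polynomial_fun q"
    "iter_partial vs (\<lambda>x. p x * (gauss t x * character s x)) = (\<lambda>x. q x * (gauss t x * character s x))" by blast
  obtain D where D: "\<And>x. (q has_derivative D x) (at x)" "\<And>v. polynomial_fun (\<lambda>x. D x v)"
    using polynomial_fun_derivative[OF q(1)] by blast
  define Q where "Q x v = complex_of_real (- 2 * pi * t\<^sup>2) * complex_of_real (x \<bullet> v) + 2 * pi * \<i> * (v \<bullet> s)" for x v
  have E: "((\<lambda>x. gauss t x * character s x) has_derivative (\<lambda>v. Q x v * (gauss t x * character s x))) (at x)" for x
    unfolding Q_def by (rule gauss_character_has_derivative)
  have "((\<lambda>x. q x * (gauss t x * character s x)) has_derivative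
      (\<lambda>v. (q x * Q x v + D x v) * (gauss t x * character s x))) (at x)" for x
    using has_derivative_mult[OF D(1) E, of x] by (simp add: algebra_simps)
  from frechet_derivative_at[OF this, symmetric]
  have "iter_partial (v # vs) (\<lambda>x. p x * (gauss t x * character s x)) =
      (\<lambda>x. (q x * Q x v + D x v) * (gauss t x * character s x))"
    by (simp add: q(2))
  moreover have "polynomial_fun (\<lambda>x. q x * Q x v + D x v)"
    unfolding Q_def by (intro polynomial_fun.intros q D)
  ultimately show ?case by blast
qed

lemma schwartz_gauss:
  fixes s :: "'a::euclidean_space"
  assumes "0 < t"
  shows "schwartz (\<lambda>x. gauss t x * character s x)"
  unfolding schwartz_def
proof (intro ballI conjI allI)
  fix vs :: "'a list" and n
  obtain q where q: "polynomial_fun q"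
    "iter_partial vs (\<lambda>x. gauss t x * character s x) = (\<lambda>x. q x * (gauss t x * character s x))"
    using iter_partial_gauss[OF polynomial_fun.const[of 1], of vs t s] by auto
  show "iter_partial vs (\<lambda>x. gauss t x * character s x) differentiable at x" for x
  proof -
    obtain D where D: "(q has_derivative D) (at x)"
      using polynomial_fun_derivative[OF q(1)] by blast
    have "(\<lambda>x. complex_of_real (gauss t x) * character s x) differentiable at x"
      using gauss_character_has_derivative differentiable_def by blast
    moreover have "q differentiable at x" using D by (auto simp: differentiable_def)
    ultimately show ?thesis unfolding q(2) by (rule differentiable_mult[rotated])
  qed
  obtain C m where C: "0 \<le> C" "\<And>x. norm (q x) \<le> C * (1 + norm x) ^ m"
    using polynomial_fun_growth[OF q(1)] by blast
  have "norm ((1 + norm x) ^ n *\<^sub>R (q x * (gauss t x * character s x))) \<le>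
      C * (fact (n + m) * exp (1 + 1 / (4 * (pi * t\<^sup>2))))" for x
  proof -
    have "norm ((1 + norm x) ^ n *\<^sub>R (q x * (gauss t x * character s x))) =
        (1 + norm x) ^ n * norm (q x) * gauss t x"
      by (simp add: norm_mult gauss_def)
    also have "\<dots> \<le> (1 + norm x) ^ n * (C * (1 + norm x) ^ m) * gauss t x"
      by (intro mult_right_mono mult_left_mono C) (auto simp: gauss_def)
    also have "\<dots> = C * ((1 + norm x) ^ (n + m) * exp (- ((pi * t\<^sup>2) * (norm x)\<^sup>2)))"
      by (simp add: gauss_def power_add mult_ac)
    also have "\<dots> \<le> C * (fact (n + m) * exp (1 + 1 / (4 * (pi * t\<^sup>2))))"
      using assms by (intro mult_left_mono power_mult_gauss_le C) auto
    finally show ?thesis .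
  qed
  then show "bounded (range (\<lambda>x. (1 + norm x) ^ n *\<^sub>R iter_partial vs (\<lambda>x. gauss t x * character s x) x))"
    unfolding q(2) bounded_iff by blast
qed

lemma lborel_integral_prod:
  fixes f :: "'a::euclidean_space \<Rightarrow> real \<Rightarrow> complex"
  assumes "\<And>i. i \<in> Basis \<Longrightarrow> integrable lborel (f i)"
  shows "(\<integral>x. (\<Prod>i\<in>Basis. f i (x \<bullet> i)) \<partial>lborel) = (\<Prod>i\<in>Basis. \<integral>u. f i u \<partial>lborel)"
    and "integrable lborel (\<lambda>x. \<Prod>i\<in>Basis. f i (x \<bullet> i))"
proof -
  interpret product_sigma_finite "\<lambda>_::'a. lborel :: real measure" ..
  have [measurable]: "f i \<in> borel_measurable borel" if "i \<in> Basis" for i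
    using borel_measurable_integrable[OF assms[OF that]] by simp
  have meas: "(\<lambda>x::'a. \<Prod>i\<in>Basis. f i (x \<bullet> i)) \<in> borel_measurable borel" by measurable
  have coord: "(\<Prod>i\<in>Basis. f i ((\<Sum>b\<in>Basis. g b *\<^sub>R b) \<bullet> i)) = (\<Prod>i\<in>Basis. f i (g i))" for g :: "'a \<Rightarrow> real"
    by (intro prod.cong refl) simp
  have meas': "(\<lambda>g. \<Sum>b\<in>Basis. g b *\<^sub>R b) \<in> measurable (\<Pi>\<^sub>M b\<in>Basis. lborel) (borel :: 'a measure)"
    by measurable
  show "(\<integral>x. (\<Prod>i\<in>Basis. f i (x \<bullet> i)) \<partial>lborel) = (\<Prod>i\<in>Basis. \<integral>u. f i u \<partial>lborel)"
    unfolding lborel_eq[where 'a = 'a] integral_distr[OF meas' meas] coord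
    by (rule product_integral_prod) (auto simp: assms)
  show "integrable lborel (\<lambda>x. \<Prod>i\<in>Basis. f i (x \<bullet> i))"
    unfolding lborel_eq[where 'a = 'a] integrable_distr_eq[OF meas' meas] coord
    by (rule product_integrable_prod) (auto simp: assms)
qed

text \<open>
  The substitution x \<mapsto> t sqrt(2 \<pi>) x turns this into the characteristic function of the standard normal
  distribution.
\<close>

lemma integral_gauss_real:
  assumes "0 < t"
  shows "integrable lborel (\<lambda>x::real. complex_of_real (exp (- (pi * t\<^sup>2 * x\<^sup>2))) * cis (2 * pi * x * u))"
    and "(\<integral>x. complex_of_real (exp (- (pi * t\<^sup>2 * x\<^sup>2))) * cis (2 * pi * x * u) \<partial>lborel) =
      complex_of_real (exp (- (pi * u\<^sup>2 / t\<^sup>2)) / t)"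
proof -
  define a where "a = t * sqrt (2 * pi)"
  have a: "0 < a" "a\<^sup>2 = t\<^sup>2 * (2 * pi)" using assms by (simp_all add: a_def power_mult_distrib)
  define v where "v = 2 * pi * u / a"
  define f where "f x = complex_of_real (std_normal_density x) * cis (v * x)" for x
  have v: "v\<^sup>2 / 2 = pi * u\<^sup>2 / t\<^sup>2"
    using a assms by (simp add: v_def power_divide power_mult_distrib) (simp add: power2_eq_square field_simps)
  have f_int: "(\<integral>x. f x \<partial>lborel) = complex_of_real (exp (- (v\<^sup>2 / 2)))"
  proof -
    have "char std_normal_distribution v = (\<integral>x. f x \<partial>lborel)"
      unfolding char_def f_def by (subst integral_density) (auto simp: scaleR_conv_of_real cis_conv_exp mult_ac)
    then show ?thesis by (simp add: char_std_normal_distribution)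
  qed
  have f_integrable: "integrable lborel f"
  proof (rule Bochner_Integration.integrable_bound)
    show "integrable lborel std_normal_density" by (rule integrable_normal_density) simp
    show "f \<in> borel_measurable lborel" unfolding f_def
      by (intro borel_measurable_times borel_measurable_of_real) (auto intro!: borel_measurable_continuous_onI continuous_intros)
  qed (auto simp: f_def norm_mult)
  have f_eq: "f (0 + a * x) = complex_of_real (inverse (sqrt (2 * pi))) * (complex_of_real (exp (- (pi * t\<^sup>2 * x\<^sup>2))) * cis (2 * pi * x * u))" for x
  proof -
    have "std_normal_density (a * x) = inverse (sqrt (2 * pi)) * exp (- (pi * t\<^sup>2 * x\<^sup>2))"
      by (simp add: std_normal_density_def power_mult_distrib a(2) field_simps)
    moreover have "v * (a * x) = 2 * pi * x * u" using a(1) by (simp add: v_def)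
    ultimately show ?thesis by (simp only: f_def add_0 of_real_mult mult.assoc)
  qed
  show int: "integrable lborel (\<lambda>x::real. complex_of_real (exp (- (pi * t\<^sup>2 * x\<^sup>2))) * cis (2 * pi * x * u))"
  proof -
    have "integrable lborel (\<lambda>x. f (0 + a * x))"
      using lborel_integrable_real_affine[OF f_integrable, of a 0] a(1) by simp
    then have "integrable lborel (\<lambda>x. complex_of_real (sqrt (2 * pi)) * f (0 + a * x))"
      by (rule integrable_mult_right)
    moreover have k: "complex_of_real (sqrt (2 * pi)) * (complex_of_real (inverse (sqrt (2 * pi))) * z) = z" for z
      by simp
    ultimately show ?thesis by (simp only: f_eq k)
  qed
  have "complex_of_real (exp (- (v\<^sup>2 / 2))) = a *\<^sub>R (\<integral>x. f (0 + a * x) \<partial>lborel)"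
    using lborel_integral_real_affine[of a f 0] a(1) f_int by simp
  also have "\<dots> = t * (\<integral>x. complex_of_real (exp (- (pi * t\<^sup>2 * x\<^sup>2))) * cis (2 * pi * x * u) \<partial>lborel)"
    unfolding f_eq by (simp add: a_def scaleR_conv_of_real)
  finally show "(\<integral>x. complex_of_real (exp (- (pi * t\<^sup>2 * x\<^sup>2))) * cis (2 * pi * x * u) \<partial>lborel) =
      complex_of_real (exp (- (pi * u\<^sup>2 / t\<^sup>2)) / t)"
    using assms by (simp add: v field_simps)
qed

lemma norm_power2_eq_sum: "(norm x)\<^sup>2 = (\<Sum>i\<in>Basis. (x \<bullet> i)\<^sup>2)"
  by (subst power2_norm_eq_inner, subst euclidean_inner) (simp add: power2_eq_square)

text \<open>
  The Fourier transform of the Gaussian, an approximate identity for t \<rightarrow> 0.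
\<close>

definition gauss_hat :: "real \<Rightarrow> 'a::euclidean_space \<Rightarrow> real" where
  "gauss_hat t y = exp (- (pi * (norm y)\<^sup>2 / t\<^sup>2)) / t ^ DIM('a)"

lemma integral_gauss_character:
  fixes w :: "'a::euclidean_space"
  assumes "0 < t"
  shows "(\<integral>x. gauss t x * character w x \<partial>lborel) = gauss_hat t w"
proof -
  have "(\<integral>x. gauss t x * character w x \<partial>lborel) =
      (\<integral>x. (\<Prod>i\<in>Basis. complex_of_real (exp (- (pi * t\<^sup>2 * (x \<bullet> i)\<^sup>2))) * cis (2 * pi * (x \<bullet> i) * (w \<bullet> i))) \<partial>lborel)"
  proof (intro Bochner_Integration.integral_cong refl)
    fix x :: 'a
    have "gauss t x = (\<Prod>i\<in>Basis. exp (- (pi * t\<^sup>2 * (x \<bullet> i)\<^sup>2)))"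
      unfolding gauss_def norm_power2_eq_sum by (simp add: exp_sum[symmetric] sum_distrib_left sum_negf)
    moreover have "character w x = (\<Prod>i\<in>Basis. cis (2 * pi * (x \<bullet> i) * (w \<bullet> i)))"
      unfolding character_def cis_conv_exp
      by (simp add: exp_sum[symmetric] euclidean_inner[of x w] sum_distrib_left mult_ac)
    ultimately show "gauss t x * character w x =
        (\<Prod>i\<in>Basis. complex_of_real (exp (- (pi * t\<^sup>2 * (x \<bullet> i)\<^sup>2))) * cis (2 * pi * (x \<bullet> i) * (w \<bullet> i)))"
      by (simp add: prod.distrib)
  qed
  also have "\<dots> = (\<Prod>i\<in>(Basis::'a set). complex_of_real (exp (- (pi * (w \<bullet> i)\<^sup>2 / t\<^sup>2)) / t))"
    by (subst lborel_integral_prod) (auto simp: integral_gauss_real[OF assms])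
  also have "\<dots> = gauss_hat t w"
    unfolding gauss_hat_def norm_power2_eq_sum
    by (simp add: prod_dividef exp_sum[symmetric] sum_distrib_left sum_negf sum_divide_distrib flip: of_real_prod)
  finally show ?thesis .
qed

lemma fourier_gauss:
  fixes s :: "'a::euclidean_space"
  assumes "0 < t"
  shows "fourier (\<lambda>x. gauss t x * character s x) y = gauss_hat t (s - y)"
proof -
  have "fourier (\<lambda>x. gauss t x * character s x) y = (\<integral>x. gauss t x * character (s + - y) x \<partial>lborel)"
    unfolding fourier_eq character_add by (simp add: mult.assoc)
  then show ?thesis using integral_gauss_character[OF assms, of "s + - y"] by simp
qed

definition tent :: "real \<Rightarrow> real \<Rightarrow> real" where
  "tent \<eta> u = max 0 (\<eta> - \<bar>u\<bar>)"

lemma tent_nonneg [simp]: "0 \<le> tent \<eta> u"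
  by (simp add: tent_def)

lemma continuous_on_tent [continuous_intros]: "continuous_on A f \<Longrightarrow> continuous_on A (\<lambda>x. tent \<eta> (f x))"
  unfolding tent_def by (intro continuous_intros)

lemma borel_measurable_tent [measurable]: "tent \<eta> \<in> borel_measurable borel"
  unfolding tent_def by measurable

text \<open>
  By an explicit antiderivative; it yields the Fourier transform of a tent on each half of its base.
\<close>

lemma integral_linear_cis:
  fixes a b c p q :: real
  assumes "a \<le> b" "c \<noteq> 0"
  defines "F \<equiv> \<lambda>u. complex_of_real (p + q * u) * cis (c * u) / (\<i> * c) + q * cis (c * u) / c\<^sup>2"
  shows "(\<integral>u. indicator {a..b} u *\<^sub>R (complex_of_real (p + q * u) * cis (c * u)) \<partial>lborel) = F b - F a"
proof (rule integral_FTC_atLeastAtMost[OF \<open>a \<le> b\<close>])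
  show "continuous_on {a..b} (\<lambda>u. complex_of_real (p + q * u) * cis (c * u))"
    by (intro continuous_intros)
next
  fix u
  have cis: "((\<lambda>u. cis (c * u)) has_vector_derivative (\<i> * c * cis (c * u))) (at u within {a..b})"
    unfolding cis_conv_exp
    by (rule derivative_eq_intros has_vector_derivative_real_field refl | simp)+
  have lin: "((\<lambda>u. complex_of_real (p + q * u)) has_vector_derivative q) (at u within {a..b})"
    by (rule has_vector_derivative_of_real) (auto intro!: derivative_eq_intros simp flip: has_real_derivative_iff_has_vector_derivative)
  have "(F has_vector_derivative
      ((complex_of_real (p + q * u) * (\<i> * c * cis (c * u)) + q * cis (c * u)) / (\<i> * c) + q * (\<i> * c * cis (c * u)) / c\<^sup>2))
      (at u within {a..b})"
    unfolding F_def
    by (intro has_vector_derivative_add has_vector_derivative_divide has_vector_derivative_mult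
        has_vector_derivative_mult_right cis lin)
  moreover have "(complex_of_real (p + q * u) * (\<i> * c * cis (c * u)) + q * cis (c * u)) / (\<i> * c) + q * (\<i> * c * cis (c * u)) / c\<^sup>2
      = complex_of_real (p + q * u) * cis (c * u)"
    using assms(2) by (simp add: field_simps power2_eq_square)
  ultimately show "(F has_vector_derivative complex_of_real (p + q * u) * cis (c * u)) (at u within {a..b})" by simp
qed

lemma integrable_tent_cis: "integrable lborel (\<lambda>u. complex_of_real (tent \<eta> u) * cis (c * u))"
proof -
  have "integrable lborel (\<lambda>u. indicator {-\<bar>\<eta>\<bar>..\<bar>\<eta>\<bar>} u *\<^sub>R (complex_of_real (tent \<eta> u) * cis (c * u)))"
    by (intro borel_integrable_compact continuous_intros) auto
  moreover have "indicator {-\<bar>\<eta>\<bar>..\<bar>\<eta>\<bar>} u *\<^sub>R (complex_of_real (tent \<eta> u) * cis (c * u)) =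
      complex_of_real (tent \<eta> u) * cis (c * u)" for u
    by (auto simp: indicator_def tent_def)
  ultimately show ?thesis by simp
qed

text \<open>
  The bound 2 \<eta>^2 is trivial; away from 0 the transform is a second difference of the exponential divided
  by (2 \<pi> x)^2.  This quadratic decay is the reason for using tents instead of indicator functions.
\<close>

lemma tent_fourier_bound:
  assumes "0 < \<eta>"
  shows "norm (\<integral>u. complex_of_real (tent \<eta> u) * cis (2 * pi * x * u) \<partial>lborel) \<le> (2 * \<eta>\<^sup>2 + 1) * inverse (1 + x\<^sup>2)"
proof -
  define T where "T = (\<integral>u. complex_of_real (tent \<eta> u) * cis (2 * pi * x * u) \<partial>lborel)"
  have "norm T \<le> (\<integral>u. norm (complex_of_real (tent \<eta> u) * cis (2 * pi * x * u)) \<partial>lborel)"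
    unfolding T_def by (rule integral_norm_bound)
  also have "\<dots> \<le> (\<integral>u. indicator {-\<eta>..\<eta>} u * \<eta> \<partial>lborel)"
  proof (rule integral_mono)
    show "integrable lborel (\<lambda>u. norm (complex_of_real (tent \<eta> u) * cis (2 * pi * x * u)))"
      by (intro integrable_norm integrable_tent_cis)
    show "integrable lborel (\<lambda>u::real. indicator {-\<eta>..\<eta>} u * \<eta>)" by (simp add: emeasure_lborel_Icc_eq)
  qed (use assms in \<open>auto simp: norm_mult tent_def indicator_def\<close>)
  also have "\<dots> = 2 * \<eta>\<^sup>2" using assms by (simp add: power2_eq_square)
  finally have T1: "norm T \<le> 2 * \<eta>\<^sup>2" .
  have T2: "x\<^sup>2 * norm T \<le> 1"
  proof (cases "x = 0")
    case False
    define c where "c = 2 * pi * x"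
    have c: "c \<noteq> 0" using False by (simp add: c_def)
    define p where "p u = indicator {0..\<eta>} u *\<^sub>R (complex_of_real (\<eta> + (-1) * u) * cis (c * u))" for u
    define m where "m u = indicator {-\<eta>..0} u *\<^sub>R (complex_of_real (\<eta> + 1 * u) * cis (c * u))" for u
    have int: "integrable lborel p" "integrable lborel m"
      unfolding p_def m_def by (intro borel_integrable_compact continuous_intros; simp)+
    have "T = (\<integral>u. p u + m u \<partial>lborel)"
      unfolding T_def c_def[symmetric]
    proof (rule integral_cong_AE)
      show "(\<lambda>u. complex_of_real (tent \<eta> u) * cis (c * u)) \<in> borel_measurable lborel"
        using integrable_tent_cis by (rule borel_measurable_integrable)
      show "(\<lambda>u. p u + m u) \<in> borel_measurable lborel"
        using int by (intro borel_measurable_add borel_measurable_integrable)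
      show "AE u in lborel. complex_of_real (tent \<eta> u) * cis (c * u) = p u + m u"
        using AE_lborel_singleton[of "0::real"]
        by eventually_elim (auto simp: tent_def p_def m_def indicator_def max_def)
    qed
    also have "\<dots> = (\<integral>u. p u \<partial>lborel) + (\<integral>u. m u \<partial>lborel)"
      using int by (rule Bochner_Integration.integral_add)
    also have "(\<integral>u. p u \<partial>lborel) = 1 / c\<^sup>2 - \<eta> / (\<i> * c) - cis (c * \<eta>) / c\<^sup>2"
      unfolding p_def using assms c by (subst integral_linear_cis) auto
    also have "(\<integral>u. m u \<partial>lborel) = 1 / c\<^sup>2 + \<eta> / (\<i> * c) - cis (- (c * \<eta>)) / c\<^sup>2"
      unfolding m_def using assms c by (subst integral_linear_cis) auto
    also have "1 / c\<^sup>2 - \<eta> / (\<i> * c) - cis (c * \<eta>) / c\<^sup>2 + (1 / c\<^sup>2 + \<eta> / (\<i> * c) - cis (- (c * \<eta>)) / c\<^sup>2) =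
        (2 - cis (c * \<eta>) - cis (- (c * \<eta>))) / c\<^sup>2"
      by (simp add: diff_divide_distrib)
    finally have "norm T \<le> 4 / c\<^sup>2"
      using norm_triangle_ineq4[of "2 - cis (c * \<eta>)" "cis (- (c * \<eta>))"] norm_triangle_ineq4[of 2 "cis (c * \<eta>)"]
      by (simp add: norm_divide norm_power divide_right_mono)
    then have "x\<^sup>2 * norm T \<le> x\<^sup>2 * (4 / c\<^sup>2)" by (rule mult_left_mono) simp
    also have "\<dots> = 1 / pi\<^sup>2" using False by (simp add: c_def power_mult_distrib)
    also have "\<dots> \<le> 1" using pi_ge_two by (simp add: divide_le_eq_1 one_le_power)
    finally show ?thesis .
  qed simp
  have "(1 + x\<^sup>2) * norm T \<le> 2 * \<eta>\<^sup>2 + 1" using T1 T2 by (simp add: algebra_simps)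
  then show ?thesis
    using one_plus_square_pos[of x] unfolding T_def by (simp add: field_simps)
qed

text \<open>
  The compactly supported kernel \<tau> that separates the atoms.
\<close>

definition tent_product :: "real \<Rightarrow> 'a::euclidean_space \<Rightarrow> real" where
  "tent_product \<eta> v = (\<Prod>i\<in>Basis. tent \<eta> (v \<bullet> i))"

lemma tent_product_nonneg [simp]: "0 \<le> tent_product \<eta> v"
  unfolding tent_product_def by (intro prod_nonneg) simp

lemma tent_product_le: "0 < \<eta> \<Longrightarrow> tent_product \<eta> (v::'a::euclidean_space) \<le> \<eta> ^ DIM('a)"
  unfolding tent_product_def
  using prod_mono[of Basis "\<lambda>i. tent \<eta> (v \<bullet> i)" "\<lambda>_. \<eta>"] by (simp add: tent_def)

lemma tent_product_0: "0 < \<eta> \<Longrightarrow> tent_product \<eta> (0::'a::euclidean_space) = \<eta> ^ DIM('a)"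
  unfolding tent_product_def by (simp add: tent_def)

lemma tent_product_support:
  assumes "tent_product \<eta> (v::'a::euclidean_space) \<noteq> 0"
  shows "norm v < real DIM('a) * \<eta>"
proof -
  have "norm v \<le> (\<Sum>i\<in>Basis. \<bar>v \<bullet> i\<bar>)" by (rule norm_le_l1)
  also have "\<dots> < (\<Sum>i\<in>(Basis::'a set). \<eta>)"
    using assms unfolding tent_product_def
    by (intro sum_strict_mono) (auto simp: tent_def max_def split: if_splits)
  finally show ?thesis by simp
qed

lemma continuous_on_tent_product: "continuous_on A (tent_product \<eta> :: 'a::euclidean_space \<Rightarrow> real)"
  unfolding tent_product_def by (intro continuous_intros)

lemma borel_measurable_tent_product [measurable]: "tent_product \<eta> \<in> borel_measurable borel"
  by (intro borel_measurable_continuous_onI continuous_on_tent_product)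

lemma tent_product_character:
  "complex_of_real (tent_product \<eta> v) * character x v =
     (\<Prod>i\<in>Basis. complex_of_real (tent \<eta> (v \<bullet> i)) * cis (2 * pi * (x \<bullet> i) * (v \<bullet> i)))"
proof -
  have "character x v = (\<Prod>i\<in>Basis. cis (2 * pi * (x \<bullet> i) * (v \<bullet> i)))"
    unfolding character_def cis_conv_exp
    by (simp add: exp_sum[symmetric] euclidean_inner[of v x] sum_distrib_left mult_ac)
  then show ?thesis by (simp add: tent_product_def prod.distrib)
qed

lemma integrable_tent_product_character:
  "integrable lborel (\<lambda>v. complex_of_real (tent_product \<eta> v) * character x v)"
  unfolding tent_product_character
  by (rule lborel_integral_prod(2)) (rule integrable_tent_cis)

lemma integrable_tent_product: "integrable lborel (tent_product \<eta> :: 'a::euclidean_space \<Rightarrow> real)"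
  using integrable_norm[OF integrable_tent_product_character[of \<eta> "0::'a"]] by simp

lemma tent_product_fourier_bound:
  assumes "0 < \<eta>"
  shows "norm (\<integral>v. complex_of_real (tent_product \<eta> v) * character x v \<partial>lborel) \<le>
    (2 * \<eta>\<^sup>2 + 1) ^ DIM('a) * weight (x::'a::euclidean_space)"
proof -
  have "norm (\<integral>v. complex_of_real (tent_product \<eta> v) * character x v \<partial>lborel) =
      (\<Prod>i\<in>Basis. norm (\<integral>u. complex_of_real (tent \<eta> u) * cis (2 * pi * (x \<bullet> i) * u) \<partial>lborel))"
    unfolding tent_product_character
    by (subst lborel_integral_prod(1)) (auto simp: integrable_tent_cis prod_norm)
  also have "\<dots> \<le> (\<Prod>i\<in>(Basis::'a set). (2 * \<eta>\<^sup>2 + 1) * inverse (1 + (x \<bullet> i)\<^sup>2))"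
    by (intro prod_mono conjI tent_fourier_bound assms) auto
  finally show ?thesis by (simp add: weight_def prod.distrib)
qed

lemma borel_measurable_gauss [measurable]:
  "gauss t \<in> borel_measurable borel" "gauss_hat t \<in> borel_measurable borel"
  unfolding gauss_def gauss_hat_def by measurable

lemma gauss_hat_nonneg: "0 < t \<Longrightarrow> 0 \<le> gauss_hat t y"
  by (simp add: gauss_hat_def)

text \<open>
  With z = \<pi> |y|^2 / t^2 one has e^(- z) \<le> k! / z^k, and for 2 k \<ge> DIM the resulting power of t is at most 1,
  so the bound is uniform in t.
\<close>

lemma gauss_hat_le_power:
  fixes y :: "'a::euclidean_space"
  assumes "0 < t" "t \<le> 1" "y \<noteq> 0" "DIM('a) \<le> 2 * k"
  shows "gauss_hat t y \<le> fact k / norm y ^ (2 * k)"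
proof -
  define z where "z = pi * (norm y)\<^sup>2 / t\<^sup>2"
  have z: "0 < z" using assms by (simp add: z_def)
  have "z ^ k * exp (- z) \<le> fact k"
    using power_le_fact_exp[of z k] z by (simp add: exp_minus field_simps)
  then have "exp (- z) \<le> fact k / z ^ k" using z by (simp add: field_simps)
  then have "gauss_hat t y \<le> fact k / z ^ k / t ^ DIM('a)"
    unfolding gauss_hat_def z_def[symmetric] using assms(1) by (intro divide_right_mono) auto
  also have "\<dots> = fact k / norm y ^ (2 * k) * ((1 / pi) ^ k * t ^ (2 * k - DIM('a)))"
    using assms by (simp add: z_def power_mult_distrib power_divide power_diff field_simps flip: power_mult)
  also have "\<dots> \<le> fact k / norm y ^ (2 * k) * 1"
    using assms pi_ge_two by (intro mult_left_mono mult_le_one power_le_one) auto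
  finally show ?thesis by simp
qed

lemma gauss_hat_decay:
  assumes "0 < t"
  obtains C where "0 \<le> C" "\<And>y::'a::euclidean_space. gauss_hat t y \<le> C / (1 + norm y) ^ n"
proof -
  define C where "C = fact n * exp (1 + 1 / (4 * (pi / t\<^sup>2))) / t ^ DIM('a)"
  have "gauss_hat t y \<le> C / (1 + norm y) ^ n" for y :: 'a
  proof -
    have "(1 + norm y) ^ n * exp (- (pi / t\<^sup>2 * (norm y)\<^sup>2)) \<le> fact n * exp (1 + 1 / (4 * (pi / t\<^sup>2)))"
      using assms by (intro power_mult_gauss_le) auto
    then have "(1 + norm y) ^ n * gauss_hat t y \<le> C"
      using assms by (simp add: gauss_hat_def C_def divide_right_mono)
    moreover have "0 < (1 + norm y) ^ n" by (simp add: add_pos_nonneg)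
    ultimately show ?thesis by (simp add: pos_le_divide_eq mult.commute)
  qed
  moreover have "0 \<le> C" using assms by (simp add: C_def)
  ultimately show thesis by (rule that[rotated])
qed

lemma gauss_hat_scale: "0 < t \<Longrightarrow> gauss_hat t (t *\<^sub>R z :: 'a::euclidean_space) = gauss 1 z / t ^ DIM('a)"
  by (simp add: gauss_hat_def gauss_def power_mult_distrib)

lemma integral_gauss: "integrable lborel (gauss 1 :: 'a::euclidean_space \<Rightarrow> real)"
  "(\<integral>x. gauss 1 (x::'a) \<partial>lborel) = 1"
proof -
  have "integrable lborel (\<lambda>x::'a. complex_of_real (gauss 1 x) * character 0 x)"
    by (intro schwartz_integrable schwartz_gauss) simp
  then have "integrable lborel (\<lambda>x::'a. complex_of_real (gauss 1 x))" by simp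
  then show int: "integrable lborel (gauss 1 :: 'a \<Rightarrow> real)"
    using complex_of_real_integrable_eq by blast
  have "(\<integral>x. complex_of_real (gauss 1 (x::'a)) \<partial>lborel) = gauss_hat 1 (0::'a)"
    using integral_gauss_character[of 1 "0::'a"] by simp
  then show "(\<integral>x. gauss 1 (x::'a) \<partial>lborel) = 1"
    by (simp add: gauss_hat_def integral_complex_of_real)
qed

lemma lborel_integral_affine:
  fixes f :: "'a::euclidean_space \<Rightarrow> real"
  assumes [measurable]: "f \<in> borel_measurable borel" and "0 < t"
  shows "(\<integral>x. f x \<partial>lborel) = t ^ DIM('a) * (\<integral>x. f (c + t *\<^sub>R x) \<partial>lborel)"
proof -
  have "(\<integral>x. f x \<partial>lborel) = (\<integral>x. f x \<partial>density (distr lborel borel (\<lambda>x. c + t *\<^sub>R x)) (\<lambda>_. ennreal (\<bar>t\<bar> ^ DIM('a))))"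
    using lborel_affine[of t c] assms(2) by simp
  also have "\<dots> = (\<integral>x. \<bar>t\<bar> ^ DIM('a) *\<^sub>R f x \<partial>distr lborel borel (\<lambda>x. c + t *\<^sub>R x))"
    by (rule integral_density) auto
  also have "\<dots> = (\<integral>x. \<bar>t\<bar> ^ DIM('a) *\<^sub>R f (c + t *\<^sub>R x) \<partial>lborel)"
    by (rule integral_distr) auto
  finally show ?thesis using assms(2) by simp
qed

text \<open>
  Rescaling v = - y + t z moves the parameter from the Gaussian into f; dominated convergence does the
  rest.
\<close>

lemma gauss_hat_approximate_identity:
  fixes f :: "'a::euclidean_space \<Rightarrow> real"
  assumes f: "continuous_on UNIV f" "\<And>v. \<bar>f v\<bar> \<le> M"
    and t: "\<And>k. 0 < t k" "t \<longlonglongrightarrow> 0"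
  shows "(\<lambda>k. \<integral>v. f v * gauss_hat (t k) (y + v) \<partial>lborel) \<longlonglongrightarrow> f (- y)"
proof -
  have [measurable]: "f \<in> borel_measurable borel"
    using f(1) by (rule borel_measurable_continuous_onI)
  have eq: "(\<integral>v. f v * gauss_hat (t k) (y + v) \<partial>lborel) = (\<integral>z. f (- y + t k *\<^sub>R z) * gauss 1 z \<partial>lborel)" for k
  proof -
    have "(\<integral>v. f v * gauss_hat (t k) (y + v) \<partial>lborel) =
        t k ^ DIM('a) * (\<integral>z. f (- y + t k *\<^sub>R z) * gauss_hat (t k) (y + (- y + t k *\<^sub>R z)) \<partial>lborel)"
      by (rule lborel_integral_affine) (use t in auto)
    also have "\<dots> = (\<integral>z. t k ^ DIM('a) * (f (- y + t k *\<^sub>R z) * (gauss 1 z / t k ^ DIM('a))) \<partial>lborel)"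
      by (simp add: gauss_hat_scale[OF t(1)])
    also have "\<dots> = (\<integral>z. f (- y + t k *\<^sub>R z) * gauss 1 z \<partial>lborel)"
      using t(1)[of k] by simp
    finally show ?thesis .
  qed
  have "(\<lambda>k. \<integral>z. f (- y + t k *\<^sub>R z) * gauss 1 z \<partial>lborel) \<longlonglongrightarrow> (\<integral>z. f (- y) * gauss 1 (z::'a) \<partial>lborel)"
  proof (rule integral_dominated_convergence[where w = "\<lambda>z::'a. M * gauss 1 z"])
    show "integrable lborel (\<lambda>z::'a. M * gauss 1 z)" by (simp add: integral_gauss)
    have "(\<lambda>k. f (- y + t k *\<^sub>R z)) \<longlonglongrightarrow> f (- y + 0 *\<^sub>R z)" for z
    proof (rule continuous_on_tendsto_compose[OF f(1)])
      show "(\<lambda>k. - y + t k *\<^sub>R z) \<longlonglongrightarrow> - y + 0 *\<^sub>R z" by (intro tendsto_intros t)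
    qed auto
    then show "AE z in lborel. (\<lambda>k. f (- y + t k *\<^sub>R z) * gauss 1 z) \<longlonglongrightarrow> f (- y) * gauss 1 z"
      by (intro AE_I2 tendsto_intros) simp
    show "AE z in lborel. norm (f (- y + t k *\<^sub>R z) * gauss 1 z) \<le> M * gauss 1 z" for k
      using f(2) by (intro AE_I2) (auto simp: abs_mult gauss_def intro!: mult_right_mono)
  qed auto
  then show ?thesis unfolding eq by (simp add: integral_gauss)
qed

section \<open>Recovering the masses from a trigonometric series\<close>

text \<open>
  Sum and average are exchanged by dominated convergence.  A bound on the support of the kernel is
  what Gaussians around distant atoms satisfy with summable constants.
\<close>

lemma tent_product_average_suminf:
  fixes u :: "nat \<Rightarrow> 'a::euclidean_space \<Rightarrow> complex"
  assumes [measurable]: "\<And>n. u n \<in> borel_measurable borel"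
    and bound: "\<And>n v. tent_product \<eta> v \<noteq> 0 \<Longrightarrow> norm (u n v) \<le> B n"
    and B: "summable B"
  shows "(\<integral>v. tent_product \<eta> v * (\<Sum>n. u n v) \<partial>lborel) = (\<Sum>n. \<integral>v. tent_product \<eta> v * u n v \<partial>lborel)"
proof -
  have le: "norm (complex_of_real (tent_product \<eta> v) * u n v) \<le> tent_product \<eta> v * B n" for n v
    using bound[of v n] by (cases "tent_product \<eta> v = 0") (auto simp: norm_mult intro: mult_left_mono)
  have int: "integrable lborel (\<lambda>v. complex_of_real (tent_product \<eta> v) * u n v)" for n
  proof (rule Bochner_Integration.integrable_bound)
    show "integrable lborel (\<lambda>v::'a. tent_product \<eta> v * B n)"
      by (intro integrable_mult_left integrable_tent_product)
    show "AE v in lborel. norm (complex_of_real (tent_product \<eta> v) * u n v) \<le> norm (tent_product \<eta> v * B n)"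
      using le by (intro AE_I2) (metis abs_ge_self order_trans real_norm_def)
  qed measurable
  have "(\<integral>v. (\<Sum>n. complex_of_real (tent_product \<eta> v) * u n v) \<partial>lborel) =
      (\<Sum>n. \<integral>v. complex_of_real (tent_product \<eta> v) * u n v \<partial>lborel)"
  proof (rule integral_suminf)
    show "AE v in lborel. summable (\<lambda>n. norm (complex_of_real (tent_product \<eta> v) * u n v))"
    proof (intro AE_I2)
      fix v :: 'a
      show "summable (\<lambda>n. norm (complex_of_real (tent_product \<eta> v) * u n v))"
        by (rule summable_comparison_test'[OF summable_mult[OF B, of "tent_product \<eta> v"], of 0]) (use le in simp)
    qed
    have "norm (\<integral>v. norm (complex_of_real (tent_product \<eta> v) * u n v) \<partial>lborel) \<le>
        (\<integral>v. tent_product \<eta> (v::'a) \<partial>lborel) * B n" for n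
    proof -
      have "(\<integral>v. norm (complex_of_real (tent_product \<eta> v) * u n v) \<partial>lborel) \<le> (\<integral>v. tent_product \<eta> (v::'a) * B n \<partial>lborel)"
        by (intro integral_mono integrable_norm int integrable_mult_left integrable_tent_product le)
      then show ?thesis by simp
    qed
    then show "summable (\<lambda>n. \<integral>v. norm (complex_of_real (tent_product \<eta> v) * u n v) \<partial>lborel)"
      by (intro summable_comparison_test'[OF summable_mult[OF B], of 0]) auto
  qed (rule int)
  moreover have "complex_of_real (tent_product \<eta> v) * (\<Sum>n. u n v) = (\<Sum>n. complex_of_real (tent_product \<eta> v) * u n v)" for v
  proof (cases "tent_product \<eta> v = 0")
    case False
    have "summable (\<lambda>n. u n v)"
      by (rule summable_comparison_test'[OF B, of 0]) (use bound[OF False] in simp)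
    then show ?thesis by (rule suminf_mult[symmetric])
  qed simp
  ultimately show ?thesis by simp
qed

lemma suminf_dominated_limit:
  fixes a :: "nat \<Rightarrow> nat \<Rightarrow> complex"
  assumes "\<And>n. (\<lambda>k. a n k) \<longlonglongrightarrow> b n" "\<And>n k. norm (a n k) \<le> M n" "summable M"
  shows "(\<lambda>k. \<Sum>n. a n k) \<longlonglongrightarrow> (\<Sum>n. b n)"
  by (rule tannerys_theorem[THEN conjunct2, THEN conjunct2, OF assms(1) _ assms(3)])
    (use assms(2) in \<open>auto intro!: always_eventually\<close>)

text \<open>
  Here lam, c and gam, d list the atoms and masses of a measure and of its Fourier transform.  The
  Poisson type identity is applied to modulated Gaussians, which are Schwartz functions with explicit
  transforms, and averaged over the modulation with the kernel \<tau>.  On the right this multiplies the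
  masses by the decaying factor \<psi>(gam n), on the left it replaces the narrow Gaussian by its average over
  \<tau>.  As t \<rightarrow> 0 the left side picks out the single atom lam m, since \<tau> vanishes at the other differences
  of atoms, and the right side becomes an absolutely convergent trigonometric series at lam m.
\<close>

lemma atoms_interpolation:
  fixes c d :: "nat \<Rightarrow> complex" and lam gam :: "nat \<Rightarrow> 'a::euclidean_space"
  assumes c: "summable (\<lambda>n. norm (c n) / (1 + norm (lam n)) ^ N)"
    and d: "summable (\<lambda>n. norm (d n) * weight (gam n))"
    and sep: "0 < \<epsilon>" "\<And>m n. c m \<noteq> 0 \<Longrightarrow> c n \<noteq> 0 \<Longrightarrow> m \<noteq> n \<Longrightarrow> \<epsilon> \<le> norm (lam m - lam n)"
    and poisson: "\<And>\<phi>. schwartz \<phi> \<Longrightarrow> (\<Sum>n. c n * fourier \<phi> (lam n)) = (\<Sum>n. d n * \<phi> (gam n))"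
  shows "\<exists>F r. wiener_le F r \<and> (\<forall>n. c n \<noteq> 0 \<longrightarrow> F (lam n) = c n)"
proof -
  \<comment> \<open>chosen so that the support of \<tau> lies in the ball of radius \<epsilon> / 2\<close>
  define \<eta> where "\<eta> = \<epsilon> / (2 * real DIM('a))"
  have \<eta>: "0 < \<eta>" using sep(1) by (simp add: \<eta>_def)
  define \<tau> :: "'a \<Rightarrow> real" where "\<tau> = tent_product \<eta>"
  have \<tau>_support: "norm v < \<epsilon> / 2" if "\<tau> v \<noteq> 0" for v
    using tent_product_support[of \<eta> v] that by (simp add: \<tau>_def \<eta>_def)
  have \<tau>_nonneg: "0 \<le> \<tau> v" for v by (simp add: \<tau>_def)
  have \<tau>_integrable: "integrable lborel \<tau>" unfolding \<tau>_def by (rule integrable_tent_product)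
  have [measurable]: "\<tau> \<in> borel_measurable borel" unfolding \<tau>_def by measurable
  define \<psi> where "\<psi> x = (\<integral>v. complex_of_real (\<tau> v) * character x v \<partial>lborel)" for x
  define K where "K = (2 * \<eta>\<^sup>2 + 1) ^ DIM('a)"
  have \<psi>: "norm (\<psi> x) \<le> K * weight x" for x
    unfolding \<psi>_def \<tau>_def K_def by (rule tent_product_fourier_bound[OF \<eta>])
  define A where "A m n t = (\<integral>v. \<tau> v * gauss_hat t (lam m - lam n + v) \<partial>lborel)" for m n t

  have average: "(\<Sum>n. c n * A m n t) = (\<Sum>n. d n * \<psi> (gam n) * character (gam n) (lam m) * gauss t (gam n))"
    if t: "0 < t" for m t
  proof -
    obtain C where C: "0 \<le> C" "\<And>y::'a. gauss_hat t y \<le> C / (1 + norm y) ^ N"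
      using gauss_hat_decay[OF t] by blast
    define R where "R = 1 + norm (lam m) + \<epsilon>"
    have R: "1 \<le> R" using sep(1) by (simp add: R_def)
    have hat_le: "gauss_hat t (lam m - lam n + v) \<le> C * R ^ N / (1 + norm (lam n)) ^ N" if "\<tau> v \<noteq> 0" for n v
    proof -
      define y where "y = lam m - lam n + v"
      have "norm (lam n) \<le> norm (lam m) + norm v + norm y"
        using norm_triangle_ineq4[of "lam m + v" y] norm_triangle_ineq[of "lam m" v] by (simp add: y_def algebra_simps)
      moreover have "norm v \<le> \<epsilon>" using \<tau>_support[OF that] sep(1) by simp
      moreover have "0 \<le> (norm (lam m) + \<epsilon>) * norm y" using sep(1) by simp
      ultimately have "1 + norm (lam n) \<le> R * (1 + norm y)"
        unfolding R_def ring_distribs by linarith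
      then have "(1 + norm (lam n)) ^ N \<le> R ^ N * (1 + norm y) ^ N"
        by (subst power_mult_distrib[symmetric], intro power_mono) auto
      then have "C / (1 + norm y) ^ N \<le> C * R ^ N / (1 + norm (lam n)) ^ N"
        using C(1) by (simp add: divide_simps add_pos_nonneg mult_left_mono mult.assoc)
      then show ?thesis using C(2)[of y] by (simp add: y_def)
    qed
    have "(\<integral>v. \<tau> v * (\<Sum>n. c n * gauss_hat t (lam m - lam n + v)) \<partial>lborel) =
        (\<Sum>n. \<integral>v. \<tau> v * (c n * gauss_hat t (lam m - lam n + v)) \<partial>lborel)"
      unfolding \<tau>_def
    proof (rule tent_product_average_suminf)
      show "summable (\<lambda>n. norm (c n) / (1 + norm (lam n)) ^ N * (C * R ^ N))"
        by (rule summable_mult2[OF c])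
      show "norm (c n * complex_of_real (gauss_hat t (lam m - lam n + v))) \<le> norm (c n) / (1 + norm (lam n)) ^ N * (C * R ^ N)"
        if "tent_product \<eta> v \<noteq> 0" for n v
        using mult_left_mono[OF hat_le[of v n], of "norm (c n)"] that gauss_hat_nonneg[OF t, of "lam m - lam n + v"]
        by (simp add: norm_mult \<tau>_def)
    qed measurable
    also have "\<dots> = (\<Sum>n. c n * A m n t)"
    proof (rule suminf_cong)
      fix n
      have "(\<integral>v. complex_of_real (\<tau> v) * (c n * gauss_hat t (lam m - lam n + v)) \<partial>lborel) =
          (\<integral>v. c n * complex_of_real (\<tau> v * gauss_hat t (lam m - lam n + v)) \<partial>lborel)"
        by (intro Bochner_Integration.integral_cong) (auto simp: mult_ac)
      also have "\<dots> = c n * A m n t"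
        unfolding A_def by (subst integral_mult_right_zero, subst integral_complex_of_real) simp
      finally show "(\<integral>v. complex_of_real (\<tau> v) * (c n * gauss_hat t (lam m - lam n + v)) \<partial>lborel) = c n * A m n t" .
    qed
    finally have lhs: "(\<integral>v. \<tau> v * (\<Sum>n. c n * gauss_hat t (lam m - lam n + v)) \<partial>lborel) = (\<Sum>n. c n * A m n t)" .

    obtain C' where C': "0 \<le> C'" "\<And>x::'a. norm (complex_of_real (gauss t x) * character 0 x) \<le> C' * weight x"
      using schwartz_le_weight[OF schwartz_gauss[OF t]] by blast
    have "(\<integral>v. \<tau> v * (\<Sum>n. d n * (gauss t (gam n) * character (lam m + v) (gam n))) \<partial>lborel) =
        (\<Sum>n. \<integral>v. \<tau> v * (d n * (gauss t (gam n) * character (lam m + v) (gam n))) \<partial>lborel)"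
      unfolding \<tau>_def
    proof (rule tent_product_average_suminf)
      show "summable (\<lambda>n. C' * (norm (d n) * weight (gam n)))"
        by (rule summable_mult[OF d])
      show "(\<lambda>v. d n * (complex_of_real (gauss t (gam n)) * character (lam m + v) (gam n))) \<in> borel_measurable borel" for n
        unfolding character_commute[of _ "gam n"] by measurable
      show "norm (d n * (complex_of_real (gauss t (gam n)) * character (lam m + v) (gam n))) \<le> C' * (norm (d n) * weight (gam n))" for n v
        using mult_left_mono[OF C'(2)[of "gam n"], of "norm (d n)"] by (simp add: norm_mult mult_ac)
    qed
    also have "\<dots> = (\<Sum>n. d n * \<psi> (gam n) * character (gam n) (lam m) * gauss t (gam n))"
    proof (rule suminf_cong)
      fix n
      have "(\<integral>v. complex_of_real (\<tau> v) * (d n * (gauss t (gam n) * character (lam m + v) (gam n))) \<partial>lborel) =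
          (\<integral>v. (d n * character (gam n) (lam m) * gauss t (gam n)) * (complex_of_real (\<tau> v) * character (gam n) v) \<partial>lborel)"
        by (intro Bochner_Integration.integral_cong)
          (auto simp: character_commute[of "lam m + _"] character_add_point mult_ac)
      also have "\<dots> = d n * \<psi> (gam n) * character (gam n) (lam m) * gauss t (gam n)"
        unfolding \<psi>_def by (subst integral_mult_right_zero) (simp add: mult_ac)
      finally show "(\<integral>v. complex_of_real (\<tau> v) * (d n * (gauss t (gam n) * character (lam m + v) (gam n))) \<partial>lborel) =
        d n * \<psi> (gam n) * character (gam n) (lam m) * gauss t (gam n)" .
    qed
    finally have rhs: "(\<integral>v. \<tau> v * (\<Sum>n. d n * (gauss t (gam n) * character (lam m + v) (gam n))) \<partial>lborel) =
      (\<Sum>n. d n * \<psi> (gam n) * character (gam n) (lam m) * gauss t (gam n))" .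
    have "(\<Sum>n. c n * gauss_hat t (lam m - lam n + v)) = (\<Sum>n. d n * (gauss t (gam n) * character (lam m + v) (gam n)))" for v
      using poisson[OF schwartz_gauss[OF t, of "lam m + v"]] unfolding fourier_gauss[OF t]
      by (simp add: algebra_simps)
    then show ?thesis using lhs rhs by simp
  qed

  define t where "t k = inverse (real (Suc k))" for k
  have t: "0 < t k" "t k \<le> 1" for k by (auto simp: t_def inverse_le_1_iff)
  have t_lim: "t \<longlonglongrightarrow> 0" unfolding t_def by (rule LIMSEQ_inverse_real_of_nat)
  define S where "S x = (\<Sum>n. d n * \<psi> (gam n) * character (gam n) x)" for x
  have d\<psi>: "norm (d n * \<psi> (gam n)) \<le> K * (norm (d n) * weight (gam n))" for n
    using mult_left_mono[OF \<psi>[of "gam n"], of "norm (d n)"] by (simp add: norm_mult mult_ac)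

  have at_atom: "S (lam m) = c m * \<eta> ^ DIM('a)" if m: "c m \<noteq> 0" for m
  proof -
    have A_lim: "(\<lambda>k. A m n (t k)) \<longlonglongrightarrow> \<tau> (- (lam m - lam n))" for n
      unfolding A_def
      by (rule gauss_hat_approximate_identity[where M = "\<eta> ^ DIM('a)"])
        (use t t_lim tent_product_le[OF \<eta>] in \<open>auto simp: \<tau>_def continuous_on_tent_product\<close>)
    have A_nonneg: "0 \<le> A m n (t k)" for n k
      unfolding A_def by (intro integral_nonneg_AE AE_I2 mult_nonneg_nonneg \<tau>_nonneg gauss_hat_nonneg t)
    obtain B where B: "0 < B" "\<And>k. norm (A m m (t k)) \<le> B"
      using convergent_imp_Bseq[OF convergentI[OF A_lim[of m]]] unfolding Bseq_def by blast
    \<comment> \<open>large enough for both the growth of c and the uniform bound on Gaussians\<close>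
    define q where "q = N + DIM('a)"
    \<comment> \<open>comparison constant: 1 + |lam n| \<le> \<kappa> |lam m - lam n| for all other atoms lam n\<close>
    define \<kappa> where "\<kappa> = (1 + norm (lam m)) / \<epsilon> + 1"
    have \<kappa>: "1 \<le> \<kappa>" using sep(1) by (simp add: \<kappa>_def)
    define L where "L = (\<integral>v. \<tau> v \<partial>lborel) * (fact q * 2 ^ (2 * q) * \<kappa> ^ (2 * q))"
    have A_le: "A m n (t k) \<le> L / (1 + norm (lam n)) ^ N" if n: "n \<noteq> m" "c n \<noteq> 0" for n k
    proof -
      define \<delta> where "\<delta> = norm (lam m - lam n)"
      have "\<epsilon> \<le> \<delta>" unfolding \<delta>_def by (rule sep(2)) (use m n in auto)
      then have \<delta>: "\<epsilon> \<le> \<delta>" "0 < \<delta>" using sep(1) by auto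
      have "norm (lam n) \<le> norm (lam m) + \<delta>"
        unfolding \<delta>_def using norm_triangle_ineq4[of "lam m" "lam m - lam n"] by simp
      moreover have "(1 + norm (lam m)) * 1 \<le> (1 + norm (lam m)) * (\<delta> / \<epsilon>)"
        using \<delta> sep(1) by (intro mult_left_mono) auto
      ultimately have "1 + norm (lam n) \<le> \<kappa> * \<delta>"
        by (simp add: \<kappa>_def distrib_right)
      then have "(1 + norm (lam n)) ^ (2 * q) \<le> \<kappa> ^ (2 * q) * \<delta> ^ (2 * q)"
        by (subst power_mult_distrib[symmetric], intro power_mono) auto
      moreover have "(1 + norm (lam n)) ^ N \<le> (1 + norm (lam n)) ^ (2 * q)"
        by (intro power_increasing) (auto simp: q_def)
      ultimately have pow: "(1 + norm (lam n)) ^ N \<le> \<kappa> ^ (2 * q) * \<delta> ^ (2 * q)" by linarith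
      define G where "G = fact q * 2 ^ (2 * q) * \<kappa> ^ (2 * q) / (1 + norm (lam n)) ^ N"
      have G_nonneg: "0 \<le> G" unfolding G_def using \<kappa> by simp
      have G: "\<tau> v * gauss_hat (t k) (lam m - lam n + v) \<le> \<tau> v * G" for v
      proof (cases "\<tau> v = 0")
        case False
        define y where "y = lam m - lam n + v"
        have "norm (lam m - lam n) \<le> norm y + norm v"
          using norm_triangle_ineq4[of y v] by (simp add: y_def)
        then have y: "\<delta> / 2 \<le> norm y" using \<tau>_support[OF False] \<delta> by (simp add: \<delta>_def)
        then have "y \<noteq> 0" using \<delta> by auto
        have "gauss_hat (t k) y \<le> fact q / norm y ^ (2 * q)"
          by (rule gauss_hat_le_power) (use t \<open>y \<noteq> 0\<close> in \<open>auto simp: q_def\<close>)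
        also have "\<dots> \<le> fact q / (\<delta> / 2) ^ (2 * q)"
          using y \<delta> by (intro divide_left_mono power_mono mult_pos_pos zero_less_power) auto
        also have "\<dots> = fact q * 2 ^ (2 * q) / \<delta> ^ (2 * q)"
          by (simp add: power_divide)
        also have "\<dots> \<le> G"
          unfolding G_def using pow \<delta> mult_left_mono[OF pow, of "fact q * 2 ^ (2 * q)"]
          by (simp add: divide_simps add_pos_nonneg mult_ac)
        finally show ?thesis using \<tau>_nonneg by (intro mult_left_mono) (auto simp: y_def)
      qed simp
      have "A m n (t k) \<le> (\<integral>v. \<tau> v * G \<partial>lborel)"
        unfolding A_def
      proof (rule integral_mono)
        show "integrable lborel (\<lambda>v. \<tau> v * G)" using \<tau>_integrable by simp
        then show "integrable lborel (\<lambda>v. \<tau> v * gauss_hat (t k) (lam m - lam n + v))"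
          by (rule Bochner_Integration.integrable_bound)
            (use G in \<open>auto simp: abs_mult \<tau>_nonneg gauss_hat_nonneg[OF t(1)] G_nonneg\<close>)
      qed (rule G)
      also have "\<dots> = L / (1 + norm (lam n)) ^ N" by (simp add: L_def G_def)
      finally show ?thesis .
    qed
    define M where "M n = norm (c n) / (1 + norm (lam n)) ^ N * L + (if n = m then norm (c m) * B else 0)" for n
    have L: "0 \<le> L" unfolding L_def using \<tau>_nonneg \<kappa> by (intro mult_nonneg_nonneg integral_nonneg_AE) auto
    have "summable M"
      unfolding M_def by (intro summable_add summable_mult2 c sums_summable[OF sums_single])
    moreover have "norm (c n * A m n (t k)) \<le> M n" for n k
    proof (cases "n = m \<or> c n = 0")
      case True
      then show ?thesis
      proof
        assume "n = m"
        moreover have "norm (c m) * norm (A m m (t k)) \<le> norm (c m) * B"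
          by (intro mult_left_mono B) simp
        moreover have "0 \<le> norm (c m) / (1 + norm (lam m)) ^ N * L" using L by simp
        ultimately show ?thesis by (simp add: M_def norm_mult)
      qed (use B L in \<open>auto simp: M_def\<close>)
    next
      case False
      then have "norm (c n) * A m n (t k) \<le> norm (c n) * (L / (1 + norm (lam n)) ^ N)"
        by (intro mult_left_mono A_le) auto
      then show ?thesis using False A_nonneg by (simp add: M_def norm_mult)
    qed
    moreover have "(\<lambda>k. c n * A m n (t k)) \<longlonglongrightarrow> (if n = m then c m * \<eta> ^ DIM('a) else 0)" for n
    proof -
      have "(\<lambda>k. c n * A m n (t k)) \<longlonglongrightarrow> c n * complex_of_real (\<tau> (- (lam m - lam n)))"
        by (intro tendsto_intros A_lim)
      moreover have "c n * complex_of_real (\<tau> (- (lam m - lam n))) = (if n = m then c m * \<eta> ^ DIM('a) else 0)"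
      proof (cases "n = m \<or> c n = 0")
        case False
        then have "\<epsilon> \<le> norm (- (lam m - lam n))" using sep(2) m by (simp add: norm_minus_commute)
        then have "\<tau> (- (lam m - lam n)) = 0"
          using \<tau>_support[of "- (lam m - lam n)"] sep(1) by fastforce
        then show ?thesis using False by simp
      qed (use m in \<open>auto simp: \<tau>_def tent_product_0[OF \<eta>]\<close>)
      ultimately show ?thesis by simp
    qed
    ultimately have "(\<lambda>k. \<Sum>n. c n * A m n (t k)) \<longlonglongrightarrow> (\<Sum>n. if n = m then c m * \<eta> ^ DIM('a) else 0)"
      by (intro suminf_dominated_limit[where M = M]) auto
    moreover have "(\<Sum>n. if n = m then c m * \<eta> ^ DIM('a) else 0) = c m * \<eta> ^ DIM('a)"
      using sums_single[of m "\<lambda>n. c m * \<eta> ^ DIM('a)"] by (simp add: sums_iff eq_commute)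
    ultimately have lim1: "(\<lambda>k. \<Sum>n. c n * A m n (t k)) \<longlonglongrightarrow> c m * \<eta> ^ DIM('a)" by simp

    have "(\<lambda>k. \<Sum>n. d n * \<psi> (gam n) * character (gam n) (lam m) * gauss (t k) (gam n)) \<longlonglongrightarrow> S (lam m)"
      unfolding S_def
    proof (rule suminf_dominated_limit)
      show "summable (\<lambda>n. K * (norm (d n) * weight (gam n)))" by (rule summable_mult[OF d])
      show "norm (d n * \<psi> (gam n) * character (gam n) (lam m) * gauss (t k) (gam n)) \<le> K * (norm (d n) * weight (gam n))" for n k
      proof -
        have "norm (d n * \<psi> (gam n) * character (gam n) (lam m) * gauss (t k) (gam n)) =
            norm (d n * \<psi> (gam n)) * gauss (t k) (gam n)"
          by (simp add: norm_mult gauss_def)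
        also have "\<dots> \<le> norm (d n * \<psi> (gam n)) * 1"
          by (intro mult_left_mono) (auto simp: gauss_def)
        finally show ?thesis using d\<psi>[of n] by simp
      qed
      show "(\<lambda>k. d n * \<psi> (gam n) * character (gam n) (lam m) * gauss (t k) (gam n)) \<longlonglongrightarrow>
          d n * \<psi> (gam n) * character (gam n) (lam m)" for n
      proof -
        have "(\<lambda>k. gauss (t k) (gam n)) \<longlonglongrightarrow> exp (- (pi * 0\<^sup>2 * (norm (gam n))\<^sup>2))"
          unfolding gauss_def by (intro tendsto_intros t_lim)
        then have "(\<lambda>k. d n * \<psi> (gam n) * character (gam n) (lam m) * gauss (t k) (gam n)) \<longlonglongrightarrow>
          d n * \<psi> (gam n) * character (gam n) (lam m) * complex_of_real (exp (- (pi * 0\<^sup>2 * (norm (gam n))\<^sup>2)))"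
          by (intro tendsto_intros)
        then show ?thesis by simp
      qed
    qed
    then have "(\<lambda>k. \<Sum>n. c n * A m n (t k)) \<longlonglongrightarrow> S (lam m)"
      using average[OF t(1)] by simp
    then show ?thesis using lim1 by (rule LIMSEQ_unique)
  qed

  have "summable (\<lambda>n. norm (d n * \<psi> (gam n)))"
    by (rule summable_comparison_test'[OF summable_mult[OF d, of K], of 0]) (use d\<psi> in simp)
  then have "wiener_le S (\<Sum>n. norm (d n * \<psi> (gam n)) * 1)"
    unfolding S_def by (intro wiener_le.series wiener_le.scale wiener_le.character) simp
  then have "wiener_le (\<lambda>x. inverse (\<eta> ^ DIM('a)) * S x) (norm (complex_of_real (inverse (\<eta> ^ DIM('a)))) * (\<Sum>n. norm (d n * \<psi> (gam n)) * 1))"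
    by (rule wiener_le.scale)
  moreover have "inverse (\<eta> ^ DIM('a)) * S (lam n) = c n" if "c n \<noteq> 0" for n
    using at_atom[OF that] \<eta> by (simp add: field_simps)
  ultimately show ?thesis by blast
qed

section \<open>Multiplying a measure by an element of the Wiener algebra\<close>

lemma distr_of_eq_integral:
  assumes "integrable (count_space UNIV) (\<lambda>x. a x * \<phi> x)"
  shows "distr_of a \<phi> = (\<integral>x. a x * \<phi> x \<partial>count_space UNIV)"
proof -
  have "Infinite_Set_Sum.abs_summable_on (\<lambda>x. a x * \<phi> x) (atoms a)"
    using assms by (auto simp: abs_summable_on_def intro: abs_summable_on_subset[unfolded abs_summable_on_def])
  then have "distr_of a \<phi> = infsetsum (\<lambda>x. a x * \<phi> x) (atoms a)"
    unfolding distr_of_def by (rule infsetsum_infsum[symmetric])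
  also have "\<dots> = infsetsum (\<lambda>x. a x * \<phi> x) UNIV"
    by (rule infsetsum_cong_neutral) (auto simp: atoms_def)
  finally show ?thesis by (simp add: infsetsum_def)
qed

lemma variation_mult_le:
  assumes "\<And>x. norm (g x) \<le> R" "0 \<le> R"
  shows "emeasure (variation (\<lambda>x. a x * g x)) A \<le> ennreal R * emeasure (variation a) A"
proof -
  have "norm (a x * g x) \<le> R * norm (a x)" for x
    using assms(1) by (simp add: norm_mult mult.commute[of R] mult_left_mono)
  then have "emeasure (variation (\<lambda>x. a x * g x)) A \<le> (\<integral>\<^sup>+x. ennreal R * (ennreal (norm (a x)) * indicator A x) \<partial>count_space UNIV)"
    unfolding emeasure_variation
    using assms by (intro nn_integral_mono)
      (auto simp: indicator_def ennreal_mult[symmetric] intro!: ennreal_leI)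
  also have "\<dots> = ennreal R * emeasure (variation a) A"
    unfolding emeasure_variation by (rule nn_integral_cmult) simp
  finally show ?thesis .
qed

lemma unit_mass_le_integrable:
  "\<exists>K\<ge>0. \<forall>(b :: 'a::euclidean_space mass) B (\<phi> :: 'a \<Rightarrow> complex) C.
    unit_mass_le b B \<longrightarrow> 0 \<le> C \<longrightarrow> (\<forall>x. norm (\<phi> x) \<le> C * weight x) \<longrightarrow>
    integrable (count_space UNIV) (\<lambda>x. b x * \<phi> x) \<and>
    (\<integral>x. norm (b x * \<phi> x) \<partial>count_space UNIV) \<le> C * (K * B)"
proof -
  obtain K where K: "0 \<le> K" "\<And>(b :: 'a mass) B \<omega>. unit_mass_le b B \<Longrightarrow>
      (\<integral>\<^sup>+x. ennreal (norm (b x) * weight (x + \<omega>)) \<partial>count_space UNIV) \<le> ennreal (K * B)"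
    using unit_mass_le_weight_sum[where 'a = 'a] by blast
  have "integrable (count_space UNIV) (\<lambda>x. b x * \<phi> x) \<and>
      (\<integral>x. norm (b x * \<phi> x) \<partial>count_space UNIV) \<le> C * (K * B)"
    if b: "unit_mass_le b B"
      and \<phi>: "0 \<le> C" "\<And>x. norm (\<phi> x) \<le> C * weight x"
    for b :: "'a mass" and B C and \<phi> :: "'a \<Rightarrow> complex"
  proof -
    have "(\<integral>\<^sup>+x. ennreal (norm (b x * \<phi> x)) \<partial>count_space UNIV) \<le>
        (\<integral>\<^sup>+x. ennreal C * ennreal (norm (b x) * weight (x + 0)) \<partial>count_space UNIV)"
    proof (rule nn_integral_mono)
      fix x
      have "norm (b x * \<phi> x) \<le> C * (norm (b x) * weight x)"
        using mult_left_mono[OF \<phi>(2)[of x], of "norm (b x)"] by (simp add: norm_mult mult_ac)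
      then show "ennreal (norm (b x * \<phi> x)) \<le> ennreal C * ennreal (norm (b x) * weight (x + 0))"
        using \<phi>(1) by (simp add: ennreal_mult[symmetric] ennreal_leI)
    qed
    also have "\<dots> = ennreal C * (\<integral>\<^sup>+x. ennreal (norm (b x) * weight (x + 0)) \<partial>count_space UNIV)"
      by (rule nn_integral_cmult) simp
    also have "\<dots> \<le> ennreal C * ennreal (K * B)"
      by (intro mult_left_mono K(2) b) auto
    also have "\<dots> = ennreal (C * (K * B))" by (rule ennreal_mult'[OF \<phi>(1), symmetric])
    finally have le: "(\<integral>\<^sup>+x. ennreal (norm (b x * \<phi> x)) \<partial>count_space UNIV) \<le> ennreal (C * (K * B))" .
    then have int: "integrable (count_space UNIV) (\<lambda>x. b x * \<phi> x)"
      by (simp add: integrable_iff_bounded le_less_trans[OF _ ennreal_less_top])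
    moreover have "ennreal (\<integral>x. norm (b x * \<phi> x) \<partial>count_space UNIV) \<le> ennreal (C * (K * B))"
      using le by (subst nn_integral_eq_integral[symmetric]) (use int in auto)
    moreover have "0 \<le> B" using b by (simp add: unit_mass_le_def)
    ultimately show ?thesis using K(1) \<phi>(1) by (subst (asm) ennreal_le_iff) auto
  qed
  then show ?thesis using K(1) by blast
qed

lemma unit_mass_le_schwartz_integrable:
  assumes "unit_mass_le b B" "schwartz \<phi>"
  shows "integrable (count_space UNIV) (\<lambda>x. b x * \<phi> x)"
  using schwartz_le_weight[OF assms(2)] unit_mass_le_integrable assms(1) by metis

text \<open>
  Multiplying the measure by a character translates its Fourier transform, which does not change the
  bound on unit balls; scalar multiples and absolutely convergent series act on the transform term by
  term.  Induction over the Wiener algebra therefore transfers a norm bound r into the bound r B.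
\<close>

lemma wiener_multiplier:
  fixes a b :: "'a::euclidean_space mass"
  assumes a: "\<And>\<phi>. schwartz \<phi> \<Longrightarrow> integrable (count_space UNIV) (\<lambda>x. a x * fourier \<phi> x)"
    and ab: "\<And>\<phi>. schwartz \<phi> \<Longrightarrow>
      (\<integral>x. a x * fourier \<phi> x \<partial>count_space UNIV) = (\<integral>x. b x * \<phi> x \<partial>count_space UNIV)"
    and b_mass: "unit_mass_le b B"
    and g: "wiener_le g r"
  shows "\<exists>c. unit_mass_le c (r * B) \<and>
    (\<forall>\<phi>. schwartz \<phi> \<longrightarrow>
      (\<integral>x. a x * g x * fourier \<phi> x \<partial>count_space UNIV) = (\<integral>x. c x * \<phi> x \<partial>count_space UNIV))"
proof -
  have b: "countable (atoms b)" "0 \<le> B" "\<And>x. emeasure (variation b) (ball x 1) \<le> ennreal B"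
    using b_mass by (auto simp: unit_mass_le_def)
  have mass: "unit_mass_le c (s * B)"
    if "countable (atoms c)" "\<And>x. emeasure (variation c) (ball x 1) \<le> ennreal (s * B)" "wiener_le f s"
    for c :: "'a mass" and s and f :: "'a \<Rightarrow> complex"
    using that(1,2) b(2) wiener_le_nonneg[OF that(3)] by (auto simp: unit_mass_le_def)
  show ?thesis
    using g
  proof (induction rule: wiener_le.induct)
    case (character \<omega>)
    define c where "c z = b (z - \<omega>)" for z
    have bij: "bij_betw (\<lambda>z. z - \<omega>) UNIV (UNIV :: 'a set)"
      by (rule bij_betw_byWitness[where f' = "\<lambda>z. z + \<omega>"]) auto
    have "atoms c = (\<lambda>z. z + \<omega>) ` atoms b"
      by (force simp: atoms_def c_def image_iff)
    then have "countable (atoms c)" using b(1) by simp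
    moreover have "emeasure (variation c) (ball x 1) \<le> ennreal (1 * B)" for x
    proof -
      have "emeasure (variation c) (ball x 1) =
          (\<integral>\<^sup>+z. ennreal (norm (b (z - \<omega>))) * indicator (ball (x - \<omega>) 1) (z - \<omega>) \<partial>count_space UNIV)"
        unfolding emeasure_variation c_def by (intro nn_integral_cong) (auto simp: indicator_def dist_norm)
      also have "\<dots> = emeasure (variation b) (ball (x - \<omega>) 1)"
        unfolding emeasure_variation by (rule nn_integral_bij_count_space[OF bij])
      finally show ?thesis using b(3) by simp
    qed
    ultimately have "unit_mass_le c (1 * B)"
      using wiener_le.character by (rule mass)
    moreover have "(\<integral>x. a x * character \<omega> x * fourier \<phi> x \<partial>count_space UNIV) = (\<integral>x. c x * \<phi> x \<partial>count_space UNIV)"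
      if \<phi>: "schwartz \<phi>" for \<phi>
    proof -
      have "(\<integral>x. a x * character \<omega> x * fourier \<phi> x \<partial>count_space UNIV) =
          (\<integral>x. a x * fourier (\<lambda>x. \<phi> (x + \<omega>)) x \<partial>count_space UNIV)"
        by (simp add: fourier_shift[OF schwartz_measurable[OF \<phi>]] mult.assoc)
      also have "\<dots> = (\<integral>x. b x * \<phi> (x + \<omega>) \<partial>count_space UNIV)"
        by (rule ab[OF schwartz_shift[OF \<phi>]])
      also have "\<dots> = (\<integral>z. b (z - \<omega>) * \<phi> (z - \<omega> + \<omega>) \<partial>count_space UNIV)"
        by (rule integral_bij_count_space[OF bij, symmetric])
      finally show ?thesis by (simp add: c_def)
    qed
    ultimately show ?case by blast
  next
    case (scale f r k)
    then obtain c where c': "unit_mass_le c (r * B)"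
      and c_eq: "\<And>\<phi>. schwartz \<phi> \<Longrightarrow>
        (\<integral>x. a x * f x * fourier \<phi> x \<partial>count_space UNIV) = (\<integral>x. c x * \<phi> x \<partial>count_space UNIV)" by blast
    have c: "countable (atoms c)" "\<And>x. emeasure (variation c) (ball x 1) \<le> ennreal (r * B)"
      using c' by (auto simp: unit_mass_le_def)
    have "countable (atoms (\<lambda>x. c x * k))"
      by (rule countable_subset[OF _ c(1)]) (auto simp: atoms_def)
    moreover have "emeasure (variation (\<lambda>x. c x * k)) (ball x 1) \<le> ennreal (norm k * r * B)" for x
    proof -
      have "emeasure (variation (\<lambda>x. c x * k)) (ball x 1) \<le> ennreal (norm k) * emeasure (variation c) (ball x 1)"
        by (rule variation_mult_le) auto
      also have "\<dots> \<le> ennreal (norm k) * ennreal (r * B)" by (intro mult_left_mono c) auto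
      finally show ?thesis by (simp add: ennreal_mult'[symmetric] mult.assoc)
    qed
    ultimately have "unit_mass_le (\<lambda>x. c x * k) (norm k * r * B)"
      using wiener_le.scale[OF scale.hyps] by (rule mass)
    moreover have "(\<integral>x. a x * (k * f x) * fourier \<phi> x \<partial>count_space UNIV) = (\<integral>x. c x * k * \<phi> x \<partial>count_space UNIV)"
      if "schwartz \<phi>" for \<phi>
    proof -
      have "(\<integral>x. a x * (k * f x) * fourier \<phi> x \<partial>count_space UNIV) = (\<integral>x. k * (a x * f x * fourier \<phi> x) \<partial>count_space UNIV)"
        by (simp add: mult_ac)
      also have "\<dots> = k * (\<integral>x. c x * \<phi> x \<partial>count_space UNIV)"
        by (simp only: integral_mult_right_zero c_eq[OF that])
      also have "\<dots> = (\<integral>x. k * (c x * \<phi> x) \<partial>count_space UNIV)"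
        by (simp only: integral_mult_right_zero)
      finally show ?thesis by (simp add: mult_ac)
    qed
    ultimately show ?case by blast
  next
    case (series f r)
    obtain c where c': "\<And>n. unit_mass_le (c n) (r n * B)"
      and c_eq: "\<And>n \<phi>. schwartz \<phi> \<Longrightarrow>
        (\<integral>x. a x * f n x * fourier \<phi> x \<partial>count_space UNIV) = (\<integral>x. c n x * \<phi> x \<partial>count_space UNIV)"
      using series.IH by metis
    have c: "countable (atoms (c n))" "emeasure (variation (c n)) (ball x 1) \<le> ennreal (r n * B)" for n x
      using c'[of n] by (auto simp: unit_mass_le_def)
    have r: "0 \<le> r n" for n using series.hyps(1) by (rule wiener_le_nonneg)
    have rB: "summable (\<lambda>n. r n * B)" by (rule summable_mult2[OF series.hyps(2)])
    have c_le: "norm (c n x) \<le> r n * B" for n x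
    proof -
      have "ennreal (norm (c n x)) = emeasure (variation (c n)) {x}"
        unfolding emeasure_variation by (simp add: nn_integral_count_space_indicator[symmetric] mult_ac)
      also have "\<dots> \<le> emeasure (variation (c n)) (ball x 1)"
        by (rule emeasure_mono) (auto simp: variation_def)
      also have "\<dots> \<le> ennreal (r n * B)" by (rule c)
      finally show ?thesis using r b(2) by (subst (asm) ennreal_le_iff) auto
    qed
    have c_summable: "summable (\<lambda>n. norm (c n x))" for x
      by (rule summable_comparison_test'[OF rB, of 0]) (use c_le in simp)
    define d where "d x = (\<Sum>n. c n x)" for x
    have "atoms d \<subseteq> (\<Union>n. atoms (c n))"
    proof
      fix x assume "x \<in> atoms d"
      then have "\<exists>n. c n x \<noteq> 0" by (cases "\<forall>n. c n x = 0") (auto simp: atoms_def d_def)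
      then show "x \<in> (\<Union>n. atoms (c n))" by (auto simp: atoms_def)
    qed
    then have "countable (atoms d)" by (rule countable_subset) (use c(1) in auto)
    moreover have "emeasure (variation d) (ball x 1) \<le> ennreal (suminf r * B)" for x
    proof -
      have "emeasure (variation d) (ball x 1) \<le> (\<integral>\<^sup>+z. (\<Sum>n. ennreal (norm (c n z)) * indicator (ball x 1) z) \<partial>count_space UNIV)"
        unfolding emeasure_variation
      proof (rule nn_integral_mono)
        fix z
        have "ennreal (norm (d z)) \<le> ennreal (\<Sum>n. norm (c n z))"
          unfolding d_def by (intro ennreal_leI summable_norm c_summable)
        also have "\<dots> = (\<Sum>n. ennreal (norm (c n z)))"
          by (rule suminf_ennreal2[symmetric]) (use c_summable in auto)
        finally show "ennreal (norm (d z)) * indicator (ball x 1) z \<le> (\<Sum>n. ennreal (norm (c n z)) * indicator (ball x 1) z)"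
          by (auto simp: indicator_def)
      qed
      also have "\<dots> = (\<Sum>n. emeasure (variation (c n)) (ball x 1))"
        unfolding emeasure_variation by (rule nn_integral_suminf) simp
      also have "\<dots> \<le> (\<Sum>n. ennreal (r n * B))" by (intro suminf_le c) auto
      also have "\<dots> = ennreal (\<Sum>n. r n * B)"
        by (rule suminf_ennreal2[OF _ rB]) (use r b(2) in auto)
      finally show ?thesis by (simp add: suminf_mult2[OF series.hyps(2)])
    qed
    ultimately have "unit_mass_le d (suminf r * B)"
      using wiener_le.series[OF series.hyps] by (rule mass)
    moreover have "(\<integral>x. a x * (\<Sum>n. f n x) * fourier \<phi> x \<partial>count_space UNIV) = (\<integral>x. d x * \<phi> x \<partial>count_space UNIV)"
      if \<phi>: "schwartz \<phi>" for \<phi>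
    proof -
      let ?M = "count_space UNIV :: 'a measure"
      have le: "norm (a x * f n x * fourier \<phi> x) \<le> norm (a x * fourier \<phi> x) * r n" for n x
        using mult_left_mono[OF wiener_le_norm[OF series.hyps(1), of n x], of "norm (a x * fourier \<phi> x)"]
        by (simp add: norm_mult mult_ac)
      have int1: "integrable ?M (\<lambda>x. a x * f n x * fourier \<phi> x)" for n
        by (rule Bochner_Integration.integrable_bound[OF integrable_mult_left[OF integrable_norm[OF a[OF \<phi>]], of "r n"]])
          (use le r in \<open>auto simp: abs_mult\<close>)
      have "(\<integral>x. a x * (\<Sum>n. f n x) * fourier \<phi> x \<partial>?M) = (\<integral>x. (\<Sum>n. a x * f n x * fourier \<phi> x) \<partial>?M)"
      proof (intro Bochner_Integration.integral_cong refl)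
        fix x
        have s: "summable (\<lambda>n. f n x)" by (rule wiener_le_summable[OF series.hyps])
        show "a x * (\<Sum>n. f n x) * fourier \<phi> x = (\<Sum>n. a x * f n x * fourier \<phi> x)"
          by (subst suminf_mult2[OF summable_mult[OF s], symmetric], subst suminf_mult[OF s]) simp
      qed
      also have "\<dots> = (\<Sum>n. \<integral>x. a x * f n x * fourier \<phi> x \<partial>?M)"
      proof (rule integral_suminf[OF int1])
        show "AE x in ?M. summable (\<lambda>n. norm (a x * f n x * fourier \<phi> x))"
        proof (intro AE_I2)
          fix x :: 'a
          show "summable (\<lambda>n. norm (a x * f n x * fourier \<phi> x))"
            by (rule summable_comparison_test'[OF summable_mult[OF series.hyps(2)], of 0]) (use le in simp)
        qed
        have "norm (\<integral>x. norm (a x * f n x * fourier \<phi> x) \<partial>?M) \<le> (\<integral>x. norm (a x * fourier \<phi> x) \<partial>?M) * r n" for n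
        proof -
          have "(\<integral>x. norm (a x * f n x * fourier \<phi> x) \<partial>?M) \<le> (\<integral>x. norm (a x * fourier \<phi> x) * r n \<partial>?M)"
            by (intro integral_mono integrable_norm int1 integrable_mult_left a[OF \<phi>] le)
          then show ?thesis by simp
        qed
        then show "summable (\<lambda>n. \<integral>x. norm (a x * f n x * fourier \<phi> x) \<partial>?M)"
          by (intro summable_comparison_test'[OF summable_mult[OF series.hyps(2)], of 0]) auto
      qed
      also have "\<dots> = (\<Sum>n. \<integral>x. c n x * \<phi> x \<partial>?M)" by (simp only: c_eq[OF \<phi>])
      also have "\<dots> = (\<integral>x. (\<Sum>n. c n x * \<phi> x) \<partial>?M)"
      proof -
        obtain C where C: "0 \<le> C" "\<And>x. norm (\<phi> x) \<le> C * weight x" using schwartz_le_weight[OF \<phi>] by blast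
        obtain K where K: "0 \<le> K"
          "\<And>n. integrable ?M (\<lambda>x. c n x * \<phi> x) \<and> (\<integral>x. norm (c n x * \<phi> x) \<partial>?M) \<le> C * (K * (r n * B))"
          using unit_mass_le_integrable[where 'a = 'a] c' C by metis
        show ?thesis
        proof (rule integral_suminf[symmetric])
          show "integrable ?M (\<lambda>x. c n x * \<phi> x)" for n using K(2) by blast
          show "AE x in ?M. summable (\<lambda>n. norm (c n x * \<phi> x))"
            using summable_mult2[OF c_summable] by (auto simp: norm_mult)
          have "summable (\<lambda>n. C * (K * (r n * B)))" by (intro summable_mult rB)
          then show "summable (\<lambda>n. \<integral>x. norm (c n x * \<phi> x) \<partial>?M)"
            by (rule summable_comparison_test'[where N = 0]) (use K(2) in auto)
        qed
      qed
      also have "\<dots> = (\<integral>x. d x * \<phi> x \<partial>?M)"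
        unfolding d_def using suminf_mult2[OF summable_norm_cancel[OF c_summable]] by simp
      finally show ?thesis .
    qed
    ultimately show ?case by blast
  next
    case (mono f r s)
    then have "unit_mass_le c (s * B)" if "unit_mass_le c (r * B)" for c :: "'a mass"
      using that mult_right_mono[OF mono.hyps(2) b(2)]
      by (auto simp: unit_mass_le_def intro: order_trans ennreal_leI)
    then show ?case using mono.IH by blast
  qed
qed

text \<open>
  The masses themselves extend to an element of the Wiener algebra; this is where uniform
  discreteness of the atoms enters.
\<close>

lemma atoms_value_in_wiener:
  fixes a b :: "'a::euclidean_space mass"
  assumes a: "atomic_measure a" "slowly_increasing a" "uniform_discrete (atoms a)"
    and b: "unit_mass_le b B"
    and ab: "\<And>\<phi>. schwartz \<phi> \<Longrightarrow> integrable (count_space UNIV) (\<lambda>x. a x * fourier \<phi> x)"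
      "\<And>\<phi>. schwartz \<phi> \<Longrightarrow>
        (\<integral>x. a x * fourier \<phi> x \<partial>count_space UNIV) = (\<integral>x. b x * \<phi> x \<partial>count_space UNIV)"
  shows "\<exists>F r. wiener_le F r \<and> (\<forall>x\<in>atoms a. F x = a x)"
proof -
  obtain c :: "nat \<Rightarrow> complex" and lam where c: "\<And>n. c n \<noteq> 0 \<Longrightarrow> c n = a (lam n)"
    "bij_betw lam {n. c n \<noteq> 0} (atoms a)"
    "\<And>f. (\<integral>\<^sup>+x. ennreal (norm (a x)) * f x \<partial>count_space UNIV) = (\<Sum>n. ennreal (norm (c n)) * f (lam n))"
    "\<And>f. integrable (count_space UNIV) (\<lambda>x. a x * f x) \<Longrightarrow>
      (\<lambda>n. c n * f (lam n)) sums (\<integral>x. a x * f x \<partial>count_space UNIV)"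
    using atoms_enumeration[of a] a(1) unfolding atomic_measure_def by blast
  obtain d :: "nat \<Rightarrow> complex" and gam where d:
    "\<And>f. (\<integral>\<^sup>+x. ennreal (norm (b x)) * f x \<partial>count_space UNIV) = (\<Sum>n. ennreal (norm (d n)) * f (gam n))"
    "\<And>f. integrable (count_space UNIV) (\<lambda>x. b x * f x) \<Longrightarrow>
      (\<lambda>n. d n * f (gam n)) sums (\<integral>x. b x * f x \<partial>count_space UNIV)"
    using atoms_enumeration[of b] b unfolding unit_mass_le_def by blast
  obtain N where N: "(\<integral>\<^sup>+x. ennreal (norm (a x) / (1 + norm x) ^ N) \<partial>count_space UNIV) < \<infinity>"
    using slowly_increasing_weighted_sum[OF a(1,2)] by blast
  have "(\<Sum>n. ennreal (norm (c n) / (1 + norm (lam n)) ^ N)) =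
      (\<integral>\<^sup>+x. ennreal (norm (a x) / (1 + norm x) ^ N) \<partial>count_space UNIV)"
    using c(3)[of "\<lambda>x. ennreal (inverse ((1 + norm x) ^ N))"]
    by (simp add: ennreal_mult'[symmetric] divide_inverse)
  then have c_sum: "summable (\<lambda>n. norm (c n) / (1 + norm (lam n)) ^ N)"
    using N by (intro summable_suminf_not_top) auto
  have b_weight: "(\<integral>\<^sup>+x. ennreal (norm (b x) * weight (x + 0)) \<partial>count_space UNIV) < \<infinity>"
  proof -
    obtain K where "(\<integral>\<^sup>+x. ennreal (norm (b x) * weight (x + 0)) \<partial>count_space UNIV) \<le> ennreal (K * B)"
      using unit_mass_le_weight_sum[where 'a = 'a] b by blast
    then show ?thesis using le_less_trans[OF _ ennreal_less_top] by simp
  qed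
  have "(\<Sum>n. ennreal (norm (d n) * weight (gam n))) = (\<integral>\<^sup>+x. ennreal (norm (b x) * weight x) \<partial>count_space UNIV)"
    using d(1)[of "\<lambda>x. ennreal (weight x)"] by (simp add: ennreal_mult'[symmetric])
  then have d_sum: "summable (\<lambda>n. norm (d n) * weight (gam n))"
    using b_weight by (intro summable_suminf_not_top) auto
  obtain \<epsilon> where \<epsilon>: "0 < \<epsilon>" "\<And>x y. x \<in> atoms a \<Longrightarrow> y \<in> atoms a \<Longrightarrow> dist x y < \<epsilon> \<Longrightarrow> x = y"
    using a(3) unfolding uniform_discrete_def by blast
  have sep: "\<epsilon> \<le> norm (lam m - lam n)" if "c m \<noteq> 0" "c n \<noteq> 0" "m \<noteq> n" for m n
  proof (rule ccontr)
    assume "\<not> \<epsilon> \<le> norm (lam m - lam n)"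
    moreover have "lam m \<in> atoms a" "lam n \<in> atoms a"
      using c(2) that by (auto simp: bij_betw_def)
    ultimately have "lam m = lam n" by (intro \<epsilon>(2)) (auto simp: dist_norm)
    then show False using c(2) that by (auto simp: bij_betw_def inj_on_def)
  qed
  have "(\<Sum>n. c n * fourier \<phi> (lam n)) = (\<Sum>n. d n * \<phi> (gam n))" if "schwartz \<phi>" for \<phi>
    using c(4)[OF ab(1)[OF that]] d(2)[OF unit_mass_le_schwartz_integrable[OF b that]] ab(2)[OF that] by (simp add: sums_iff)
  from atoms_interpolation[OF c_sum d_sum \<epsilon>(1) sep this]
  obtain F r where F: "wiener_le F r" "\<And>n. c n \<noteq> 0 \<Longrightarrow> F (lam n) = c n" by blast
  have "F x = a x" if x: "x \<in> atoms a" for x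
  proof -
    obtain n where "c n \<noteq> 0" "x = lam n"
      using c(2) x by (auto simp: bij_betw_def)
    then show ?thesis using F(2) c(1) by simp
  qed
  then show ?thesis using F(1) by blast
qed

theorem theorem8:
  fixes a b :: "'a::euclidean_space mass" and h :: "complex \<Rightarrow> complex" and U :: "complex set"
  assumes "fourier_quasicrystal a"
    and "uniform_discrete (atoms a)"
    and "fourier_measure a b" and "translation_bounded b"
    and "open U" and "closure (a ` atoms a) \<subseteq> U" and "h holomorphic_on U"
  shows "fourier_quasicrystal (\<lambda>x. a x * h (a x)) \<and>
         (\<exists>c. fourier_measure (\<lambda>x. a x * h (a x)) c \<and> translation_bounded c)"
proof -
  have a: "atomic_measure a" "slowly_increasing a"
    using assms(1) by (auto simp: fourier_quasicrystal_def)
  have b: "countable (atoms b)" "distr_eq (fourier_distr (distr_of a)) (distr_of b)"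
    using assms(3) by (auto simp: fourier_measure_def atomic_measure_def)
  obtain B where B: "unit_mass_le b B"
    using translation_bounded_imp_unit_mass_le[OF b(1) assms(4)] by blast
  have int_fourier: "integrable (count_space UNIV) (\<lambda>x. a x * fourier \<phi> x)" if \<phi>: "schwartz \<phi>" for \<phi>
  proof -
    obtain N where N: "(\<integral>\<^sup>+x. ennreal (norm (a x) / (1 + norm x) ^ N) \<partial>count_space UNIV) < \<infinity>"
      using slowly_increasing_weighted_sum[OF a] by blast
    obtain C where C: "0 \<le> C" "\<And>y. norm (fourier \<phi> y) \<le> C / (1 + norm y) ^ N"
      using fourier_schwartz_decay[OF \<phi>] by blast
    show ?thesis
    proof (rule Bochner_Integration.integrable_bound)
      show "integrable (count_space UNIV) (\<lambda>x. C * (norm (a x) / (1 + norm x) ^ N))"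
        using N by (intro integrable_mult_right) (simp add: integrable_iff_bounded)
      show "AE x in count_space UNIV. norm (a x * fourier \<phi> x) \<le> norm (C * (norm (a x) / (1 + norm x) ^ N))"
      proof (intro AE_I2)
        fix x
        show "norm (a x * fourier \<phi> x) \<le> norm (C * (norm (a x) / (1 + norm x) ^ N))"
          using mult_left_mono[OF C(2)[of x], of "norm (a x)"] C(1) by (simp add: norm_mult mult_ac)
      qed
    qed simp
  qed
  have ab: "(\<integral>x. a x * fourier \<phi> x \<partial>count_space UNIV) = (\<integral>x. b x * \<phi> x \<partial>count_space UNIV)"
    if "schwartz \<phi>" for \<phi>
    using b(2) that distr_of_eq_integral[OF int_fourier[OF that]]
      distr_of_eq_integral[OF unit_mass_le_schwartz_integrable[OF B that]]
    by (simp add: distr_eq_def fourier_distr_def)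
  obtain F r where F: "wiener_le F r" "\<And>x. x \<in> atoms a \<Longrightarrow> F x = a x"
    using atoms_value_in_wiener[OF a assms(2) B int_fourier ab] by blast
  have "F ` atoms a = a ` atoms a" using F(2) by (intro image_cong) auto
  then have "wiener_on (atoms a) (\<lambda>x. h (F x))"
    using local_wiener_levy[OF F(1) assms(5) _ assms(7)] assms(6) by metis
  then obtain g R where g: "wiener_le g R" "\<And>x. x \<in> atoms a \<Longrightarrow> g x = h (a x)"
    unfolding wiener_on_def using F(2) by metis
  have \<nu>: "a x * h (a x) = a x * g x" for x
    by (cases "a x = 0") (simp_all add: g(2) atoms_def)
  have R: "0 \<le> R" "\<And>x. norm (g x) \<le> R" using wiener_le_nonneg[OF g(1)] wiener_le_norm[OF g(1)] by auto
  let ?\<nu> = "\<lambda>x. a x * g x"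
  obtain c where c: "unit_mass_le c (R * B)"
    "\<And>\<phi>. schwartz \<phi> \<Longrightarrow>
      (\<integral>x. a x * g x * fourier \<phi> x \<partial>count_space UNIV) = (\<integral>x. c x * \<phi> x \<partial>count_space UNIV)"
    using wiener_multiplier[OF int_fourier ab B g(1)] by blast
  have c_tb: "translation_bounded c" by (rule unit_mass_le_imp_translation_bounded[OF c(1)])
  have "distr_eq (fourier_distr (distr_of ?\<nu>)) (distr_of c)"
    unfolding distr_eq_def fourier_distr_def
  proof (intro allI impI)
    fix \<phi> :: "'a \<Rightarrow> complex" assume \<phi>: "schwartz \<phi>"
    have "integrable (count_space UNIV) (\<lambda>x. a x * g x * fourier \<phi> x)"
    proof (rule Bochner_Integration.integrable_bound)
      show "integrable (count_space UNIV) (\<lambda>x. R * norm (a x * fourier \<phi> x))"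
        by (intro integrable_mult_right integrable_norm int_fourier \<phi>)
      show "AE x in count_space UNIV. norm (a x * g x * fourier \<phi> x) \<le> norm (R * norm (a x * fourier \<phi> x))"
      proof (intro AE_I2)
        fix x
        show "norm (a x * g x * fourier \<phi> x) \<le> norm (R * norm (a x * fourier \<phi> x))"
          using mult_right_mono[OF R(2)[of x], of "norm (a x * fourier \<phi> x)"] R(1) by (simp add: norm_mult mult_ac)
      qed
    qed simp
    then show "distr_of ?\<nu> (fourier \<phi>) = distr_of c \<phi>"
      using c(2)[OF \<phi>] distr_of_eq_integral[of ?\<nu> "fourier \<phi>"]
        distr_of_eq_integral[OF unit_mass_le_schwartz_integrable[OF c(1) \<phi>]] by simp
  qed
  then have fm: "fourier_measure ?\<nu> c"
    unfolding fourier_measure_def using unit_mass_le_imp_slowly_increasing[OF c(1)] by blast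
  have \<nu>_le: "emeasure (variation ?\<nu>) A \<le> ennreal R * emeasure (variation a) A" for A
    by (rule variation_mult_le[OF R(2,1)])
  have "atomic_measure ?\<nu>"
    unfolding atomic_measure_def
  proof (intro conjI allI)
    show "countable (atoms ?\<nu>)"
      by (rule countable_subset[of _ "atoms a"]) (use a(1) in \<open>auto simp: atoms_def atomic_measure_def\<close>)
    fix r
    have "ennreal R * emeasure (variation a) (ball 0 r) < \<infinity>"
      using a(1) by (auto simp: atomic_measure_def ennreal_mult_less_top)
    then show "emeasure (variation ?\<nu>) (ball 0 r) < \<infinity>" by (rule le_less_trans[OF \<nu>_le])
  qed
  moreover have "slowly_increasing ?\<nu>"
  proof -
    obtain C N where CN: "\<forall>\<^sub>F r in at_top. emeasure (variation a) (ball 0 r) \<le> ennreal (C * r ^ N)"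
      using a(2) unfolding slowly_increasing_def by blast
    have "\<forall>\<^sub>F r in at_top. emeasure (variation ?\<nu>) (ball 0 r) \<le> ennreal (R * C * r ^ N)"
      using CN
    proof eventually_elim
      case (elim r)
      have "emeasure (variation ?\<nu>) (ball 0 r) \<le> ennreal R * ennreal (C * r ^ N)"
        using \<nu>_le[of "ball 0 r"] mult_left_mono[OF elim, of "ennreal R"] by (simp add: order_trans)
      then show ?case using R(1) by (simp add: ennreal_mult'[symmetric] mult.assoc)
    qed
    then show ?thesis unfolding slowly_increasing_def by blast
  qed
  ultimately show ?thesis
    unfolding \<nu> fourier_quasicrystal_def using fm c_tb by blast
qed

end
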